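(* Let $G$ be an AQ-graph with vertex set $V$ and let $B\in P_G$ be such that $B$ is a positive, self-adjoint operator on $L^2(V)$. Suppose that $B(x,y)\in\mathbb{Q}$ for all $x,y\in V$. If $\lambda$ is a point of discontinuity of the integrated density of states $\sigma_B$, then $\lambda$ is an algebraic number.
   Context: Graphs. $G=G(V,E)$ is an infinite, connected graph with bounded vertex degrees; $d_G$ is the shortest path distance, and $B_r(x)$ is the ball of radius $r$ around $x$, a finite graph (the induced subgraph) rooted at $x$. A F\o lner sequence in $G$ is a sequence $\{Q_n\}_{n=1}^\infty$ of non-empty finite subsets of $V$ with $\lim_{n\to\infty}|\partial Q_n|/|Q_n|=0$, where $\partial Q_n=\{p\in Q_n : \exists q\notin Q_n,\ (p,q)\in E\}$. $G$ is amenable if it has a F\o lner sequence. Vertices $x,y$ have the same $r$-pattern if there is a graph isomorphism $\phi:B_r(x)\to B_r(y)$ with $\phi(x)=y$; $P_r(G)$ is the finite set of $r$-patterns occurring in $G$. $G$ is an AQ-graph (abstract quasicrystal graph) if it is infinite, connected, of bounded degree, amenable, and for every $r$ and every $\alpha\in P_r(G)$ there is a number $P(\alpha)$ (the frequency) such that for any F\o lner sequence $\{Q_n\}$, $\lim_{n\to\infty}|Q_n^\alpha|/|Q_n|=P(\alpha)$, where $Q_n^\alpha\subseteq Q_n$ is the set of vertices of $Q_n$ having $r$-pattern $\alpha$. Pattern-invariant matrices. $P_G$ is the set of functions $A:V\times V\to\mathbb{C}$ for which there is $r_A$ (the propagation) such that $A(x,y)=0$ whenever $d_G(x,y)>r_A$,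 and $A(x,y)=A(\phi(x),\phi(y))$ for every graph isomorphism $\phi$ from the $r_A$-ball around $x$ to the $r_A$-ball around $\phi(x)$ mapping $x$ to $\phi(x)$, and every $y$ in the $r_A$-ball around $x$. $P_G$ is a unital $*$-algebra with matrix addition, matrix multiplication $AB(x,y)=\sum_z A(x,z)B(z,y)$ and $A^*(x,y)=\overline{A(y,x)}$, acting on $L^2(V)$ (square-summable functions) by $A(f)(x)=\sum_y A(x,y)f(y)$. Trace and von Neumann algebra. For $A\in P_G$, $\mathrm{Tr}_G(A)=\lim_{n\to\infty}\frac1{|Q_n|}\sum_{x\in Q_n}A(x,x)$ for a F\o lner sequence $\{Q_n\}$; the limit exists and is independent of the sequence. Let $H$ be the Hilbert space completion of $P_G$ for $\langle A,B\rangle=\mathrm{Tr}_G(B^*A)$ (after dividing by null vectors, if any). Left multiplication $L_A(B)=AB$ extends to a bounded operator on $H$; $N_G\subseteq B(H)$ is the weak operator closure of $\{L_A: A\in P_G\}$, $\psi_G:P_G\to N_G$ is $A\mapsto L_A$, and $\mathrm{Tr}_G$ extends to $N_G$ by $\mathrm{Tr}_G(T)=\langle T\mathbf 1,\mathbf 1\rangle$, with $\mathbf 1$ the class of the identity matrix. Integrated density of states. For positive self-adjoint $B\in P_G$, $\sigma_B(\lambda)=\mathrm{Tr}_G(\chi_{[0,\lambda]}(\psi_G(B)))$ for $\lambda\ge0$ (spectral projection by functional calculus), and $\sigma_B(\lambda)=0$ for $\lambda<0$. *)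

theory Defs
  imports "HOL-Analysis.Analysis" "HOL-Computational_Algebra.Computational_Algebra"
begin

section \<open>Graphs, patterns and AQ-graphs\<close>

record 'v graph =
  verts :: "'v set"
  edges :: "('v \<times> 'v) set"

definition simple_graph :: "'v graph \<Rightarrow> bool" where
  "simple_graph G \<longleftrightarrow> edges G \<subseteq> verts G \<times> verts G \<and> sym (edges G) \<and> irrefl (edges G)"

definition connected_graph :: "'v graph \<Rightarrow> bool" where
  "connected_graph G \<longleftrightarrow> (\<forall>x\<in>verts G. \<forall>y\<in>verts G. (x, y) \<in> (edges G)\<^sup>*)"

definition bounded_degree :: "'v graph \<Rightarrow> bool" where
  "bounded_degree G \<longleftrightarrow>
     (\<exists>d. \<forall>x\<in>verts G. finite (edges G `` {x}) \<and> card (edges G `` {x}) \<le> d)"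

text \<open>Meaningful only for vertices joined by a path; all graphs below are connected.\<close>

definition graph_dist :: "'v graph \<Rightarrow> 'v \<Rightarrow> 'v \<Rightarrow> nat" where
  "graph_dist G x y = (LEAST n. (x, y) \<in> edges G ^^ n)"

definition graph_ball :: "'v graph \<Rightarrow> nat \<Rightarrow> 'v \<Rightarrow> 'v set" where
  "graph_ball G r x = {y \<in> verts G. graph_dist G x y \<le> r}"

text \<open>Rooted isomorphisms between the subgraphs induced on two balls; only the values of
  \<open>\<phi>\<close> on the first ball matter.\<close>

definition ball_iso :: "'v graph \<Rightarrow> nat \<Rightarrow> 'v \<Rightarrow> 'v \<Rightarrow> ('v \<Rightarrow> 'v) \<Rightarrow> bool" where
  "ball_iso G r x y \<phi> \<longleftrightarrow>
     bij_betw \<phi> (graph_ball G r x) (graph_ball G r y) \<and> \<phi> x = y \<and>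
     (\<forall>u\<in>graph_ball G r x. \<forall>v\<in>graph_ball G r x.
        (u, v) \<in> edges G \<longleftrightarrow> (\<phi> u, \<phi> v) \<in> edges G)"

definition same_pattern :: "'v graph \<Rightarrow> nat \<Rightarrow> ('v \<times> 'v) set" where
  "same_pattern G r = {(x, y). x \<in> verts G \<and> y \<in> verts G \<and> (\<exists>\<phi>. ball_iso G r x y \<phi>)}"

text \<open>An \<open>r\<close>-pattern occurring in \<open>G\<close> is identified with the set of all vertices that
  have it, so that \<open>Q\<^sup>\<alpha>\<close> becomes \<open>Q \<inter> \<alpha>\<close>.\<close>

definition patterns :: "'v graph \<Rightarrow> nat \<Rightarrow> 'v set set" where
  "patterns G r = verts G // same_pattern G r"

definition boundary :: "'v graph \<Rightarrow> 'v set \<Rightarrow> 'v set" where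
  "boundary G Q = {p \<in> Q. \<exists>q\<in>verts G - Q. (p, q) \<in> edges G}"

definition folner_sequence :: "'v graph \<Rightarrow> (nat \<Rightarrow> 'v set) \<Rightarrow> bool" where
  "folner_sequence G Q \<longleftrightarrow>
     (\<forall>n. finite (Q n) \<and> Q n \<noteq> {} \<and> Q n \<subseteq> verts G) \<and>
     (\<lambda>n. real (card (boundary G (Q n))) / real (card (Q n))) \<longlonglongrightarrow> 0"

definition amenable :: "'v graph \<Rightarrow> bool" where
  "amenable G \<longleftrightarrow> (\<exists>Q. folner_sequence G Q)"

definition AQ_graph :: "'v graph \<Rightarrow> bool" where
  "AQ_graph G \<longleftrightarrow>
     simple_graph G \<and> infinite (verts G) \<and> connected_graph G \<and> bounded_degree G \<and> amenable G \<and>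
     (\<forall>r. \<forall>\<alpha>\<in>patterns G r. \<exists>p::real. \<forall>Q. folner_sequence G Q \<longrightarrow>
        (\<lambda>n. real (card (Q n \<inter> \<alpha>)) / real (card (Q n))) \<longlonglongrightarrow> p)"


section \<open>Pattern-invariant matrices\<close>

text \<open>A function on \<open>V \<times> V\<close> is represented by a total function vanishing elsewhere.\<close>

type_synonym 'v matrix = "'v \<Rightarrow> 'v \<Rightarrow> complex"

definition pattern_invariant :: "'v graph \<Rightarrow> 'v matrix set" where
  "pattern_invariant G = {A.
     (\<forall>x y. x \<notin> verts G \<or> y \<notin> verts G \<longrightarrow> A x y = 0) \<and>
     (\<exists>r. (\<forall>x\<in>verts G. \<forall>y\<in>verts G. graph_dist G x y > r \<longrightarrow> A x y = 0) \<and>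
          (\<forall>x\<in>verts G. \<forall>x'\<in>verts G. \<forall>\<phi>. ball_iso G r x x' \<phi> \<longrightarrow>
             (\<forall>y\<in>graph_ball G r x. A x y = A (\<phi> x) (\<phi> y))))}"

definition mat_one :: "'v graph \<Rightarrow> 'v matrix" where
  "mat_one G = (\<lambda>x y. if x \<in> verts G \<and> x = y then 1 else 0)"

text \<open>The sum has only finitely many nonzero terms when the factors have finite propagation.\<close>

definition mat_mult :: "'v graph \<Rightarrow> 'v matrix \<Rightarrow> 'v matrix \<Rightarrow> 'v matrix" where
  "mat_mult G A B = (\<lambda>x y. \<Sum>\<^sub>\<infinity>z\<in>verts G. A x z * B z y)"

definition mat_star :: "'v matrix \<Rightarrow> 'v matrix" where
  "mat_star A = (\<lambda>x y. cnj (A y x))"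

definition l2 :: "'v graph \<Rightarrow> ('v \<Rightarrow> complex) set" where
  "l2 G = {f. (\<forall>x. x \<notin> verts G \<longrightarrow> f x = 0) \<and> (\<lambda>x. (cmod (f x))\<^sup>2) summable_on verts G}"

definition l2_inner :: "'v graph \<Rightarrow> ('v \<Rightarrow> complex) \<Rightarrow> ('v \<Rightarrow> complex) \<Rightarrow> complex" where
  "l2_inner G f g = (\<Sum>\<^sub>\<infinity>x\<in>verts G. f x * cnj (g x))"

definition mat_apply :: "'v graph \<Rightarrow> 'v matrix \<Rightarrow> ('v \<Rightarrow> complex) \<Rightarrow> 'v \<Rightarrow> complex" where
  "mat_apply G A f = (\<lambda>x. \<Sum>\<^sub>\<infinity>y\<in>verts G. A x y * f y)"

definition self_adjoint_on_l2 :: "'v graph \<Rightarrow> 'v matrix \<Rightarrow> bool" where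
  "self_adjoint_on_l2 G A \<longleftrightarrow>
     (\<forall>f\<in>l2 G. \<forall>g\<in>l2 G. l2_inner G (mat_apply G A f) g = l2_inner G f (mat_apply G A g))"

definition positive_on_l2 :: "'v graph \<Rightarrow> 'v matrix \<Rightarrow> bool" where
  "positive_on_l2 G A \<longleftrightarrow>
     (\<forall>f\<in>l2 G. l2_inner G (mat_apply G A f) f \<in> \<real> \<and> 0 \<le> Re (l2_inner G (mat_apply G A f) f))"

text \<open>On an AQ-graph the limit exists for every Folner sequence and does not depend on it.\<close>

definition mat_trace :: "'v graph \<Rightarrow> 'v matrix \<Rightarrow> complex" where
  "mat_trace G A = (THE t. \<forall>Q. folner_sequence G Q \<longrightarrow>
     (\<lambda>n. (\<Sum>x\<in>Q n. A x x) / of_nat (card (Q n))) \<longlonglongrightarrow> t)"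


section \<open>Inner product spaces, completion and Borel functional calculus\<close>

text \<open>Complex vector spaces with a positive semidefinite Hermitian form, linear in the first
  argument. They are carrier-based because the Hilbert space of \<open>G\<close> depends on the term \<open>G\<close>.\<close>

record 'a inner_space =
  vecs :: "'a set"
  vadd :: "'a \<Rightarrow> 'a \<Rightarrow> 'a"
  vscale :: "complex \<Rightarrow> 'a \<Rightarrow> 'a"
  inprod :: "'a \<Rightarrow> 'a \<Rightarrow> complex"

definition vnorm :: "'a inner_space \<Rightarrow> 'a \<Rightarrow> real" where
  "vnorm X x = sqrt (Re (inprod X x x))"

definition vdist :: "'a inner_space \<Rightarrow> 'a \<Rightarrow> 'a \<Rightarrow> real" where
  "vdist X x y = vnorm X (vadd X x (vscale X (-1) y))"

definition cauchy_seqs :: "'a inner_space \<Rightarrow> (nat \<Rightarrow> 'a) set" where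
  "cauchy_seqs X = {s. (\<forall>n. s n \<in> vecs X) \<and>
     (\<forall>e>0. \<exists>N. \<forall>m\<ge>N. \<forall>n\<ge>N. vdist X (s m) (s n) < e)}"

definition cauchy_equiv :: "'a inner_space \<Rightarrow> ((nat \<Rightarrow> 'a) \<times> (nat \<Rightarrow> 'a)) set" where
  "cauchy_equiv X = {(s, t). s \<in> cauchy_seqs X \<and> t \<in> cauchy_seqs X \<and>
     (\<lambda>n. vdist X (s n) (t n)) \<longlonglongrightarrow> 0}"

definition cclass :: "'a inner_space \<Rightarrow> (nat \<Rightarrow> 'a) \<Rightarrow> (nat \<Rightarrow> 'a) set" where
  "cclass X s = cauchy_equiv X `` {s}"

definition crep :: "(nat \<Rightarrow> 'a) set \<Rightarrow> nat \<Rightarrow> 'a" where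
  "crep c = (SOME s. s \<in> c)"

text \<open>Cauchy sequences modulo sequences at distance tending to \<open>0\<close>; in particular null vectors
  are divided out. The operations do not depend on the representatives.\<close>

definition hilbert_completion :: "'a inner_space \<Rightarrow> (nat \<Rightarrow> 'a) set inner_space" where
  "hilbert_completion X =
     \<lparr> vecs = cauchy_seqs X // cauchy_equiv X,
       vadd = (\<lambda>c d. cclass X (\<lambda>n. vadd X (crep c n) (crep d n))),
       vscale = (\<lambda>a c. cclass X (\<lambda>n. vscale X a (crep c n))),
       inprod = (\<lambda>c d. lim (\<lambda>n. inprod X (crep c n) (crep d n))) \<rparr>"

definition bounded_operator :: "'a inner_space \<Rightarrow> ('a \<Rightarrow> 'a) \<Rightarrow> bool" where
  "bounded_operator X T \<longleftrightarrow>
     T \<in> vecs X \<rightarrow>\<^sub>E vecs X \<and>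
     (\<forall>x\<in>vecs X. \<forall>y\<in>vecs X. T (vadd X x y) = vadd X (T x) (T y)) \<and>
     (\<forall>a. \<forall>x\<in>vecs X. T (vscale X a x) = vscale X a (T x)) \<and>
     (\<exists>K. \<forall>x\<in>vecs X. vnorm X (T x) \<le> K * vnorm X x)"

text \<open>For a bounded self-adjoint operator \<open>T\<close> on a Hilbert space, \<open>spectral_measure X T x\<close> is
  the spectral measure of \<open>T\<close> at the vector \<open>x\<close>, that is, the compactly supported measure
  with \<open>\<langle>p(T) x, x\<rangle> = \<integral> p d\<mu>\<close> for all polynomials \<open>p\<close>. The operator \<open>f(T)\<close> for a bounded Borel
  function \<open>f\<close> is then given by its quadratic form \<open>\<langle>f(T) x, x\<rangle> = \<integral> f d\<mu>\<close>.\<close>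

definition spectral_measure :: "'a inner_space \<Rightarrow> ('a \<Rightarrow> 'a) \<Rightarrow> 'a \<Rightarrow> real measure" where
  "spectral_measure X T x = (THE \<mu>.
     sets \<mu> = sets borel \<and> finite_measure \<mu> \<and> (\<exists>K. AE t in \<mu>. \<bar>t\<bar> \<le> K) \<and>
     (\<forall>k. inprod X ((T ^^ k) x) x = complex_of_real (LINT t|\<mu>. t ^ k)))"

definition borel_calculus ::
  "'a inner_space \<Rightarrow> ('a \<Rightarrow> 'a) \<Rightarrow> (real \<Rightarrow> complex) \<Rightarrow> 'a \<Rightarrow> 'a" where
  "borel_calculus X T f = (THE S. bounded_operator X S \<and>
     (\<forall>x\<in>vecs X. inprod X (S x) x = (LINT t|spectral_measure X T x. f t)))"


section \<open>The trace representation and the integrated density of states\<close>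

definition pattern_space :: "'v graph \<Rightarrow> 'v matrix inner_space" where
  "pattern_space G =
     \<lparr> vecs = pattern_invariant G,
       vadd = (\<lambda>A B x y. A x y + B x y),
       vscale = (\<lambda>a A x y. a * A x y),
       inprod = (\<lambda>A B. mat_trace G (mat_mult G (mat_star B) A)) \<rparr>"

definition trace_space :: "'v graph \<Rightarrow> (nat \<Rightarrow> 'v matrix) set inner_space" where
  "trace_space G = hilbert_completion (pattern_space G)"

definition left_mult ::
  "'v graph \<Rightarrow> 'v matrix \<Rightarrow> (nat \<Rightarrow> 'v matrix) set \<Rightarrow> (nat \<Rightarrow> 'v matrix) set" where
  "left_mult G A =
     (\<lambda>c\<in>vecs (trace_space G). cclass (pattern_space G) (\<lambda>n. mat_mult G A (crep c n)))"

definition one_vec :: "'v graph \<Rightarrow> (nat \<Rightarrow> 'v matrix) set" where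
  "one_vec G = cclass (pattern_space G) (\<lambda>_. mat_one G)"

text \<open>The set \<open>{left_mult G A |A. A \<in> pattern_invariant G}\<close> generates the von Neumann algebra
  \<open>N_G\<close> of \<open>G\<close>, on which \<open>T \<mapsto> \<langle>T 1, 1\<rangle>\<close> is the canonical trace. The formula itself makes sense
  for every operator; it is only applied to spectral projections of elements of \<open>N_G\<close>, which
  belong to \<open>N_G\<close> again.\<close>

definition vN_trace ::
  "'v graph \<Rightarrow> ((nat \<Rightarrow> 'v matrix) set \<Rightarrow> (nat \<Rightarrow> 'v matrix) set) \<Rightarrow> complex" where
  "vN_trace G T = inprod (trace_space G) (T (one_vec G)) (one_vec G)"

text \<open>The trace of a projection is real, so taking the real part only adjusts the type.\<close>

definition ids :: "'v graph \<Rightarrow> 'v matrix \<Rightarrow> real \<Rightarrow> real" where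
  "ids G B l = (if l < 0 then 0
     else Re (vN_trace G (borel_calculus (trace_space G) (left_mult G B) (indicator {0..l}))))"

end

theory Submission
  imports Defs "HOL-Probability.Probability" "Jordan_Normal_Form.Schur_Decomposition"
begin

text \<open>For \<open>t \<ge> 0\<close> the number \<open>ids G B t\<close> is the mass that the spectral measure \<open>\<mu>\<close> of left
multiplication by \<open>B\<close>, taken at the unit vector, gives to \<open>{0..t}\<close>. So a discontinuity is either
at the algebraic number 0 or at an atom \<open>l > 0\<close> of \<open>\<mu>\<close>, and it has to be shown that \<open>\<mu>\<close> has no
transcendental atoms.

The moments of \<open>\<mu>\<close> are the traces of the powers of \<open>B\<close>. Along a Folner sequence they are limits of
the normalised traces of the powers of the finite compressions of \<open>B\<close> to the sets \<open>Q n\<close>, because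
truncation is only felt near the boundary (\<open>folner_moments\<close>). Hence the normalised eigenvalue
counts of the compressions converge weakly to \<open>\<mu>\<close>, and it is enough to show that a short interval
around a transcendental \<open>l\<close> contains only a small proportion of their eigenvalues, uniformly in
\<open>n\<close>.

A pattern-invariant matrix has finitely many different entries, so after multiplication by a common
denominator the compressions are symmetric integer matrices. If \<open>f\<close> is an integer polynomial and
\<open>A\<close> a symmetric integer matrix, then the product of the nonzero values of \<open>f\<close> at the eigenvalues of
\<open>A\<close> is, up to sign, a coefficient of the characteristic polynomial of the integer matrix \<open>f(A)\<close>,
and therefore at least 1 in modulus (\<open>integer_matrix_eigenvalues\<close>). By the pigeonhole principle
there are integer polynomials that are extremely small at \<open>l\<close> compared with their size on the whole
spectrum (\<open>integer_poly_small_at_transcendental\<close>), and nonzero there because \<open>l\<close> is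
transcendental. Eigenvalues near \<open>l\<close> then contribute tiny nonzero factors to a product which
is at least 1, so they must be rare (\<open>few_small_values\<close>, \<open>rational_atom_zero\<close>).

To relate this to the integrated density of states one needs that the spectral measure and the
spectral projections exist and are unique. The completion of a semi-inner product space is
constructed in terms of inner products alone. Spectral measures come from the Hausdorff moment
problem, whose positivity condition holds since \<open>(K + T)^i (K - T)^j\<close> is a positive operator for
\<open>\<parallel>T\<parallel> \<le> K\<close> (\<open>hausdorff_moment\<close>, \<open>spectral_measure_exists\<close>). Spectral projections are
strong limits of polynomials in \<open>T\<close> (\<open>borel_calculus_form\<close>).\<close>

section \<open>Integer polynomials that are small at a transcendental number\<close>

text \<open>The pigeonhole principle, applied to the integer polynomials of degree at most \<open>d = m + 1\<close> with
coefficients in \<open>{0..H}\<close>. With \<open>C = (d + 1) M\<^sup>d\<close> their values at \<open>l\<close> lie in an interval of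
length \<open>2 H C\<close>, and there are \<open>(H + 1)\<^sup>d\<^sup>+\<^sup>1\<close> of them, so two differ at \<open>l\<close> by at most
\<open>2 C / H\<^sup>d\<close>. Their difference is bounded by \<open>F = H C\<close> on the whole of \<open>[-M, M]\<close>: the bound
grows like \<open>H\<close> while the value at \<open>l\<close> decays like the power \<open>m + 1\<close> of \<open>1 / H\<close>.\<close>

lemma integer_poly_small_at_transcendental:
  fixes l M :: real and m :: nat
  assumes M: "1 \<le> M" "\<bar>l\<bar> \<le> M" and tr: "\<not> algebraic l"
  obtains f :: "int poly" and F \<eta> :: real
  where "1 < F" "0 < \<eta>" "F ^ m * \<eta> \<le> 1"
    "\<And>t. \<bar>t\<bar> \<le> M \<Longrightarrow> \<bar>poly (of_int_poly f) t\<bar> \<le> F"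
    "0 < \<bar>poly (of_int_poly f) l\<bar>" "2 * \<bar>poly (of_int_poly f) l\<bar> \<le> \<eta>"
proof -
  define d where "d = m + 1"
  define C where "C = real (d + 1) * M ^ d"
  have C1: "1 < C"
  proof -
    have "1 \<le> M ^ d" using M by (simp add: one_le_power)
    then have "real (d + 1) * 1 \<le> C" unfolding C_def by (intro mult_left_mono) auto
    then show ?thesis by (simp add: d_def)
  qed
  define H where "H = nat \<lceil>4 * C ^ (m + 1)\<rceil>"
  have H4: "4 * C ^ (m + 1) \<le> real H" unfolding H_def by linarith
  have "1 < C ^ (m + 1)" using C1 by (intro one_less_power) auto
  then have H2: "4 \<le> H" using H4 by linarith
  define A where "A = ({..d} \<rightarrow>\<^sub>E {0..int H})"
  define val where "val = (\<lambda>xs t. \<Sum>i\<le>d. real_of_int (xs i) * t ^ i)"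
  define K where "K = H ^ (d + 1)"
  have Kpos: "0 < K" using H2 by (simp add: K_def)
  have val_bound: "\<bar>\<Sum>i\<le>d. real_of_int (c i) * t ^ i\<bar> \<le> real H * C"
    if c: "\<And>i. i \<le> d \<Longrightarrow> \<bar>c i\<bar> \<le> int H" and t: "\<bar>t\<bar> \<le> M" for c t
  proof -
    have "\<bar>real_of_int (c i) * t ^ i\<bar> \<le> real H * M ^ d" if "i \<le> d" for i
    proof -
      have "\<bar>real_of_int (c i)\<bar> \<le> real H" using c[OF that] by linarith
      moreover have "\<bar>t\<bar> ^ i \<le> M ^ d"
        by (rule order_trans[OF power_mono[OF t] power_increasing[OF that M(1)]]) auto
      ultimately show ?thesis unfolding abs_mult power_abs by (intro mult_mono) auto
    qed
    then have "\<bar>\<Sum>i\<le>d. real_of_int (c i) * t ^ i\<bar> \<le> (\<Sum>i\<le>d. real H * M ^ d)"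
      by (intro order_trans[OF sum_abs sum_mono]) auto
    then show ?thesis by (simp add: C_def algebra_simps)
  qed
  \<comment> \<open>the value at \<open>l\<close> rounded to a grid with \<open>K = H\<^sup>d\<^sup>+\<^sup>1\<close> steps; there are \<open>K + 1\<close> grid points\<close>
  define box where "box = (\<lambda>xs. nat \<lfloor>(val xs l + real H * C) * real K / (2 * real H * C)\<rfloor>)"
  have HC: "0 < real H * C" using H2 C1 by simp
  have box: "box xs \<le> K" if "xs \<in> A" for xs
  proof -
    have "\<bar>val xs l\<bar> \<le> real H * C" unfolding val_def
      by (rule val_bound[OF _ M(2)]) (use that in \<open>auto simp: A_def PiE_iff\<close>)
    then have "val xs l + real H * C \<le> 2 * real H * C" by linarith
    then have "(val xs l + real H * C) * real K \<le> (2 * real H * C) * real K"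
      by (rule mult_right_mono) simp
    then have "(val xs l + real H * C) * real K / (2 * real H * C) \<le> real K"
      using HC by (simp add: divide_le_eq mult.commute)
    then show ?thesis unfolding box_def by linarith
  qed
  have "card A = (H + 1) ^ (d + 1)" unfolding A_def by (subst card_PiE) (auto simp: nat_add_distrib)
  moreover have "K + 1 < (H + 1) ^ (d + 1)"
  proof -
    have "H ^ 1 \<le> H ^ d" using H2 by (intro power_increasing) (auto simp: d_def)
    then have "K + 1 < H * H ^ d + H ^ d" using H2 by (simp add: K_def)
    also have "\<dots> = (H + 1) * H ^ d" by simp
    also have "\<dots> \<le> (H + 1) * (H + 1) ^ d" by (intro mult_left_mono power_mono) auto
    finally show ?thesis by simp
  qed
  ultimately have "card {..K} < card A" by simp
  moreover have "card (box ` A) \<le> card {..K}" using box by (intro card_mono) auto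
  ultimately have "\<not> inj_on box A" by (intro pigeonhole) linarith
  then obtain xs ys where xy: "xs \<in> A" "ys \<in> A" "box xs = box ys" "xs \<noteq> ys"
    by (auto simp: inj_on_def)
  define f where "f = (\<Sum>i\<le>d. monom (xs i - ys i) i)"
  have poly_f: "poly (of_int_poly f) t = (\<Sum>i\<le>d. real_of_int (xs i - ys i) * t ^ i)" for t :: real
    unfolding f_def by (simp add: of_int_poly_hom.hom_sum poly_sum poly_monom map_poly_monom)
  have coeff_f: "coeff f i = (if i \<le> d then xs i - ys i else 0)" for i
    unfolding f_def by (simp add: coeff_sum)
  have "f \<noteq> 0"
  proof
    assume "f = 0"
    then have "xs i = ys i" if "i \<le> d" for i using coeff_f[of i] that by simp
    then have "xs = ys" using xy(1,2) unfolding A_def by (intro PiE_ext) auto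
    then show False using xy(4) by simp
  qed
  have nz: "poly (of_int_poly f) l \<noteq> 0"
  proof
    assume "poly (of_int_poly f) l = 0"
    moreover have "(of_int_poly f :: real poly) \<noteq> 0" using \<open>f \<noteq> 0\<close> by simp
    ultimately have "algebraic l" unfolding algebraic_def
      by (intro exI[of _ "of_int_poly f"]) auto
    then show False using tr by simp
  qed
  have small: "\<bar>poly (of_int_poly f) l\<bar> \<le> 2 * C / real H ^ d"
  proof -
    define u where "u = (\<lambda>zs. (val zs l + real H * C) * real K / (2 * real H * C))"
    have nn: "0 \<le> u zs" if "zs \<in> A" for zs
    proof -
      have "\<bar>val zs l\<bar> \<le> real H * C" unfolding val_def
        by (rule val_bound[OF _ M(2)]) (use that in \<open>auto simp: A_def PiE_iff\<close>)
      then show ?thesis unfolding u_def using HC C1 by (intro divide_nonneg_nonneg mult_nonneg_nonneg) auto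
    qed
    have "nat \<lfloor>u xs\<rfloor> = nat \<lfloor>u ys\<rfloor>" using xy(3) by (simp add: box_def u_def)
    then have "\<bar>u xs - u ys\<bar> \<le> 1" using nn[OF xy(1)] nn[OF xy(2)] by linarith
    moreover have "u xs - u ys = poly (of_int_poly f) l * (real K / (2 * real H * C))"
      unfolding u_def poly_f val_def
      by (simp add: diff_divide_distrib[symmetric] left_diff_distrib[symmetric] sum_subtractf[symmetric])
    ultimately have "\<bar>poly (of_int_poly f) l\<bar> * (real K / (2 * real H * C)) \<le> 1"
      using Kpos C1 by (simp add: abs_mult)
    then show ?thesis using H2 C1 by (simp add: K_def field_simps)
  qed
  show thesis
  proof (rule that)
    show "1 < real H * C" using H2 C1 by (simp add: less_1_mult)
    show "0 < 4 * C / real H ^ d" using H2 C1 by simp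
    have "(real H * C) ^ m * (4 * C / real H ^ d) = 4 * C ^ (m + 1) / real H"
      using H2 by (simp add: d_def power_mult_distrib field_simps)
    also have "\<dots> \<le> 1" using H4 H2 by simp
    finally show "(real H * C) ^ m * (4 * C / real H ^ d) \<le> 1" .
    show "\<bar>poly (of_int_poly f) t\<bar> \<le> real H * C" if "\<bar>t\<bar> \<le> M" for t
      unfolding poly_f
    proof (rule val_bound[OF _ that])
      fix i assume "i \<le> d"
      then have "xs i \<in> {0..int H}" "ys i \<in> {0..int H}" using xy(1,2) by (auto simp: A_def)
      then show "\<bar>xs i - ys i\<bar> \<le> int H" by auto
    qed
    show "0 < \<bar>poly (of_int_poly f) l\<bar>" using nz by simp
    show "2 * \<bar>poly (of_int_poly f) l\<bar> \<le> 4 * C / real H ^ d" using small by simp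
  qed
qed

section \<open>Eigenvalues of symmetric integer matrices\<close>

text \<open>Powers of the compression of \<open>A\<close> to \<open>Q\<close>. Sums over an arbitrary set, instead of matrices of a
fixed dimension, make it possible to apply this directly to subsets of a graph.\<close>

primrec fin_mat_power :: "'v set \<Rightarrow> ('v \<Rightarrow> 'v \<Rightarrow> 'a::comm_ring_1) \<Rightarrow> nat \<Rightarrow> 'v \<Rightarrow> 'v \<Rightarrow> 'a" where
  "fin_mat_power Q A 0 = (\<lambda>x y. if x = y then 1 else 0)"
| "fin_mat_power Q A (Suc k) = (\<lambda>x y. \<Sum>z\<in>Q. A x z * fin_mat_power Q A k z y)"

definition mat_diag_sum :: "'a::comm_ring_1 mat \<Rightarrow> 'a" where
  "mat_diag_sum X = (\<Sum>i<dim_row X. X $$ (i, i))"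

lemma mat_diag_sum_comm:
  assumes "X \<in> carrier_mat n n" "Y \<in> carrier_mat n n"
  shows "mat_diag_sum (X * Y) = mat_diag_sum (Y * X)"
proof -
  have "mat_diag_sum (X * Y) = (\<Sum>i<n. \<Sum>j<n. X $$ (i, j) * Y $$ (j, i))"
    unfolding mat_diag_sum_def using assms
    by (intro sum.cong) (auto simp: scalar_prod_def lessThan_atLeast0 intro!: sum.cong)
  also have "\<dots> = (\<Sum>j<n. \<Sum>i<n. Y $$ (j, i) * X $$ (i, j))"
    by (subst sum.swap) (simp add: mult.commute)
  also have "\<dots> = mat_diag_sum (Y * X)"
    unfolding mat_diag_sum_def using assms
    by (intro sum.cong) (auto simp: scalar_prod_def lessThan_atLeast0 intro!: sum.cong)
  finally show ?thesis .
qed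

lemma upper_triangular_mult_diag:
  fixes X Y :: "'a::comm_ring_1 mat"
  assumes X: "X \<in> carrier_mat n n" "upper_triangular X"
    and Y: "Y \<in> carrier_mat n n" "upper_triangular Y"
  shows "upper_triangular (X * Y)" "i < n \<Longrightarrow> (X * Y) $$ (i, i) = X $$ (i, i) * Y $$ (i, i)"
proof -
  have entry: "(X * Y) $$ (i, j) = (\<Sum>k<n. X $$ (i, k) * Y $$ (k, j))" if "i < n" "j < n" for i j
    using that X Y by (auto simp: scalar_prod_def lessThan_atLeast0 intro!: sum.cong)
  show "upper_triangular (X * Y)"
  proof (rule upper_triangularI)
    fix i j assume ij: "j < i" "i < dim_row (X * Y)"
    then have "i < n" "j < n" using X by auto
    moreover have "X $$ (i, k) * Y $$ (k, j) = 0" if "k < n" for k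
    proof (cases "k < i")
      case True then show ?thesis using X \<open>i < n\<close> by (simp add: upper_triangularD)
    next
      case False then show ?thesis using Y ij that by (simp add: upper_triangularD)
    qed
    ultimately show "(X * Y) $$ (i, j) = 0" using entry by simp
  qed
  assume i: "i < n"
  have "X $$ (i, k) * Y $$ (k, i) = (if k = i then X $$ (i, i) * Y $$ (i, i) else 0)" if k: "k < n" for k
  proof (cases k i rule: linorder_cases)
    case less
    then have "X $$ (i, k) = 0" using X i by (intro upper_triangularD) auto
    then show ?thesis using less by simp
  next
    case greater
    then have "Y $$ (k, i) = 0" using Y k by (intro upper_triangularD) auto
    then show ?thesis using greater by simp
  qed simp
  then have "(X * Y) $$ (i, i) = (\<Sum>k<n. if k = i then X $$ (i, i) * Y $$ (i, i) else 0)"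
    unfolding entry[OF i i] by (intro sum.cong) auto
  then show "(X * Y) $$ (i, i) = X $$ (i, i) * Y $$ (i, i)"
    using i by simp
qed

text \<open>The lowest nonvanishing coefficient of a split polynomial is, up to sign, the product of its nonzero
roots. For an integer polynomial it is a nonzero integer, which bounds that product from below.\<close>

lemma coeff_prod_linear_at_zero_roots:
  fixes as :: "'a::idom list"
  shows "coeff (\<Prod>a\<leftarrow>as. [:- a, 1:]) (length (filter (\<lambda>a. a = 0) as)) = (\<Prod>a\<leftarrow>filter (\<lambda>a. a \<noteq> 0) as. - a)"
proof -
  have split: "(\<Prod>a\<leftarrow>as. [:- a, 1:]) = monom 1 (length (filter (\<lambda>a. a = 0) as)) * (\<Prod>a\<leftarrow>filter (\<lambda>a. a \<noteq> 0) as. [:- a, 1:])"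
  proof (induction as)
    case (Cons a as)
    show ?case
    proof (cases "a = 0")
      case True
      then show ?thesis using Cons by (simp add: monom_Suc)
    next
      case False
      then have "(\<Prod>a\<leftarrow>a # as. [:- a, 1:]) = [:- a, 1:] * (monom 1 (length (filter (\<lambda>a. a = 0) as)) * (\<Prod>a\<leftarrow>filter (\<lambda>a. a \<noteq> 0) as. [:- a, 1:]))"
        by (simp only: list.map prod_list.Cons Cons)
      then show ?thesis using False by (simp only: filter.simps if_False if_True list.map prod_list.Cons mult.left_commute not_False_eq_True)
    qed
  qed simp
  have "coeff (\<Prod>a\<leftarrow>bs. [:- a, 1:]) 0 = (\<Prod>a\<leftarrow>bs. - a)" for bs :: "'a list"
    by (induction bs) (auto simp: coeff_mult)
  then show ?thesis unfolding split by (simp add: coeff_monom_mult)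
qed

lemma similar_upper_triangular_char_poly:
  fixes X V P P' :: "complex mat"
  assumes "V \<in> carrier_mat n n" "P \<in> carrier_mat n n" "P' \<in> carrier_mat n n"
    and "P * P' = 1\<^sub>m n" "P' * P = 1\<^sub>m n" "upper_triangular V" "X = P * V * P'"
  shows "char_poly X = (\<Prod>a\<leftarrow>diag_mat V. [:- a, 1:])"
proof -
  have "X \<in> carrier_mat n n" using assms(1-3,7) by simp
  then have "similar_mat_wit X V P P'"
    using assms(1-5,7) unfolding similar_mat_wit_def Let_def by (simp add: carrier_matD)
  then have "similar_mat X V" unfolding similar_mat_def by blast
  then have "char_poly X = char_poly V" by (rule char_poly_similar)
  also have "\<dots> = (\<Prod>a\<leftarrow>diag_mat V. [:- a, 1:])"
    by (rule char_poly_upper_triangular[OF assms(1,6)])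
  finally show ?thesis .
qed

text \<open>The form \<open>\<langle>A w, w\<rangle>\<close> equals its own conjugate, which makes \<open>e\<close> real; comparing the coordinate of
\<open>A w = e w\<close> at which \<open>w\<close> is largest gives the bound by row sums.\<close>

lemma symmetric_matrix_eigenvalue_bounds:
  fixes A :: "nat \<Rightarrow> nat \<Rightarrow> int" and M :: real and w :: "nat \<Rightarrow> complex"
  assumes sym: "\<And>i j. i < n \<Longrightarrow> j < n \<Longrightarrow> A i j = A j i"
    and bound: "\<And>i. i < n \<Longrightarrow> (\<Sum>j<n. real_of_int \<bar>A i j\<bar>) \<le> M"
    and eq: "\<And>i. i < n \<Longrightarrow> (\<Sum>j<n. of_int (A i j) * w j) = e * w i"
    and i0: "i0 < n" "w i0 \<noteq> 0"
  shows "Im e = 0" "cmod e \<le> M"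
proof -
  have "(\<Sum>i<n. cnj (w i) * (e * w i)) = (\<Sum>i<n. \<Sum>j<n. of_int (A i j) * (cnj (w i) * w j))"
    by (intro sum.cong refl) (simp add: eq[symmetric] sum_distrib_left mult_ac)
  also have "\<dots> = (\<Sum>i<n. \<Sum>j<n. of_int (A i j) * (w i * cnj (w j)))"
  proof (subst sum.swap, intro sum.cong refl)
    fix j i assume "j \<in> {..<n}" "i \<in> {..<n}"
    then have "A i j = A j i" using sym by simp
    then show "of_int (A i j) * (cnj (w i) * w j) = of_int (A j i) * (w j * cnj (w i))" by simp
  qed
  also have "\<dots> = cnj (\<Sum>i<n. \<Sum>j<n. of_int (A i j) * (cnj (w i) * w j))"
    by simp
  also have "\<dots> = cnj (\<Sum>i<n. cnj (w i) * (e * w i))"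
    by (intro arg_cong[where f = cnj] sum.cong refl) (simp add: eq[symmetric] sum_distrib_left mult_ac)
  finally have "(\<Sum>i<n. cnj (w i) * (e * w i)) = cnj (\<Sum>i<n. cnj (w i) * (e * w i))" .
  moreover have "(\<Sum>i<n. cnj (w i) * (e * w i)) = e * complex_of_real (\<Sum>i<n. (cmod (w i))\<^sup>2)"
    by (simp add: sum_distrib_left complex_norm_square[symmetric] mult_ac)
  ultimately have "e * complex_of_real (\<Sum>i<n. (cmod (w i))\<^sup>2) = cnj e * complex_of_real (\<Sum>i<n. (cmod (w i))\<^sup>2)"
    by simp
  moreover have "(\<Sum>i<n. (cmod (w i))\<^sup>2) > 0"
    using i0 by (intro sum_pos2[of _ i0]) auto
  ultimately have "e = cnj e" by (metis less_irrefl mult_right_cancel of_real_eq_0_iff)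
  then show "Im e = 0" by (simp add: complex_eq_iff)
  define S where "S = (\<lambda>i. cmod (w i)) ` {..<n}"
  have fin: "finite S" "S \<noteq> {}" using i0 by (auto simp: S_def)
  from Max_in[OF fin] obtain i where i: "i < n" "Max S = cmod (w i)"
    unfolding S_def by (rule imageE) simp
  have max: "cmod (w j) \<le> cmod (w i)" if "j < n" for j
    unfolding i(2)[symmetric] using that fin by (intro Max_ge) (auto simp: S_def)
  have "0 < cmod (w i0)" using i0(2) by simp
  then have wi: "0 < cmod (w i)" using max[OF i0(1)] by linarith
  have "cmod e * cmod (w i) = cmod (\<Sum>j<n. of_int (A i j) * w j)"
    using eq[OF i(1)] by (simp add: norm_mult)
  also have "\<dots> \<le> (\<Sum>j<n. real_of_int \<bar>A i j\<bar> * cmod (w i))"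
    by (rule sum_norm_le) (simp add: norm_mult max mult_left_mono)
  also have "\<dots> = (\<Sum>j<n. real_of_int \<bar>A i j\<bar>) * cmod (w i)"
    by (rule sum_distrib_right[symmetric])
  also have "\<dots> \<le> M * cmod (w i)"
    by (rule mult_right_mono[OF bound[OF i(1)]]) simp
  finally show "cmod e \<le> M" using wi by simp
qed

text \<open>\<open>X\<close> is conjugated by \<open>P\<close> to an upper triangular matrix with the numbers \<open>g e\<close> on the diagonal,
where \<open>P'\<close> is the inverse of \<open>P\<close>. If \<open>P\<close> triangularises \<open>A\<close> with diagonal \<open>es\<close>, this holds for
\<open>X = f(A)\<close> and \<open>g = f\<close> for every polynomial \<open>f\<close>. Working with the relation avoids polynomials of
matrices: it is stable under sums and products and determines trace and characteristic polynomial.\<close>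

definition triangular_rep ::
  "complex mat \<Rightarrow> complex mat \<Rightarrow> real list \<Rightarrow> complex mat \<Rightarrow> (real \<Rightarrow> real) \<Rightarrow> bool" where
  "triangular_rep P P' es X g \<longleftrightarrow> (\<exists>V \<in> carrier_mat (length es) (length es). upper_triangular V \<and>
     (\<forall>i<length es. V $$ (i, i) = complex_of_real (g (es ! i))) \<and> X = P * V * P')"

context
  fixes P P' :: "complex mat" and es :: "real list" and n :: nat
  assumes n: "n = length es" and Pc: "P \<in> carrier_mat n n" "P' \<in> carrier_mat n n"
    and PP: "P * P' = 1\<^sub>m n" "P' * P = 1\<^sub>m n"
begin

lemma triangular_repE:
  assumes "triangular_rep P P' es X g"
  obtains V where "V \<in> carrier_mat n n" "upper_triangular V"
    "\<And>i. i < n \<Longrightarrow> V $$ (i, i) = complex_of_real (g (es ! i))" "X = P * V * P'"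
  using assms unfolding triangular_rep_def n by blast

lemma triangular_repI:
  assumes "V \<in> carrier_mat n n" "upper_triangular V"
    "\<And>i. i < n \<Longrightarrow> V $$ (i, i) = complex_of_real (g (es ! i))" "X = P * V * P'"
  shows "triangular_rep P P' es X g"
  using assms unfolding triangular_rep_def n by blast

lemma triangular_rep_mult:
  assumes "triangular_rep P P' es X g" "triangular_rep P P' es Y h"
  shows "triangular_rep P P' es (X * Y) (\<lambda>t. g t * h t)"
proof -
  obtain U where U: "U \<in> carrier_mat n n" "upper_triangular U"
    "\<And>i. i < n \<Longrightarrow> U $$ (i, i) = complex_of_real (g (es ! i))" "X = P * U * P'"
    using assms(1) by (rule triangular_repE) blast
  obtain V where V: "V \<in> carrier_mat n n" "upper_triangular V"
    "\<And>i. i < n \<Longrightarrow> V $$ (i, i) = complex_of_real (h (es ! i))" "Y = P * V * P'"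
    using assms(2) by (rule triangular_repE) blast
  have "X * Y = P * U * (P' * P) * V * P'"
    unfolding V(4) U(4) using Pc V(1) U(1) by (simp add: assoc_mult_mat[of _ n n _ n _ n])
  also have "\<dots> = P * (U * V) * P'"
    unfolding PP using Pc V(1) U(1) by (simp add: assoc_mult_mat[of _ n n _ n _ n])
  finally show ?thesis
    using upper_triangular_mult_diag[OF U(1,2) V(1,2)] U(1,3) V(1,3)
    by (intro triangular_repI[of "U * V"]) auto
qed

lemma triangular_rep_const:
  assumes "c = complex_of_real r"
  shows "triangular_rep P P' es (c \<cdot>\<^sub>m 1\<^sub>m n) (\<lambda>_. r)"
proof (rule triangular_repI)
  show "c \<cdot>\<^sub>m 1\<^sub>m n = P * (c \<cdot>\<^sub>m 1\<^sub>m n) * P'"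
    using Pc PP(1) by (simp add: mult_smult_distrib[of _ n n _ n] mult_smult_assoc_mat[of _ n n _ n])
qed (use assms in auto)

lemma triangular_rep_add:
  assumes "triangular_rep P P' es X g" "triangular_rep P P' es Y h"
  shows "triangular_rep P P' es (X + Y) (\<lambda>t. g t + h t)"
proof -
  obtain V where V: "V \<in> carrier_mat n n" "upper_triangular V"
    "\<And>i. i < n \<Longrightarrow> V $$ (i, i) = complex_of_real (g (es ! i))" "X = P * V * P'"
    using assms(1) by (rule triangular_repE) blast
  obtain W where W: "W \<in> carrier_mat n n" "upper_triangular W"
    "\<And>i. i < n \<Longrightarrow> W $$ (i, i) = complex_of_real (h (es ! i))" "Y = P * W * P'"
    using assms(2) by (rule triangular_repE) blast
  show ?thesis
  proof (rule triangular_repI)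
    show "X + Y = P * (V + W) * P'"
      unfolding V(4) W(4) using Pc V(1) W(1)
      by (simp add: mult_add_distrib_mat[of _ n n _ n] add_mult_distrib_mat[of _ n n _ _ n])
    show "upper_triangular (V + W)"
      using V(1,2) W(1,2) by (intro upper_triangularI) (simp add: upper_triangularD)
  qed (use V W in auto)
qed

lemma triangular_rep_trace:
  assumes "triangular_rep P P' es X g"
  shows "mat_diag_sum X = complex_of_real (\<Sum>e\<leftarrow>es. g e)"
proof -
  obtain V where V: "V \<in> carrier_mat n n" "upper_triangular V"
    "\<And>i. i < n \<Longrightarrow> V $$ (i, i) = complex_of_real (g (es ! i))" "X = P * V * P'"
    using assms(1) by (rule triangular_repE) blast
  have "mat_diag_sum X = mat_diag_sum (P' * (P * V))"
    unfolding V(4) using Pc V(1) by (intro mat_diag_sum_comm[of _ n]) auto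
  also have "P' * (P * V) = P' * P * V"
    using Pc V(1) by (simp add: assoc_mult_mat[of _ n n _ n _ n])
  also have "\<dots> = V" unfolding PP using V(1) by simp
  also have "mat_diag_sum V = (\<Sum>i<n. complex_of_real (g (es ! i)))"
    using V(1,3) unfolding mat_diag_sum_def by auto
  also have "\<dots> = complex_of_real (\<Sum>e\<leftarrow>es. g e)"
    by (simp add: sum_list_sum_nth lessThan_atLeast0 n)
  finally show ?thesis .
qed

lemma triangular_rep_char_poly:
  assumes "triangular_rep P P' es X g"
  shows "char_poly X = (\<Prod>a\<leftarrow>map (\<lambda>e. complex_of_real (g e)) es. [:- a, 1:])"
proof -
  obtain V where V: "V \<in> carrier_mat n n" "upper_triangular V"
    "\<And>i. i < n \<Longrightarrow> V $$ (i, i) = complex_of_real (g (es ! i))" "X = P * V * P'"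
    using assms(1) by (rule triangular_repE) blast
  have "diag_mat V = map (\<lambda>e. complex_of_real (g e)) es"
    using V(1,3) n by (intro nth_equalityI) (auto simp: diag_mat_def)
  then show ?thesis
    using similar_upper_triangular_char_poly[OF V(1) Pc PP V(2,4)] by simp
qed

lemma triangular_rep_integer_poly:
  assumes Z: "Z \<in> carrier_mat n n" "triangular_rep P P' es (map_mat complex_of_int Z) (\<lambda>t. t)"
  shows "\<exists>Y \<in> carrier_mat n n. triangular_rep P P' es (map_mat complex_of_int Y) (poly (of_int_poly f))"
proof (induction f)
  case 0
  have "map_mat complex_of_int (0\<^sub>m n n) = 0 \<cdot>\<^sub>m 1\<^sub>m n" by (intro eq_matI) auto
  moreover have "poly (of_int_poly 0) = (\<lambda>_::real. 0)" by (simp add: fun_eq_iff)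
  ultimately have "triangular_rep P P' es (map_mat complex_of_int (0\<^sub>m n n)) (poly (of_int_poly 0))"
    using triangular_rep_const[of 0 0] by (simp only: of_real_0)
  then show ?case by (rule bexI) simp
next
  case (pCons c f)
  then obtain Y where Y: "Y \<in> carrier_mat n n"
    "triangular_rep P P' es (map_mat complex_of_int Y) (poly (of_int_poly f))" by auto
  have "map_mat complex_of_int (c \<cdot>\<^sub>m 1\<^sub>m n + Z * Y)
      = map_mat complex_of_int (c \<cdot>\<^sub>m 1\<^sub>m n) + map_mat complex_of_int (Z * Y)"
    using Z Y by (intro eq_matI) auto
  also have "map_mat complex_of_int (Z * Y) = map_mat complex_of_int Z * map_mat complex_of_int Y"
    using Z Y by (intro of_int_hom.mat_hom_mult) auto
  also have "map_mat complex_of_int (c \<cdot>\<^sub>m 1\<^sub>m n) = of_int c \<cdot>\<^sub>m 1\<^sub>m n"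
    by (intro eq_matI) auto
  finally have mat: "map_mat complex_of_int (c \<cdot>\<^sub>m 1\<^sub>m n + Z * Y)
      = of_int c \<cdot>\<^sub>m 1\<^sub>m n + map_mat complex_of_int Z * map_mat complex_of_int Y" .
  have "poly (of_int_poly (pCons c f)) = (\<lambda>t::real. of_int c + t * poly (of_int_poly f) t)"
    by (simp add: of_int_hom.map_poly_pCons_hom fun_eq_iff)
  then have "triangular_rep P P' es (map_mat complex_of_int (c \<cdot>\<^sub>m 1\<^sub>m n + Z * Y)) (poly (of_int_poly (pCons c f)))"
    unfolding mat
    using triangular_rep_add[OF triangular_rep_const[of "of_int c" "of_int c"] triangular_rep_mult[OF Z(2) Y(2)]]
    by simp
  then show ?case using Z(1) Y(1) by (intro bexI[of _ "c \<cdot>\<^sub>m 1\<^sub>m n + Z * Y"]) auto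
qed

text \<open>The matrix \<open>f(Z)\<close> has integer entries, hence so has its characteristic polynomial, whose roots are
the values of \<open>f\<close> at the eigenvalues.\<close>

lemma triangular_rep_nonzero_prod:
  assumes Z: "Z \<in> carrier_mat n n" "triangular_rep P P' es (map_mat complex_of_int Z) (\<lambda>t. t)"
  shows "1 \<le> (\<Prod>e\<leftarrow>filter (\<lambda>e. poly (of_int_poly f) e \<noteq> 0) es. \<bar>poly (of_int_poly f) e\<bar>)"
proof -
  obtain Y where Y: "Y \<in> carrier_mat n n"
    "triangular_rep P P' es (map_mat complex_of_int Y) (poly (of_int_poly f))"
    using triangular_rep_integer_poly[OF Z] by blast
  define gs where "gs = map (\<lambda>e. complex_of_real (poly (of_int_poly f) e)) es"
  define z where "z = length (filter (\<lambda>a. a = 0) gs)"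
  have cp: "map_poly complex_of_int (char_poly Y) = (\<Prod>a\<leftarrow>gs. [:- a, 1:])"
    unfolding gs_def triangular_rep_char_poly[OF Y(2), symmetric] by (rule of_int_hom.char_poly_hom[OF Y(1), symmetric])
  have "real_of_int \<bar>coeff (char_poly Y) z\<bar> = cmod (coeff (map_poly complex_of_int (char_poly Y)) z)"
    by (simp add: coeff_map_poly)
  also have "\<dots> = cmod (\<Prod>a\<leftarrow>filter (\<lambda>a. a \<noteq> 0) gs. - a)"
    unfolding cp z_def coeff_prod_linear_at_zero_roots ..
  finally have c: "real_of_int \<bar>coeff (char_poly Y) z\<bar> = cmod (\<Prod>a\<leftarrow>filter (\<lambda>a. a \<noteq> 0) gs. - a)" .
  have norm_c: "cmod (\<Prod>a\<leftarrow>filter (\<lambda>a. a \<noteq> 0) (map (\<lambda>e. complex_of_real (g e)) xs). - a)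
      = (\<Prod>e\<leftarrow>filter (\<lambda>e. g e \<noteq> 0) xs. \<bar>g e\<bar>)" for g :: "real \<Rightarrow> real" and xs
    by (induction xs) (simp_all add: norm_mult)
  have "(\<Prod>e\<leftarrow>filter (\<lambda>e. g e \<noteq> 0) xs. \<bar>g e\<bar>) \<noteq> 0" for g :: "real \<Rightarrow> real" and xs
    by (induction xs) simp_all
  then have "cmod (\<Prod>a\<leftarrow>filter (\<lambda>a. a \<noteq> 0) gs. - a) \<noteq> 0"
    unfolding gs_def norm_c by blast
  then have "real_of_int \<bar>coeff (char_poly Y) z\<bar> \<noteq> 0" unfolding c by blast
  then have "coeff (char_poly Y) z \<noteq> 0" by simp
  then have "1 \<le> real_of_int \<bar>coeff (char_poly Y) z\<bar>" by linarith
  also have "\<dots> = (\<Prod>e\<leftarrow>filter (\<lambda>e. poly (of_int_poly f) e \<noteq> 0) es. \<bar>poly (of_int_poly f) e\<bar>)"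
    unfolding c gs_def by (rule norm_c)
  finally show ?thesis .
qed

end

text \<open>A list of eigenvalues with multiplicity, together with the two facts about it that matter: it
computes the traces of powers, and integrality forces the nonzero values of an integer polynomial on
it to have a product of modulus at least 1.\<close>

lemma integer_matrix_eigenvalues:
  fixes A :: "nat \<Rightarrow> nat \<Rightarrow> int" and M :: real
  assumes sym: "\<And>i j. i < n \<Longrightarrow> j < n \<Longrightarrow> A i j = A j i"
    and bound: "\<And>i. i < n \<Longrightarrow> (\<Sum>j<n. real_of_int \<bar>A i j\<bar>) \<le> M"
  obtains es :: "real list" where "length es = n" "\<And>e. e \<in> set es \<Longrightarrow> \<bar>e\<bar> \<le> M"
    "\<And>k. real_of_int (\<Sum>i<n. fin_mat_power {..<n} A k i i) = (\<Sum>e\<leftarrow>es. e ^ k)"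
    "\<And>f :: int poly. 1 \<le> (\<Prod>e\<leftarrow>filter (\<lambda>e. poly (of_int_poly f) e \<noteq> 0) es. \<bar>poly (of_int_poly f) e\<bar>)"
proof -
  define Z where "Z = mat n n (\<lambda>(i, j). A i j)"
  define C :: "complex mat" where "C = map_mat of_int Z"
  have Z: "Z \<in> carrier_mat n n" and C: "C \<in> carrier_mat n n" by (auto simp: Z_def C_def)
  obtain as where as: "char_poly C = (\<Prod>a\<leftarrow>as. [:- a, 1:])"
    using char_poly_factorized[OF C] by blast
  obtain U where U: "U \<in> carrier_mat n n" "upper_triangular U" "similar_mat C U"
    using schur_decomposition_exists[OF C as] by blast
  obtain n' P P' where P0: "{C, U, P, P'} \<subseteq> carrier_mat n' n'"
    "P * P' = 1\<^sub>m n'" "P' * P = 1\<^sub>m n'" "C = P * U * P'"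
    using similar_matD[OF U(3)] by blast
  have "n' = n" using P0(1) carrier_matD[OF C] by auto
  note P = P0[unfolded this]
  have Pc: "P \<in> carrier_mat n n" "P' \<in> carrier_mat n n" using P(1) by auto
  note P = Pc P(2-4)
  have ev: "Im e = 0 \<and> cmod e \<le> M" if "e \<in> set (diag_mat U)" for e
  proof -
    have "char_poly C = (\<Prod>a\<leftarrow>diag_mat U. [:- a, 1:])"
      by (rule similar_upper_triangular_char_poly[OF U(1) P(1-4) U(2) P(5)])
    moreover have "poly (\<Prod>a\<leftarrow>as. [:- a, 1:]) e = 0" if "e \<in> set as" for as
      using that by (induction as) auto
    ultimately have "poly (char_poly C) e = 0" using that by simp
    then have "eigenvalue C e" using eigenvalue_root_char_poly[OF C] by simp
    then obtain v where v: "v \<in> carrier_vec n" "v \<noteq> 0\<^sub>v n" "C *\<^sub>v v = e \<cdot>\<^sub>v v"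
      using C unfolding eigenvalue_def eigenvector_def by auto
    define w where "w = (\<lambda>i. vec_index v i)"
    have eq: "(\<Sum>j<n. of_int (A i j) * w j) = e * w i" if i: "i < n" for i
    proof -
      have "(\<Sum>j<n. of_int (A i j) * w j) = vec_index (C *\<^sub>v v) i"
        using i v(1) by (simp add: w_def C_def Z_def scalar_prod_def lessThan_atLeast0)
      also have "\<dots> = e * w i" unfolding v(3) using i v(1) by (simp add: w_def)
      finally show ?thesis .
    qed
    have "\<exists>i0<n. w i0 \<noteq> 0"
    proof (rule ccontr)
      assume "\<not> (\<exists>i0<n. w i0 \<noteq> 0)"
      then have "v = 0\<^sub>v n" using v(1) by (intro eq_vecI) (auto simp: w_def)
      then show False using v(2) by simp
    qed
    then obtain i0 where i0: "i0 < n" "w i0 \<noteq> 0" by blast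
    show ?thesis
      using symmetric_matrix_eigenvalue_bounds[where A = A and n = n and M = M and w = w and e = e and ?i0.0 = i0]
        sym bound eq i0 by blast
  qed
  define es where "es = map Re (diag_mat U)"
  have len: "length (diag_mat U) = n" using U by (simp add: diag_mat_def)
  have Ui: "U $$ (i, i) = complex_of_real (es ! i)" if "i < n" for i
  proof -
    have "diag_mat U ! i = U $$ (i, i)" using that U by (simp add: diag_mat_def)
    moreover have "diag_mat U ! i \<in> set (diag_mat U)" using that len by simp
    ultimately show ?thesis using ev that len by (auto simp: es_def complex_eq_iff)
  qed
  define R where "R = triangular_rep P P' es"
  have n: "n = length es" using len by (simp add: es_def)
  have R_C: "R C (\<lambda>t. t)"
    unfolding R_def using triangular_repI[OF n Pc P(3,4) U(1,2) Ui P(5)] by simp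
  show thesis
  proof (rule that)
    show "length es = n" using len by (simp add: es_def)
    show "\<bar>e\<bar> \<le> M" if "e \<in> set es" for e
      using that ev unfolding es_def by (auto intro: order_trans[OF abs_Re_le_cmod])
    show "real_of_int (\<Sum>i<n. fin_mat_power {..<n} A k i i) = (\<Sum>e\<leftarrow>es. e ^ k)" for k
    proof -
      define X where "X = (\<lambda>k. mat n n (\<lambda>(i, j). complex_of_int (fin_mat_power {..<n} A k i j)))"
      have "R (X k) (\<lambda>t. t ^ k)"
      proof (induction k)
        case 0
        have "X 0 = 1 \<cdot>\<^sub>m 1\<^sub>m n" by (intro eq_matI) (auto simp: X_def)
        then show ?case using triangular_rep_const[OF n Pc P(3,4), of 1 1] by (simp add: R_def)
      next
        case (Suc k)
        have "X (Suc k) = C * X k"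
          by (intro eq_matI) (simp_all add: X_def C_def Z_def scalar_prod_def lessThan_atLeast0)
        then show ?case
          using triangular_rep_mult[OF n Pc P(3,4) R_C[unfolded R_def] Suc[unfolded R_def]] by (simp add: R_def)
      qed
      from triangular_rep_trace[OF n Pc P(3,4) this[unfolded R_def]]
      have "complex_of_real (real_of_int (\<Sum>i<n. fin_mat_power {..<n} A k i i)) = complex_of_real (\<Sum>e\<leftarrow>es. e ^ k)"
        by (simp add: mat_diag_sum_def X_def)
      then show ?thesis by (simp only: of_real_eq_iff)
    qed
    show "1 \<le> (\<Prod>e\<leftarrow>filter (\<lambda>e. poly (of_int_poly f) e \<noteq> 0) es. \<bar>poly (of_int_poly f) e\<bar>)" for f :: "int poly"
      by (rule triangular_rep_nonzero_prod[OF n Pc P(3,4) Z R_C[unfolded R_def C_def]])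
  qed
qed

text \<open>In the product every value has modulus at most \<open>F\<close> and every small one at most \<open>F\<close> to the power
\<open>-m\<close>, so that a single small value uses up what \<open>m\<close> others can contribute.\<close>

lemma few_small_values:
  fixes v :: "'a \<Rightarrow> real" and F \<eta> :: real
  assumes F: "1 < F" and eta: "0 < \<eta>" "F ^ m * \<eta> \<le> 1"
    and bound: "\<And>e. e \<in> set es \<Longrightarrow> \<bar>v e\<bar> \<le> F"
    and prod: "1 \<le> (\<Prod>e\<leftarrow>filter (\<lambda>e. v e \<noteq> 0) es. \<bar>v e\<bar>)"
  shows "m * length (filter (\<lambda>e. v e \<noteq> 0 \<and> \<bar>v e\<bar> \<le> \<eta>) es) \<le> length es"
proof -
  define k where "k = (\<lambda>es. length (filter (\<lambda>e. v e \<noteq> 0 \<and> \<bar>v e\<bar> \<le> \<eta>) es))"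
  have "(\<Prod>e\<leftarrow>filter (\<lambda>e. v e \<noteq> 0) es. \<bar>v e\<bar>) * F ^ (m * k es) \<le> F ^ length es"
    using bound
  proof (induction es)
    case Nil then show ?case by (simp add: k_def)
  next
    case (Cons e es)
    have IH: "(\<Prod>e\<leftarrow>filter (\<lambda>e. v e \<noteq> 0) es. \<bar>v e\<bar>) * F ^ (m * k es) \<le> F ^ length es" (is "?p * _ \<le> _")
      using Cons by simp
    have p0: "0 \<le> ?p" by (induction es) auto
    consider "v e = 0" | "v e \<noteq> 0" "\<bar>v e\<bar> \<le> \<eta>" | "v e \<noteq> 0" "\<not> \<bar>v e\<bar> \<le> \<eta>" by blast
    then show ?case
    proof cases
      case 1
      then have "k (e # es) = k es" by (simp add: k_def)
      moreover have "F ^ length es \<le> F ^ length (e # es)" using F by (intro power_increasing) auto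
      ultimately show ?thesis using IH 1 by simp
    next
      case 2
      then have "k (e # es) = Suc (k es)" by (simp add: k_def)
      then have "(\<Prod>e\<leftarrow>filter (\<lambda>e. v e \<noteq> 0) (e # es). \<bar>v e\<bar>) * F ^ (m * k (e # es))
          = (\<bar>v e\<bar> * F ^ m) * (?p * F ^ (m * k es))" using 2 by (simp add: power_add mult_ac)
      also have "\<dots> \<le> F * F ^ length es"
      proof (rule mult_mono[OF _ IH])
        have "\<bar>v e\<bar> * F ^ m \<le> \<eta> * F ^ m" using 2 F by (intro mult_right_mono) auto
        also have "\<dots> \<le> 1" using eta by (simp add: mult.commute)
        finally show "\<bar>v e\<bar> * F ^ m \<le> F" using F by linarith
      qed (use F p0 in auto)
      finally show ?thesis by simp
    next
      case 3
      then have "k (e # es) = k es" by (simp add: k_def)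
      then have "(\<Prod>e\<leftarrow>filter (\<lambda>e. v e \<noteq> 0) (e # es). \<bar>v e\<bar>) * F ^ (m * k (e # es))
          = \<bar>v e\<bar> * (?p * F ^ (m * k es))" using 3 by (simp add: mult_ac)
      also have "\<dots> \<le> F * F ^ length es" using Cons(2)[of e] p0 F by (intro mult_mono[OF _ IH]) auto
      finally show ?thesis by simp
    qed
  qed
  moreover have "1 * F ^ (m * k es) \<le> (\<Prod>e\<leftarrow>filter (\<lambda>e. v e \<noteq> 0) es. \<bar>v e\<bar>) * F ^ (m * k es)"
    using prod F by (intro mult_right_mono) auto
  ultimately have "F ^ (m * k es) \<le> F ^ length es" by simp
  then show ?thesis using F by (simp add: k_def)
qed

section \<open>Compactly supported measures on the line\<close>

lemma continuous_poly_approximation: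
  fixes f :: "real \<Rightarrow> real"
  assumes "continuous_on {a..b} f" "0 < e"
  obtains p :: "real poly" where "\<And>t. t \<in> {a..b} \<Longrightarrow> \<bar>f t - poly p t\<bar> < e"
proof -
  obtain g where g: "real_polynomial_function g" "\<And>t. t \<in> {a..b} \<Longrightarrow> \<bar>f t - g t\<bar> < e"
    using Stone_Weierstrass_real_polynomial_function[OF compact_Icc assms] by blast
  obtain c n where "g = (\<lambda>x. \<Sum>i\<le>n. c i * x ^ i)"
    using g(1) unfolding real_polynomial_function_iff_sum by blast
  then have "g = poly (\<Sum>i\<le>n. monom (c i) i)" by (simp add: fun_eq_iff poly_sum poly_monom)
  then show thesis using g(2) that by blast
qed

lemma integrable_bounded_on_support:
  fixes f :: "real \<Rightarrow> real"
  assumes "finite_measure \<mu>" "sets \<mu> = sets borel" "AE t in \<mu>. \<bar>t\<bar> \<le> K"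
    and "f \<in> borel_measurable borel" "\<And>t. \<bar>t\<bar> \<le> K \<Longrightarrow> \<bar>f t\<bar> \<le> C"
  shows "integrable \<mu> f"
proof (rule finite_measure.integrable_const_bound[OF assms(1)])
  show "AE t in \<mu>. norm (f t) \<le> C" using assms(3) by eventually_elim (simp add: assms(5))
  show "f \<in> borel_measurable \<mu>" using assms(2,4) by (simp cong: measurable_cong_sets)
qed

lemma borel_measurable_poly [measurable]: "poly (p :: real poly) \<in> borel_measurable borel"
  by (intro borel_measurable_continuous_onI continuous_intros)

lemma integrable_poly:
  assumes "finite_measure \<mu>" "sets \<mu> = sets borel" "AE t in \<mu>. \<bar>t\<bar> \<le> K"
  shows "integrable \<mu> (poly (p :: real poly))"
proof -
  have "compact (poly p ` {-K..K})"
    by (intro compact_continuous_image continuous_intros compact_Icc)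
  then obtain C where "\<forall>x\<in>poly p ` {-K..K}. norm x \<le> C"
    using compact_imp_bounded bounded_iff by blast
  then show ?thesis
    by (intro integrable_bounded_on_support[OF assms, of _ C]) (simp_all add: image_iff abs_le_iff minus_le_iff)
qed

lemma integral_eq_of_moments:
  fixes \<mu> \<nu> :: "real measure"
  assumes mu: "finite_measure \<mu>" "sets \<mu> = sets borel" "AE t in \<mu>. \<bar>t\<bar> \<le> K"
    and nu: "finite_measure \<nu>" "sets \<nu> = sets borel" "AE t in \<nu>. \<bar>t\<bar> \<le> K"
    and eq: "\<And>k. (LINT t|\<mu>. t ^ k) = (LINT t|\<nu>. t ^ k)"
  shows "(LINT t|\<mu>. poly p t) = (LINT t|\<nu>. poly p t)"
proof -
  have pow: "integrable \<mu> (\<lambda>t. t ^ k)" "integrable \<nu> (\<lambda>t. t ^ k)" for k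
    using integrable_poly[OF mu, of "monom 1 k"] integrable_poly[OF nu, of "monom 1 k"]
    by (simp_all add: poly_monom[abs_def])
  show ?thesis unfolding poly_altdef using pow eq by (simp add: Bochner_Integration.integral_sum)
qed

text \<open>By the Weierstrass theorem the moments determine the integrals of continuous functions on a compact
interval, and the indicator function of a half-line is a bounded limit of continuous functions.\<close>

lemma compact_measure_unique:
  fixes \<mu> \<nu> :: "real measure"
  assumes mu: "finite_measure \<mu>" "sets \<mu> = sets borel" "AE t in \<mu>. \<bar>t\<bar> \<le> K"
    and nu: "finite_measure \<nu>" "sets \<nu> = sets borel" "AE t in \<nu>. \<bar>t\<bar> \<le> K"
    and eq: "\<And>k. (LINT t|\<mu>. t ^ k) = (LINT t|\<nu>. t ^ k)"
  shows "\<mu> = \<nu>"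
proof -
  interpret mu: finite_measure \<mu> by fact
  interpret nu: finite_measure \<nu> by fact
  have cont: "(LINT t|\<mu>. f t) = (LINT t|\<nu>. f t)"
    if f: "continuous_on UNIV f" "\<And>t. \<bar>f t\<bar> \<le> 1" for f :: "real \<Rightarrow> real"
  proof -
    have fb: "f \<in> borel_measurable borel" using f(1) by (rule borel_measurable_continuous_onI)
    have fi: "integrable \<mu> f" "integrable \<nu> f"
      using integrable_bounded_on_support[OF mu fb, of 1] integrable_bounded_on_support[OF nu fb, of 1] f(2) by auto
    define c where "c = measure \<mu> (space \<mu>) + measure \<nu> (space \<nu>)"
    have c: "0 \<le> c" by (simp add: c_def)
    have "\<bar>(LINT t|\<mu>. f t) - (LINT t|\<nu>. f t)\<bar> \<le> e" if e: "0 < e" for e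
    proof -
      have "0 < e / (c + 1)" using e c by simp
      then obtain p :: "real poly" where p: "\<And>t. t \<in> {-K..K} \<Longrightarrow> \<bar>f t - poly p t\<bar> < e / (c + 1)"
        using continuous_poly_approximation[OF continuous_on_subset[OF f(1)], of "-K" K] by blast
      have close: "\<bar>(LINT t|\<rho>. f t) - (LINT t|\<rho>. poly p t)\<bar> \<le> e / (c + 1) * measure \<rho> (space \<rho>)"
        if \<rho>: "finite_measure \<rho>" "sets \<rho> = sets borel" "AE t in \<rho>. \<bar>t\<bar> \<le> K" and fi: "integrable \<rho> f" for \<rho>
      proof -
        interpret rho: finite_measure \<rho> by fact
        have "\<bar>LINT t|\<rho>. f t - poly p t\<bar> \<le> (LINT t|\<rho>. \<bar>f t - poly p t\<bar>)" by (rule integral_abs_bound)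
        also have "\<dots> \<le> (LINT t|\<rho>. e / (c + 1))"
        proof (rule integral_mono_AE)
          show "AE t in \<rho>. \<bar>f t - poly p t\<bar> \<le> e / (c + 1)"
            using \<rho>(3)
          proof eventually_elim
            case (elim t)
            then have "t \<in> {-K..K}" by (simp add: abs_le_iff minus_le_iff)
            from p[OF this] show ?case by simp
          qed
        qed (use fi integrable_poly[OF \<rho>] in auto)
        finally show ?thesis using fi integrable_poly[OF \<rho>] by (simp add: mult.commute)
      qed
      have "\<bar>(LINT t|\<mu>. f t) - (LINT t|\<nu>. f t)\<bar> \<le> e / (c + 1) * measure \<mu> (space \<mu>) + e / (c + 1) * measure \<nu> (space \<nu>)"
        using close[OF mu fi(1)] close[OF nu fi(2)] integral_eq_of_moments[OF mu nu eq, of p] by linarith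
      also have "\<dots> = e * (c / (c + 1))"
      proof -
        have "e / (c + 1) * u + e / (c + 1) * v = e * ((u + v) / (c + 1))" for u v
          by (simp add: add_divide_distrib distrib_left)
        then show ?thesis unfolding c_def by blast
      qed
      also have "\<dots> \<le> e" using e c by (simp add: mult_le_cancel_left2 field_simps)
      finally show ?thesis .
    qed
    then have "\<bar>(LINT t|\<mu>. f t) - (LINT t|\<nu>. f t)\<bar> \<le> 0" by (rule field_le_epsilon[of _ 0, simplified])
    then show ?thesis by simp
  qed
  show ?thesis
  proof (rule measure_eqI_lessThan[OF mu(2) nu(2)])
    show "emeasure \<mu> {x <..} < \<infinity>" for x by (simp add: mu.emeasure_eq_measure)
    fix x :: real
    define f where "f = (\<lambda>j t. min 1 (max 0 (real j * (t - x))))"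
    have f_lim: "(\<lambda>j. f j t) \<longlonglongrightarrow> indicat_real {x<..} t" for t
    proof (cases "x < t")
      case True
      obtain N where N: "1 / (t - x) < real N" using reals_Archimedean2 by blast
      have "f j t = 1" if "N \<le> j" for j
      proof -
        have "1 / (t - x) \<le> real j" using N that by linarith
        then show ?thesis using True by (simp add: f_def field_simps)
      qed
      then show ?thesis using True by (intro tendsto_eventually) (auto simp: eventually_sequentially)
    next
      case False
      then have "real j * (t - x) \<le> 0" for j by (simp add: mult_nonneg_nonpos)
      then have "f j t = 0" for j by (simp add: f_def max.absorb1)
      then show ?thesis using False by simp
    qed
    have lim: "(\<lambda>j. LINT t|\<rho>. f j t) \<longlonglongrightarrow> measure \<rho> {x<..}"
      if \<rho>: "finite_measure \<rho>" "sets \<rho> = sets borel" for \<rho>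
    proof -
      interpret rho: finite_measure \<rho> by fact
      have "(\<lambda>j. LINT t|\<rho>. f j t) \<longlonglongrightarrow> (LINT t|\<rho>. indicat_real {x<..} t)"
      proof (rule integral_dominated_convergence[where w = "\<lambda>_. 1"])
        show "AE t in \<rho>. (\<lambda>j. f j t) \<longlonglongrightarrow> indicat_real {x<..} t" using f_lim by simp
        show "AE t in \<rho>. norm (f j t) \<le> 1" for j by (simp add: f_def)
      qed (use \<rho>(2) in \<open>auto simp: f_def cong: measurable_cong_sets\<close>)
      moreover have "(LINT t|\<rho>. indicat_real {x<..} t) = measure \<rho> {x<..}"
        using \<rho>(2) sets_eq_imp_space_eq[OF \<rho>(2)] by simp
      ultimately show ?thesis by simp
    qed
    have "(LINT t|\<mu>. f j t) = (LINT t|\<nu>. f j t)" for j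
      by (rule cont) (auto simp: f_def intro!: continuous_intros)
    then have "measure \<mu> {x<..} = measure \<nu> {x<..}"
      using LIMSEQ_unique[OF lim[OF mu(1,2)]] lim[OF nu(1,2)] by simp
    then show "emeasure \<mu> {x <..} = emeasure \<nu> {x <..}"
      by (simp add: mu.emeasure_eq_measure nu.emeasure_eq_measure)
  qed
qed

section \<open>The Hausdorff moment problem\<close>

text \<open>The mean of \<open>k choose j\<close> under the binomial distribution with parameters \<open>n\<close> and \<open>x\<close> is
\<open>(n choose j) x\<^sup>j\<close>. The identity is needed in a ring of polynomials, with \<open>x\<close> the variable and
\<open>y = 1 - x\<close>.\<close>

lemma bernstein_factorial_moment:
  fixes x y :: "'a::comm_ring_1"
  assumes xy: "x + y = 1" and j: "j \<le> n"
  shows "(\<Sum>k\<le>n. of_nat (k choose j) * (of_nat (n choose k) * x ^ k * y ^ (n - k))) = of_nat (n choose j) * x ^ j"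
proof -
  have "(\<Sum>k\<le>n. of_nat (k choose j) * (of_nat (n choose k) * x ^ k * y ^ (n - k)))
      = (\<Sum>k\<in>{j..n}. of_nat (k choose j) * (of_nat (n choose k) * x ^ k * y ^ (n - k)))"
    by (rule sum.mono_neutral_right) (auto simp: not_le binomial_eq_0)
  also have "\<dots> = (\<Sum>i\<le>n - j. of_nat (n choose j) * x ^ j * (of_nat (n - j choose i) * x ^ i * y ^ (n - j - i)))"
  proof (rule sum.reindex_bij_witness[of _ "\<lambda>i. i + j" "\<lambda>k. k - j"])
    fix k assume k: "k \<in> {j..n}"
    have 1: "of_nat (n choose k) * of_nat (k choose j) = (of_nat (n choose j) * of_nat (n - j choose (k - j)) :: 'a)"
      using k choose_mult[of j k n] by (metis atLeastAtMost_iff of_nat_mult)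
    have 2: "x ^ k = x ^ j * x ^ (k - j)" using k by (simp add: power_add[symmetric])
    have 3: "n - j - (k - j) = n - k" using k by simp
    have "of_nat (k choose j) * (of_nat (n choose k) * x ^ k * y ^ (n - k))
        = (of_nat (n choose k) * of_nat (k choose j)) * (x ^ k * y ^ (n - k))" by (simp only: mult_ac)
    also have "\<dots> = of_nat (n choose j) * x ^ j * (of_nat (n - j choose (k - j)) * x ^ (k - j) * y ^ (n - k))"
      unfolding 1 2 by (simp only: mult_ac)
    finally show "of_nat (n choose j) * x ^ j * (of_nat (n - j choose (k - j)) * x ^ (k - j) * y ^ (n - j - (k - j)))
        = of_nat (k choose j) * (of_nat (n choose k) * x ^ k * y ^ (n - k))"
      unfolding 3 by (rule sym)
  qed (use j in auto)
  also have "\<dots> = of_nat (n choose j) * x ^ j * (x + y) ^ (n - j)"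
    by (simp only: sum_distrib_left[symmetric] binomial_ring)
  finally show ?thesis using xy by simp
qed

text \<open>The two numbers are the probabilities that \<open>j\<close> draws from \<open>n\<close> objects all hit a given set of \<open>k\<close>
objects, without and with replacement. The bound does not depend on \<open>k\<close> and tends to 0 as \<open>n\<close>
grows.\<close>

lemma choose_ratio_close:
  assumes k: "k \<le> n" and j: "2 * j < n"
  shows "\<bar>real (k choose j) / real (n choose j) - (real k / real n) ^ j\<bar> \<le> real j * (real j / real (n - j))"
proof -
  have choose: "real (m choose j) = (\<Prod>i<j. real m - real i) / fact j" for m
    unfolding binomial_gbinomial gbinomial_prod_rev by (simp add: lessThan_atLeast0)
  have nz: "(\<Prod>i<j. real n - real i) \<noteq> 0" using j by auto
  have "real (k choose j) / real (n choose j) = (\<Prod>i<j. (real k - real i) / (real n - real i))"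
    unfolding choose by (simp add: prod_dividef)
  moreover have "(real k / real n) ^ j = (\<Prod>i<j. real k / real n)" by simp
  moreover have "norm ((\<Prod>i<j. (real k - real i) / (real n - real i)) - (\<Prod>i<j. real k / real n))
      \<le> (\<Sum>i<j. norm ((real k - real i) / (real n - real i) - real k / real n))"
  proof (rule norm_prod_diff)
    fix i assume "i \<in> {..<j}"
    then have i: "i < j" by simp
    show "norm ((real k - real i) / (real n - real i)) \<le> 1"
      using i j k by (simp add: abs_le_iff divide_le_eq)
    show "norm (real k / real n) \<le> 1" using k j by (simp add: divide_le_eq_1)
  qed
  moreover have "(\<Sum>i<j. norm ((real k - real i) / (real n - real i) - real k / real n)) \<le> (\<Sum>i<j. real j / real (n - j))"
  proof (rule sum_mono)
    fix i assume "i \<in> {..<j}"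
    then have i: "i < j" by simp
    have pos: "0 < real n" "0 < real n - real i" using i j by auto
    have "(real k - real i) / (real n - real i) - real k / real n = - (real i * (real n - real k) / (real n * (real n - real i)))"
      using pos by (simp add: field_simps)
    then have "norm ((real k - real i) / (real n - real i) - real k / real n) = real i * (real n - real k) / (real n * (real n - real i))"
      using pos k by simp
    also have "\<dots> \<le> real j * real n / (real n * (real n - real j))"
      using i j k by (intro frac_le mult_mono) auto
    also have "\<dots> = real j / real (n - j)" using j by (simp add: of_nat_diff)
    finally show "norm ((real k - real i) / (real n - real i) - real k / real n) \<le> real j / real (n - j)" .
  qed
  ultimately show ?thesis by simp
qed

text \<open>Put the mass \<open>L((n choose k) t\<^sup>k (1 - t)\<^sup>n\<^sup>-\<^sup>k)\<close> at the point \<open>k / n\<close>. By the two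
preceding lemmas the \<open>j\<close>-th moment of this discrete measure tends to \<open>L(t\<^sup>j)\<close>, so that a weak
limit, which exists by Helly's selection theorem, represents \<open>L\<close>. If \<open>L 1 = 0\<close>, then all masses
vanish and the zero measure represents \<open>L\<close>.\<close>

theorem hausdorff_moment:
  fixes L :: "real poly \<Rightarrow> real"
  assumes add: "\<And>p q. L (p + q) = L p + L q" and homog: "\<And>c p. L (Polynomial.smult c p) = c * L p"
    and nonneg: "\<And>n k. k \<le> n \<Longrightarrow> 0 \<le> L ([:0, 1:] ^ k * [:1, - 1:] ^ (n - k))"
  obtains \<mu> :: "real measure" where "sets \<mu> = sets borel" "finite_measure \<mu>" "AE t in \<mu>. 0 \<le> t \<and> t \<le> 1"
    "\<And>p. (LINT t|\<mu>. poly p t) = L p"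
proof -
  have L0: "L 0 = 0" using homog[of 0 0] by simp
  have L_sum: "L (\<Sum>i\<in>A. p i) = (\<Sum>i\<in>A. L (p i))" for A :: "nat set" and p
    by (induction A rule: infinite_finite_induct) (simp_all add: L0 add)
  \<comment> \<open>the mass of the discrete measure at \<open>k / n\<close>\<close>
  define c where "c = (\<lambda>n k. L (Polynomial.smult (of_nat (n choose k)) ([:0, 1:] ^ k * [:1, - 1:] ^ (n - k))))"
  have c_nonneg: "0 \<le> c n k" if "k \<le> n" for n k
    unfolding c_def homog using nonneg[OF that] by simp
  have moment: "(\<Sum>k\<le>n. real (k choose j) * c n k) = real (n choose j) * L (monom 1 j)" if "j \<le> n" for n j
  proof -
    have "(\<Sum>k\<le>n. real (k choose j) * c n k) = L (\<Sum>k\<le>n. of_nat (k choose j) * (of_nat (n choose k) * [:0, 1:] ^ k * [:1, - 1:] ^ (n - k)))"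
      unfolding c_def L_sum by (intro sum.cong refl) (simp add: homog[symmetric] of_nat_poly mult_ac)
    also have "\<dots> = L (of_nat (n choose j) * [:0, 1:] ^ j)"
      by (subst bernstein_factorial_moment) (use that in \<open>auto simp: one_pCons\<close>)
    also have "\<dots> = real (n choose j) * L (monom 1 j)"
      by (simp add: of_nat_poly homog monom_altdef)
    finally show ?thesis .
  qed
  define m where "m = L 1"
  have c_sum: "(\<Sum>k\<le>n. c n k) = m" for n using moment[of 0 n] by (simp add: m_def)
  have m0: "0 \<le> m" unfolding c_sum[of 0, symmetric] using c_nonneg by simp
  have L_poly: "L p = (\<Sum>i\<le>degree p. coeff p i * L (monom 1 i))" for p
  proof -
    have "L p = L (\<Sum>i\<le>degree p. Polynomial.smult (coeff p i) (monom 1 i))"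
      by (subst poly_as_sum_of_monoms[of p, symmetric]) (simp add: smult_monom)
    then show ?thesis unfolding L_sum homog .
  qed
  show thesis
  proof (cases "m = 0")
    case True
    have "L (monom 1 j) = 0" for j
    proof -
      have "\<forall>k\<in>{..j}. c j k = 0"
        using c_sum[of j] True c_nonneg by (subst sum_nonneg_eq_0_iff[symmetric]) auto
      then show ?thesis using moment[of j j] by simp
    qed
    then have "L p = 0" for p by (subst L_poly) simp
    then show thesis
      by (intro that[of "null_measure borel"])
        (auto intro!: finite_measureI AE_I'[of UNIV] simp: null_sets_def integral_null_measure)
  next
    case False
    then have m: "0 < m" using m0 by simp
    define w where "w = (\<lambda>n k. c n k / m)"
    have w: "\<And>n k. k \<le> n \<Longrightarrow> 0 \<le> w n k" "\<And>n. (\<Sum>k\<le>n. w n k) = 1"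
      using c_nonneg c_sum m by (auto simp: w_def sum_divide_distrib[symmetric])
    define \<mu> where "\<mu> = (\<lambda>n. distr (point_measure {..n} (\<lambda>k. ennreal (w n k))) borel (\<lambda>k. real k / real n))"
    have int: "(LINT t|\<mu> n. f t) = (\<Sum>k\<le>n. w n k * f (real k / real n))" if "f \<in> borel_measurable borel" for n and f :: "real \<Rightarrow> real"
      unfolding \<mu>_def using w that
      by (subst integral_distr) (auto intro!: lebesgue_integral_point_measure_finite[THEN trans])
    have prob: "real_distribution (\<mu> n)" for n
    proof -
      have "prob_space (point_measure {..n} (\<lambda>k. ennreal (w n k)))"
      proof (rule prob_spaceI)
        have "(\<Sum>k\<le>n. ennreal (w n k)) = ennreal (\<Sum>k\<le>n. w n k)" by (rule sum_ennreal) (simp add: w(1))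
        then show "emeasure (point_measure {..n} (\<lambda>k. ennreal (w n k))) (space (point_measure {..n} (\<lambda>k. ennreal (w n k)))) = 1"
          by (simp add: space_point_measure emeasure_point_measure_finite w(2))
      qed
      then have "prob_space (\<mu> n)" unfolding \<mu>_def by (rule prob_space.prob_space_distr) simp
      then show ?thesis by (simp add: real_distribution_def real_distribution_axioms_def \<mu>_def)
    qed
    \<comment> \<open>all these measures live on \<open>[0, 1]\<close>\<close>
    have "tight \<mu>"
      unfolding tight_def
    proof (intro conjI allI impI prob)
      fix e :: real assume e: "0 < e"
      have "measure (\<mu> n) {-1<..1} = 1" for n
      proof -
        interpret real_distribution "\<mu> n" by (rule prob)
        have "measure (\<mu> n) {-1<..1} = (LINT t|\<mu> n. indicat_real {-1<..1} t)" by simp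
        also have "\<dots> = (\<Sum>k\<le>n. w n k * 1)"
          unfolding int[OF borel_measurable_indicator[OF greaterThanAtMost_borel]]
          by (intro sum.cong refl arg_cong2[where f = "(*)"])
            (auto simp: indicator_def divide_le_eq_1 less_le_trans[of "-1" 0])
        finally show ?thesis using w by simp
      qed
      then show "\<exists>a b. a < b \<and> (\<forall>n. 1 - e < measure (\<mu> n) {a<..b})"
        using e by (intro exI[of _ "-1"] exI[of _ 1]) simp
    qed
    from tight_imp_convergent_subsubsequence[OF this strict_mono_id] obtain r M where
      r: "strict_mono r" and M: "real_distribution M" and wc: "weak_conv_m (\<mu> \<circ> id \<circ> r) M" by blast
    have conv: "(\<lambda>n. LINT t|\<mu> (r n). f t) \<longlonglongrightarrow> (LINT t|M. f t)"
      if "\<And>x. isCont f x" "\<And>x. norm (f x) \<le> C" for f :: "real \<Rightarrow> real" and C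
      using weak_conv_imp_integral_bdd_continuous_conv[OF _ M wc that] prob by simp
    interpret M: real_distribution M by (rule M)
    have support: "AE t in M. 0 \<le> t \<and> t \<le> 1"
    proof -
      define f where "f = (\<lambda>t::real. min 1 (max 0 (max (- t) (t - 1))))"
      have fb: "f \<in> borel_measurable borel" unfolding f_def by simp
      have f0: "f (real k / real n) = 0" if "k \<le> n" for k n
      proof -
        have "0 \<le> real k / real n" "real k / real n \<le> 1" using that by (auto simp: divide_le_eq_1)
        then show ?thesis by (simp add: f_def)
      qed
      have fc: "isCont f x" for x unfolding f_def by (intro continuous_intros)
      have "(\<lambda>n. LINT t|\<mu> (r n). f t) \<longlonglongrightarrow> (LINT t|M. f t)"
        by (rule conv[of f 1, OF fc]) (simp add: f_def)
      moreover have "(LINT t|\<mu> n. f t) = 0" for n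
        unfolding int[OF fb] by (rule sum.neutral) (simp add: f0)
      ultimately have "(LINT t|M. f t) = 0" by (simp add: LIMSEQ_const_iff)
      moreover have "integrable M f"
        by (rule M.integrable_const_bound[of _ 1]) (use fb in \<open>auto simp: f_def\<close>)
      ultimately have "AE t in M. f t = 0"
        by (subst (asm) integral_nonneg_eq_0_iff_AE) (auto simp: f_def)
      then show ?thesis by eventually_elim (auto simp: f_def min_def max_def split: if_splits)
    qed
    have mono: "(LINT t|M. t ^ j) = L (monom 1 j) / m" for j
    proof -
      \<comment> \<open>weak convergence applies to bounded functions only, so the power is cut off outside \<open>[0, 1]\<close>\<close>
      define g where "g = (\<lambda>t::real. (max 0 (min 1 t)) ^ j)"
      have gb: "g \<in> borel_measurable borel" unfolding g_def by simp
      have gc: "isCont g x" for x unfolding g_def by (intro continuous_intros)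
      have "(LINT t|M. t ^ j) = (LINT t|M. g t)"
        using support by (intro integral_cong_AE) (auto simp: g_def cong: measurable_cong_sets)
      moreover have "(\<lambda>n. LINT t|\<mu> (r n). g t) \<longlonglongrightarrow> (LINT t|M. g t)"
        by (rule conv[of g 1, OF gc]) (simp add: g_def power_le_one abs_le_iff)
      moreover have g_lim: "(\<lambda>n. LINT t|\<mu> n. g t) \<longlonglongrightarrow> L (monom 1 j) / m"
      proof (rule Lim_transform2[OF tendsto_const])
        have "(\<lambda>n. real j / real (n - j)) \<longlonglongrightarrow> 0"
          by (rule LIMSEQ_offset[of _ j]) (simp add: lim_const_over_n)
        from tendsto_mult_left[OF this, of "real j"]
        have lim: "(\<lambda>n. real j * (real j / real (n - j))) \<longlonglongrightarrow> 0" by simp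
        show "(\<lambda>n. L (monom 1 j) / m - (LINT t|\<mu> n. g t)) \<longlonglongrightarrow> 0"
        proof (rule Lim_null_comparison[OF _ lim])
          show "\<forall>\<^sub>F n in sequentially. norm (L (monom 1 j) / m - (LINT t|\<mu> n. g t)) \<le> real j * (real j / real (n - j))"
            using eventually_gt_at_top[of "2 * j"]
          proof eventually_elim
            fix n assume n: "2 * j < n"
            then have nj: "real (n choose j) \<noteq> 0" by simp
            have "L (monom 1 j) / m = (\<Sum>k\<le>n. real (k choose j) * c n k) / real (n choose j) / m"
              using moment[of j n] n nj by simp
            also have "\<dots> = (\<Sum>k\<le>n. w n k * (real (k choose j) / real (n choose j)))"
              by (simp add: w_def sum_divide_distrib mult.commute)
            finally have "L (monom 1 j) / m = (\<Sum>k\<le>n. w n k * (real (k choose j) / real (n choose j)))" .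
            moreover have "(LINT t|\<mu> n. g t) = (\<Sum>k\<le>n. w n k * (real k / real n) ^ j)"
              unfolding int[OF gb]
            proof (intro sum.cong refl)
              fix k assume "k \<in> {..n}"
              then have "0 \<le> real k / real n" "real k / real n \<le> 1" by (auto simp: divide_le_eq_1)
              then show "w n k * g (real k / real n) = w n k * (real k / real n) ^ j" by (simp add: g_def)
            qed
            ultimately have "norm (L (monom 1 j) / m - (LINT t|\<mu> n. g t))
                = \<bar>\<Sum>k\<le>n. w n k * (real (k choose j) / real (n choose j) - (real k / real n) ^ j)\<bar>"
              by (simp add: sum_subtractf right_diff_distrib)
            also have "\<dots> \<le> (\<Sum>k\<le>n. w n k * (real j * (real j / real (n - j))))"
            proof (rule order_trans[OF sum_abs], rule sum_mono)
              fix k assume "k \<in> {..n}"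
              then have k: "k \<le> n" by simp
              show "\<bar>w n k * (real (k choose j) / real (n choose j) - (real k / real n) ^ j)\<bar> \<le> w n k * (real j * (real j / real (n - j)))"
                unfolding abs_mult abs_of_nonneg[OF w(1)[OF k]]
                by (rule mult_left_mono[OF choose_ratio_close[OF k n] w(1)[OF k]])
            qed
            also have "\<dots> = real j * (real j / real (n - j))"
              by (simp only: sum_distrib_right[symmetric] w(2) mult_1)
            finally show "norm (L (monom 1 j) / m - (LINT t|\<mu> n. g t)) \<le> real j * (real j / real (n - j))" .
          qed
        qed
      qed
      moreover from LIMSEQ_subseq_LIMSEQ[OF g_lim r]
      have "(\<lambda>n. LINT t|\<mu> (r n). g t) \<longlonglongrightarrow> L (monom 1 j) / m" by (simp add: comp_def)
      ultimately show ?thesis using LIMSEQ_unique by metis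
    qed
    have fin: "finite_measure (density M (\<lambda>_. ennreal m))"
      by (rule finite_measureI) (simp add: emeasure_density M.emeasure_space_1 M.emeasure_eq_measure ennreal_mult_eq_top_iff nn_integral_cmult)
    have AE1: "AE t in M. \<bar>t\<bar> \<le> 1" using support by eventually_elim auto
    have "(LINT t|density M (\<lambda>_. ennreal m). poly p t) = L p" for p
    proof -
      have "integrable M (\<lambda>t. t ^ k)" for k
        using integrable_poly[of M 1 "monom 1 k"] AE1 M.finite_measure_axioms by (simp add: poly_monom[abs_def])
      then have "(LINT t|M. poly p t) = (\<Sum>i\<le>degree p. coeff p i * (L (monom 1 i) / m))"
        unfolding poly_altdef by (simp add: Bochner_Integration.integral_sum mono)
      then have "m * (LINT t|M. poly p t) = L p"
        using m by (subst L_poly) (simp add: sum_distrib_left mult.left_commute)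
      then show ?thesis using m by (subst integral_density) (auto cong: measurable_cong_sets)
    qed
    then show thesis
      using fin support m by (intro that[of "density M (\<lambda>_. ennreal m)"]) (auto simp: AE_density)
  qed
qed

section \<open>Semi-inner product spaces and their completion\<close>

text \<open>All rules are rules for the inner product. They suffice because distances are determined by inner
products, and so, once null vectors are divided out, is the equality of vectors: every identity
below is checked by taking inner products.\<close>

locale semi_inner =
  fixes X :: "'a inner_space"
  assumes vecs_nonempty: "vecs X \<noteq> {}"
    and add_closed [simp]: "x \<in> vecs X \<Longrightarrow> y \<in> vecs X \<Longrightarrow> vadd X x y \<in> vecs X"
    and scale_closed [simp]: "x \<in> vecs X \<Longrightarrow> vscale X a x \<in> vecs X"
    and inner_add_left [simp]: "x \<in> vecs X \<Longrightarrow> y \<in> vecs X \<Longrightarrow> z \<in> vecs X \<Longrightarrow>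
      inprod X (vadd X x y) z = inprod X x z + inprod X y z"
    and inner_scale_left [simp]: "x \<in> vecs X \<Longrightarrow> z \<in> vecs X \<Longrightarrow>
      inprod X (vscale X a x) z = a * inprod X x z"
    and inner_sym: "x \<in> vecs X \<Longrightarrow> y \<in> vecs X \<Longrightarrow> inprod X y x = cnj (inprod X x y)"
    and inner_nonneg: "x \<in> vecs X \<Longrightarrow> 0 \<le> Re (inprod X x x)"
begin

lemma inner_add_right [simp]:
  "x \<in> vecs X \<Longrightarrow> y \<in> vecs X \<Longrightarrow> z \<in> vecs X \<Longrightarrow> inprod X z (vadd X x y) = inprod X z x + inprod X z y"
  by (subst (1 2 3) inner_sym) auto

lemma inner_scale_right [simp]:
  "x \<in> vecs X \<Longrightarrow> z \<in> vecs X \<Longrightarrow> inprod X z (vscale X a x) = cnj a * inprod X z x"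
  by (subst (1 2) inner_sym) auto

lemma Re_inner_sym: "x \<in> vecs X \<Longrightarrow> y \<in> vecs X \<Longrightarrow> Re (inprod X y x) = Re (inprod X x y)"
  by (subst inner_sym) auto

lemma vnorm_nonneg [simp]: "x \<in> vecs X \<Longrightarrow> 0 \<le> vnorm X x"
  unfolding vnorm_def by (simp add: inner_nonneg)

lemma vnorm_square: "x \<in> vecs X \<Longrightarrow> (vnorm X x)\<^sup>2 = Re (inprod X x x)"
  unfolding vnorm_def by (simp add: inner_nonneg)

lemma inner_self: "x \<in> vecs X \<Longrightarrow> inprod X x x = complex_of_real ((vnorm X x)\<^sup>2)"
proof -
  assume x: "x \<in> vecs X"
  have "inprod X x x = cnj (inprod X x x)" by (rule inner_sym[OF x x])
  then have "Im (inprod X x x) = 0" by (simp add: complex_eq_iff)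
  then show ?thesis using vnorm_square[OF x] by (simp add: complex_eq_iff)
qed

text \<open>The real quadratic function of \<open>t\<close> obtained from \<open>\<langle>z, z\<rangle>\<close> with \<open>z = x - t \<langle>x, y\<rangle> y\<close> is
nonnegative; its value at \<open>t = 1 / \<parallel>y\<parallel>\<^sup>2\<close> gives the claim, and if \<open>\<parallel>y\<parallel> = 0\<close> then it is affine and
must be constant.\<close>

lemma cauchy_schwarz:
  assumes x: "x \<in> vecs X" and y: "y \<in> vecs X"
  shows "cmod (inprod X x y) \<le> vnorm X x * vnorm X y"
proof -
  define c where "c = (cmod (inprod X x y))\<^sup>2"
  have quad: "0 \<le> (vnorm X x)\<^sup>2 - 2 * t * c + t\<^sup>2 * c * (vnorm X y)\<^sup>2" for t :: real
  proof -
    define a where "a = - (complex_of_real t * inprod X x y)"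
    define z where "z = vadd X x (vscale X a y)"
    have z: "z \<in> vecs X" using x y by (simp add: z_def)
    have "inprod X z z = inprod X x x + cnj a * inprod X x y + (a * inprod X y x + a * (cnj a * inprod X y y))"
      using x y by (simp add: z_def algebra_simps)
    also have "inprod X y x = cnj (inprod X x y)" by (rule inner_sym[OF x y])
    also have "cnj a * inprod X x y = - complex_of_real (t * c)"
      unfolding c_def of_real_mult complex_norm_square by (simp add: a_def)
    also have "a * cnj (inprod X x y) = - complex_of_real (t * c)"
      unfolding c_def of_real_mult complex_norm_square by (simp add: a_def)
    also have "a * (cnj a * inprod X y y) = complex_of_real (t\<^sup>2 * c * (vnorm X y)\<^sup>2)"
      unfolding inner_self[OF y] c_def of_real_mult complex_norm_square by (simp add: a_def power2_eq_square)
    finally have "Re (inprod X z z) = (vnorm X x)\<^sup>2 - 2 * t * c + t\<^sup>2 * c * (vnorm X y)\<^sup>2"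
      using inner_self[OF x] by simp
    then show ?thesis using inner_nonneg[OF z] by simp
  qed
  have "c \<le> (vnorm X x)\<^sup>2 * (vnorm X y)\<^sup>2"
  proof (cases "vnorm X y = 0")
    case True
    have "c = 0"
    proof (rule ccontr)
      assume "c \<noteq> 0"
      then show False using quad[of "((vnorm X x)\<^sup>2 + 1) / (2 * c)"] True by simp
    qed
    then show ?thesis by simp
  next
    case False
    define n where "n = (vnorm X y)\<^sup>2"
    have n: "0 < n" using False by (simp add: n_def)
    have "0 \<le> (vnorm X x)\<^sup>2 - 2 * (1 / n) * c + (1 / n)\<^sup>2 * c * n" using quad[of "1 / n"] by (simp add: n_def)
    then have "c / n \<le> (vnorm X x)\<^sup>2" using n by (simp add: power2_eq_square field_simps)
    then show ?thesis using n by (simp add: n_def[symmetric] field_simps)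
  qed
  then have "(cmod (inprod X x y))\<^sup>2 \<le> (vnorm X x * vnorm X y)\<^sup>2"
    by (simp add: c_def power_mult_distrib)
  then show ?thesis by (rule power2_le_imp_le) (simp add: x y)
qed

lemma Re_inner_le: "x \<in> vecs X \<Longrightarrow> y \<in> vecs X \<Longrightarrow> \<bar>Re (inprod X x y)\<bar> \<le> vnorm X x * vnorm X y"
  using cauchy_schwarz[of x y] abs_Re_le_cmod[of "inprod X x y"] by linarith

lemma vnorm_add_le:
  assumes x: "x \<in> vecs X" and y: "y \<in> vecs X"
  shows "vnorm X (vadd X x y) \<le> vnorm X x + vnorm X y"
proof (rule power2_le_imp_le)
  have "(vnorm X (vadd X x y))\<^sup>2 = (vnorm X x)\<^sup>2 + 2 * Re (inprod X x y) + (vnorm X y)\<^sup>2"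
    using x y by (simp add: vnorm_square Re_inner_sym)
  then show "(vnorm X (vadd X x y))\<^sup>2 \<le> (vnorm X x + vnorm X y)\<^sup>2"
    using Re_inner_le[OF x y] by (simp add: power2_sum)
qed (simp add: x y)

lemma vdist_square:
  assumes x: "x \<in> vecs X" and y: "y \<in> vecs X"
  shows "(vdist X x y)\<^sup>2 = Re (inprod X x x) - 2 * Re (inprod X x y) + Re (inprod X y y)"
  using x y by (simp add: vdist_def vnorm_square Re_inner_sym)

lemma vdist_nonneg [simp]: "x \<in> vecs X \<Longrightarrow> y \<in> vecs X \<Longrightarrow> 0 \<le> vdist X x y"
  unfolding vdist_def by simp

lemma vdist_self [simp]: "x \<in> vecs X \<Longrightarrow> vdist X x x = 0"
  using vdist_square[of x x] by simp

lemma vdist_sym: "x \<in> vecs X \<Longrightarrow> y \<in> vecs X \<Longrightarrow> vdist X x y = vdist X y x"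
  by (rule power2_eq_imp_eq) (simp_all add: vdist_square Re_inner_sym)

lemma vdist_triangle:
  assumes x: "x \<in> vecs X" and y: "y \<in> vecs X" and z: "z \<in> vecs X"
  shows "vdist X x z \<le> vdist X x y + vdist X y z"
proof -
  have "vdist X x z = vnorm X (vadd X (vadd X x (vscale X (-1) y)) (vadd X y (vscale X (-1) z)))"
    by (rule power2_eq_imp_eq) (use x y z in \<open>simp_all add: vdist_square vnorm_square Re_inner_sym\<close>)
  also have "\<dots> \<le> vdist X x y + vdist X y z"
    unfolding vdist_def using x y z by (intro vnorm_add_le) auto
  finally show ?thesis .
qed

lemma vdist_add_le:
  assumes "x \<in> vecs X" "x' \<in> vecs X" "y \<in> vecs X" "y' \<in> vecs X"
  shows "vdist X (vadd X x y) (vadd X x' y') \<le> vdist X x x' + vdist X y y'"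
proof -
  have "vdist X (vadd X x y) (vadd X x' y') = vnorm X (vadd X (vadd X x (vscale X (-1) x')) (vadd X y (vscale X (-1) y')))"
    by (rule power2_eq_imp_eq) (use assms in \<open>simp_all add: vdist_square vnorm_square Re_inner_sym\<close>)
  also have "\<dots> \<le> vdist X x x' + vdist X y y'"
    unfolding vdist_def using assms by (intro vnorm_add_le) auto
  finally show ?thesis .
qed

lemma vdist_scale:
  assumes "x \<in> vecs X" "y \<in> vecs X"
  shows "vdist X (vscale X a x) (vscale X a y) = cmod a * vdist X x y"
proof (rule power2_eq_imp_eq)
  have *: "Re (a * (cnj a * z)) = (cmod a)\<^sup>2 * Re z" for z
    unfolding mult.assoc[symmetric] complex_norm_square[symmetric] by simp
  have **: "Re (cnj a * (a * z)) = (cmod a)\<^sup>2 * Re z" for z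
    using *[of z] by (simp add: mult_ac)
  show "(vdist X (vscale X a x) (vscale X a y))\<^sup>2 = (cmod a * vdist X x y)\<^sup>2"
    using assms by (simp add: vdist_square power_mult_distrib * ** algebra_simps del: times_complex.sel)
qed (use assms in auto)

lemma inner_diff_le:
  assumes x: "x \<in> vecs X" "x' \<in> vecs X" and y: "y \<in> vecs X" "y' \<in> vecs X"
  shows "cmod (inprod X x y - inprod X x' y') \<le> vdist X x x' * vnorm X y + vnorm X x' * vdist X y y'"
proof -
  have "inprod X x y - inprod X x' y' = inprod X (vadd X x (vscale X (-1) x')) y + inprod X x' (vadd X y (vscale X (-1) y'))"
    using x y by simp
  also have "cmod \<dots> \<le> vdist X x x' * vnorm X y + vnorm X x' * vdist X y y'"
    unfolding vdist_def using x y by (intro order_trans[OF norm_triangle_ineq] add_mono cauchy_schwarz) auto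
  finally show ?thesis .
qed

lemma vnorm_diff_le:
  assumes x: "x \<in> vecs X" and y: "y \<in> vecs X"
  shows "vnorm X x \<le> vnorm X y + vdist X x y"
proof -
  have "vnorm X x = vnorm X (vadd X y (vadd X x (vscale X (-1) y)))"
    by (rule power2_eq_imp_eq) (use x y in \<open>simp_all add: vnorm_square Re_inner_sym\<close>)
  also have "\<dots> \<le> vnorm X y + vdist X x y"
    unfolding vdist_def using x y by (intro vnorm_add_le) auto
  finally show ?thesis .
qed

lemma inner_tendsto:
  assumes s: "\<And>n. s n \<in> vecs X" "x \<in> vecs X" "(\<lambda>n. vdist X (s n) x) \<longlonglongrightarrow> 0"
    and t: "\<And>n. t n \<in> vecs X" "y \<in> vecs X" "(\<lambda>n. vdist X (t n) y) \<longlonglongrightarrow> 0"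
  shows "(\<lambda>n. inprod X (s n) (t n)) \<longlonglongrightarrow> inprod X x y"
proof (rule Lim_transform2[OF tendsto_const])
  have "(\<lambda>n. vdist X (s n) x * vnorm X y + (vnorm X x + vdist X (s n) x) * vdist X (t n) y) \<longlonglongrightarrow> 0 * vnorm X y + (vnorm X x + 0) * 0"
    by (intro tendsto_intros s t)
  then have lim: "(\<lambda>n. vdist X (s n) x * vnorm X y + (vnorm X x + vdist X (s n) x) * vdist X (t n) y) \<longlonglongrightarrow> 0" by simp
  show "(\<lambda>n. inprod X x y - inprod X (s n) (t n)) \<longlonglongrightarrow> 0"
  proof (rule Lim_null_comparison[OF _ lim], intro always_eventually allI)
    fix n
    have "norm (inprod X x y - inprod X (s n) (t n)) \<le> vdist X x (s n) * vnorm X y + vnorm X (s n) * vdist X y (t n)"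
      using s t by (intro inner_diff_le) auto
    also have "\<dots> \<le> vdist X (s n) x * vnorm X y + (vnorm X x + vdist X (s n) x) * vdist X (t n) y"
      using s(1,2) t(1,2) vnorm_diff_le[of "s n" x]
      by (intro add_mono mult_mono) (auto simp: vdist_sym[of x "s n"] vdist_sym[of y "t n"])
    finally show "norm (inprod X x y - inprod X (s n) (t n)) \<le> vdist X (s n) x * vnorm X y + (vnorm X x + vdist X (s n) x) * vdist X (t n) y" .
  qed
qed

end

locale hilbert = semi_inner +
  assumes vdist_zero_imp_eq: "x \<in> vecs X \<Longrightarrow> y \<in> vecs X \<Longrightarrow> vdist X x y = 0 \<Longrightarrow> x = y"
    and complete: "s \<in> cauchy_seqs X \<Longrightarrow> \<exists>x\<in>vecs X. (\<lambda>n. vdist X (s n) x) \<longlonglongrightarrow> 0"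
begin

lemma inner_ext:
  assumes x: "x \<in> vecs X" and y: "y \<in> vecs X"
    and eq: "\<And>z. z \<in> vecs X \<Longrightarrow> inprod X x z = inprod X y z"
  shows "x = y"
proof (rule vdist_zero_imp_eq[OF x y])
  have "(vdist X x y)\<^sup>2 = 0"
    unfolding vdist_square[OF x y] using eq[OF x] eq[OF y] x y by (simp add: Re_inner_sym)
  then show "vdist X x y = 0" by simp
qed

end

context semi_inner
begin

lemma cauchy_seqs_vecs: "s \<in> cauchy_seqs X \<Longrightarrow> s n \<in> vecs X"
  unfolding cauchy_seqs_def by blast

lemma const_cauchy_seq: "x \<in> vecs X \<Longrightarrow> (\<lambda>_. x) \<in> cauchy_seqs X"
  unfolding cauchy_seqs_def by simp

lemma cauchy_seqs_bounded:
  assumes "s \<in> cauchy_seqs X"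
  obtains K where "\<And>n. vnorm X (s n) \<le> K"
proof -
  obtain N where N: "\<forall>m\<ge>N. \<forall>n\<ge>N. vdist X (s m) (s n) < 1"
    using assms unfolding cauchy_seqs_def by (auto dest: spec[of _ "1::real"])
  have "vnorm X (s n) \<le> (\<Sum>i\<le>N. vnorm X (s i)) + 1" for n
  proof (cases "n \<le> N")
    case True
    have "vnorm X (s n) \<le> (\<Sum>i\<le>N. vnorm X (s i))"
      using True assms by (intro member_le_sum) (auto simp: cauchy_seqs_vecs)
    then show ?thesis by simp
  next
    case False
    then have "vdist X (s n) (s N) < 1" using N by simp
    then have "vnorm X (s n) \<le> vnorm X (s N) + 1"
      using vnorm_diff_le[of "s n" "s N"] assms by (simp add: cauchy_seqs_vecs)
    moreover have "vnorm X (s N) \<le> (\<Sum>i\<le>N. vnorm X (s i))"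
      using assms by (intro member_le_sum) (auto simp: cauchy_seqs_vecs)
    ultimately show ?thesis by simp
  qed
  then show thesis by (rule that)
qed

lemma inner_convergent:
  assumes s: "s \<in> cauchy_seqs X" and t: "t \<in> cauchy_seqs X"
  shows "convergent (\<lambda>n. inprod X (s n) (t n))"
proof -
  obtain K where K: "\<And>n. vnorm X (s n) \<le> K" using cauchy_seqs_bounded[OF s] by blast
  obtain L where L: "\<And>n. vnorm X (t n) \<le> L" using cauchy_seqs_bounded[OF t] by blast
  note mem = cauchy_seqs_vecs[OF s] cauchy_seqs_vecs[OF t]
  define B where "B = max (max K L) 1"
  have B: "0 < B" "\<And>n. vnorm X (s n) \<le> B" "\<And>n. vnorm X (t n) \<le> B"
    using K L unfolding B_def by (auto simp: le_max_iff_disj)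
  have "Cauchy (\<lambda>n. inprod X (s n) (t n))"
  proof (rule metric_CauchyI)
    fix e :: real assume e: "0 < e"
    then have e': "0 < e / (2 * B)" using B by simp
    obtain N1 where N1: "\<forall>m\<ge>N1. \<forall>n\<ge>N1. vdist X (s m) (s n) < e / (2 * B)"
      using s e' unfolding cauchy_seqs_def by blast
    obtain N2 where N2: "\<forall>m\<ge>N2. \<forall>n\<ge>N2. vdist X (t m) (t n) < e / (2 * B)"
      using t e' unfolding cauchy_seqs_def by blast
    show "\<exists>M. \<forall>m\<ge>M. \<forall>n\<ge>M. dist (inprod X (s m) (t m)) (inprod X (s n) (t n)) < e"
    proof (intro exI[of _ "max N1 N2"] allI impI)
      fix m n assume mn: "max N1 N2 \<le> m" "max N1 N2 \<le> n"
      have "dist (inprod X (s m) (t m)) (inprod X (s n) (t n))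
          \<le> vdist X (s m) (s n) * vnorm X (t m) + vnorm X (s n) * vdist X (t m) (t n)"
        unfolding dist_norm by (intro inner_diff_le mem)
      also have "\<dots> \<le> vdist X (s m) (s n) * B + B * vdist X (t m) (t n)"
        using B mem by (intro add_mono mult_mono) auto
      also have "\<dots> < e / (2 * B) * B + B * (e / (2 * B))"
        using N1 N2 mn B by (intro add_strict_mono mult_strict_right_mono mult_strict_left_mono) auto
      also have "\<dots> = e" using B by simp
      finally show "dist (inprod X (s m) (t m)) (inprod X (s n) (t n)) < e" .
    qed
  qed
  then show ?thesis by (rule Cauchy_convergent)
qed

lemma equiv_cauchy: "equiv (cauchy_seqs X) (cauchy_equiv X)"
proof (rule equivI)
  show "cauchy_equiv X \<subseteq> cauchy_seqs X \<times> cauchy_seqs X" unfolding cauchy_equiv_def by auto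
  show "refl_on (cauchy_seqs X) (cauchy_equiv X)"
    by (rule refl_onI) (auto simp: cauchy_equiv_def cauchy_seqs_vecs)
  show "sym (cauchy_equiv X)"
  proof (rule symI)
    fix s t assume "(s, t) \<in> cauchy_equiv X"
    then have st: "s \<in> cauchy_seqs X" "t \<in> cauchy_seqs X" "(\<lambda>n. vdist X (s n) (t n)) \<longlonglongrightarrow> 0"
      by (auto simp: cauchy_equiv_def)
    have "(\<lambda>n. vdist X (s n) (t n)) = (\<lambda>n. vdist X (t n) (s n))"
      using st(1,2) by (simp add: fun_eq_iff vdist_sym cauchy_seqs_vecs)
    then show "(t, s) \<in> cauchy_equiv X" using st by (simp add: cauchy_equiv_def)
  qed
  show "trans (cauchy_equiv X)"
  proof (rule transI)
    fix s t u assume "(s, t) \<in> cauchy_equiv X" "(t, u) \<in> cauchy_equiv X"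
    then have st: "s \<in> cauchy_seqs X" "t \<in> cauchy_seqs X" "u \<in> cauchy_seqs X"
      "(\<lambda>n. vdist X (s n) (t n)) \<longlonglongrightarrow> 0" "(\<lambda>n. vdist X (t n) (u n)) \<longlonglongrightarrow> 0"
      by (auto simp: cauchy_equiv_def)
    have "(\<lambda>n. vdist X (s n) (u n)) \<longlonglongrightarrow> 0"
      by (rule Lim_null_comparison[OF _ tendsto_add_zero[OF st(4,5)]])
        (use st(1-3) in \<open>auto intro!: vdist_triangle always_eventually simp: cauchy_seqs_vecs\<close>)
    then show "(s, u) \<in> cauchy_equiv X" using st by (simp add: cauchy_equiv_def)
  qed
qed

definition completion where "completion = hilbert_completion X"

lemma vecs_completion: "vecs completion = cauchy_seqs X // cauchy_equiv X"
  unfolding completion_def hilbert_completion_def by simp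

lemma cclass_in [simp]: "s \<in> cauchy_seqs X \<Longrightarrow> cclass X s \<in> vecs completion"
  unfolding vecs_completion cclass_def by (rule quotientI)

lemma crep_in:
  assumes "c \<in> vecs completion"
  shows "crep c \<in> cauchy_seqs X" "cclass X (crep c) = c"
proof -
  obtain s where s: "s \<in> cauchy_seqs X" "c = cauchy_equiv X `` {s}"
    using assms unfolding vecs_completion by (rule quotientE)
  have "s \<in> c" using s equiv_class_self[OF equiv_cauchy] by simp
  then have r: "crep c \<in> c" unfolding crep_def by (rule someI[of "\<lambda>s. s \<in> c"])
  then show "crep c \<in> cauchy_seqs X" using s unfolding cauchy_equiv_def by auto
  have "(s, crep c) \<in> cauchy_equiv X" using r s(2) by simp
  then show "cclass X (crep c) = c"
    unfolding cclass_def s(2) using equiv_class_eq[OF equiv_cauchy] by metis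
qed

lemma vecs_completion_cases:
  assumes "c \<in> vecs completion"
  obtains s where "s \<in> cauchy_seqs X" "c = cclass X s"
  using crep_in[OF assms] that by metis

lemma cclass_eq_iff:
  assumes "s \<in> cauchy_seqs X" "t \<in> cauchy_seqs X"
  shows "cclass X s = cclass X t \<longleftrightarrow> (\<lambda>n. vdist X (s n) (t n)) \<longlonglongrightarrow> 0"
  unfolding cclass_def eq_equiv_class_iff[OF equiv_cauchy assms] using assms
  by (simp add: cauchy_equiv_def)

lemma crep_dist:
  assumes "s \<in> cauchy_seqs X"
  shows "(\<lambda>n. vdist X (crep (cclass X s) n) (s n)) \<longlonglongrightarrow> 0"
  using crep_in[OF cclass_in[OF assms]] cclass_eq_iff assms by blast

text \<open>The inner product of the completion is defined through chosen representatives. Its value is the limit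
along any pair of representatives.\<close>

lemma inner_completion_lim:
  assumes s: "s \<in> cauchy_seqs X" and t: "t \<in> cauchy_seqs X"
  shows "(\<lambda>n. inprod X (s n) (t n)) \<longlonglongrightarrow> inprod completion (cclass X s) (cclass X t)"
proof -
  let ?s = "crep (cclass X s)" and ?t = "crep (cclass X t)"
  have st: "?s \<in> cauchy_seqs X" "?t \<in> cauchy_seqs X" using crep_in s t by auto
  have lim: "(\<lambda>n. inprod X (?s n) (?t n)) \<longlonglongrightarrow> inprod completion (cclass X s) (cclass X t)"
    unfolding completion_def hilbert_completion_def using inner_convergent[OF st]
    by (simp add: convergent_LIMSEQ_iff)
  obtain K where K: "\<And>n. vnorm X (s n) \<le> K" using cauchy_seqs_bounded[OF s] by blast
  obtain L where L: "\<And>n. vnorm X (?t n) \<le> L" using cauchy_seqs_bounded[OF st(2)] by blast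
  have "(\<lambda>n. vdist X (?s n) (s n) * L + K * vdist X (?t n) (t n)) \<longlonglongrightarrow> 0 * L + K * 0"
    by (intro tendsto_intros crep_dist s t)
  then have bound: "(\<lambda>n. vdist X (?s n) (s n) * L + K * vdist X (?t n) (t n)) \<longlonglongrightarrow> 0" by simp
  have "(\<lambda>n. inprod X (?s n) (?t n) - inprod X (s n) (t n)) \<longlonglongrightarrow> 0"
  proof (rule Lim_null_comparison[OF _ bound], intro always_eventually allI)
    fix n
    have mem: "s n \<in> vecs X" "t n \<in> vecs X" "?s n \<in> vecs X" "?t n \<in> vecs X"
      using s t st cauchy_seqs_vecs by auto
    have "norm (inprod X (?s n) (?t n) - inprod X (s n) (t n))
        \<le> vdist X (?s n) (s n) * vnorm X (?t n) + vnorm X (s n) * vdist X (?t n) (t n)"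
      using mem by (intro inner_diff_le)
    also have "\<dots> \<le> vdist X (?s n) (s n) * L + K * vdist X (?t n) (t n)"
      using mem K L by (intro add_mono mult_left_mono mult_right_mono) auto
    finally show "norm (inprod X (?s n) (?t n) - inprod X (s n) (t n)) \<le> vdist X (?s n) (s n) * L + K * vdist X (?t n) (t n)" .
  qed
  from tendsto_diff[OF lim this] show ?thesis by simp
qed

lemma add_cauchy:
  assumes s: "s \<in> cauchy_seqs X" and t: "t \<in> cauchy_seqs X"
  shows "(\<lambda>n. vadd X (s n) (t n)) \<in> cauchy_seqs X"
  unfolding cauchy_seqs_def
proof (intro CollectI conjI allI impI)
  note mem [simp] = cauchy_seqs_vecs[OF s] cauchy_seqs_vecs[OF t]
  show "vadd X (s n) (t n) \<in> vecs X" for n by simp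
  fix e :: real assume "0 < e"
  then have e2: "0 < e / 2" by simp
  obtain N1 where N1: "\<forall>m\<ge>N1. \<forall>n\<ge>N1. vdist X (s m) (s n) < e / 2"
    using s e2 unfolding cauchy_seqs_def by blast
  obtain N2 where N2: "\<forall>m\<ge>N2. \<forall>n\<ge>N2. vdist X (t m) (t n) < e / 2"
    using t e2 unfolding cauchy_seqs_def by blast
  show "\<exists>N. \<forall>m\<ge>N. \<forall>n\<ge>N. vdist X (vadd X (s m) (t m)) (vadd X (s n) (t n)) < e"
  proof (intro exI[of _ "max N1 N2"] allI impI)
    fix m n assume mn: "max N1 N2 \<le> m" "max N1 N2 \<le> n"
    have "vdist X (vadd X (s m) (t m)) (vadd X (s n) (t n)) \<le> vdist X (s m) (s n) + vdist X (t m) (t n)"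
      by (rule vdist_add_le) simp_all
    also have "\<dots> < e / 2 + e / 2" using N1 N2 mn by (intro add_strict_mono) auto
    also have "\<dots> = e" by simp
    finally show "vdist X (vadd X (s m) (t m)) (vadd X (s n) (t n)) < e" .
  qed
qed

lemma scale_cauchy:
  assumes s: "s \<in> cauchy_seqs X"
  shows "(\<lambda>n. vscale X a (s n)) \<in> cauchy_seqs X"
  unfolding cauchy_seqs_def
proof (intro CollectI conjI allI impI)
  note mem [simp] = cauchy_seqs_vecs[OF s]
  show "vscale X a (s n) \<in> vecs X" for n by simp
  fix e :: real assume "0 < e"
  then have "0 < e / (cmod a + 1)" by (simp add: add_nonneg_pos)
  then obtain N where N: "\<forall>m\<ge>N. \<forall>n\<ge>N. vdist X (s m) (s n) < e / (cmod a + 1)"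
    using s unfolding cauchy_seqs_def by blast
  show "\<exists>N. \<forall>m\<ge>N. \<forall>n\<ge>N. vdist X (vscale X a (s m)) (vscale X a (s n)) < e"
  proof (intro exI[of _ N] allI impI)
    fix m n assume mn: "N \<le> m" "N \<le> n"
    have "vdist X (vscale X a (s m)) (vscale X a (s n)) = cmod a * vdist X (s m) (s n)"
      by (rule vdist_scale) simp_all
    also have "\<dots> \<le> (cmod a + 1) * vdist X (s m) (s n)" by (intro mult_right_mono) auto
    also have "\<dots> < (cmod a + 1) * (e / (cmod a + 1))"
      using N mn by (intro mult_strict_left_mono) (auto simp: add_nonneg_pos)
    also have "\<dots> = e" by (simp add: add_nonneg_eq_0_iff)
    finally show "vdist X (vscale X a (s m)) (vscale X a (s n)) < e" .
  qed
qed

lemma add_completion: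
  assumes s: "s \<in> cauchy_seqs X" and t: "t \<in> cauchy_seqs X"
  shows "vadd completion (cclass X s) (cclass X t) = cclass X (\<lambda>n. vadd X (s n) (t n))"
proof -
  let ?s = "crep (cclass X s)" and ?t = "crep (cclass X t)"
  have st: "?s \<in> cauchy_seqs X" "?t \<in> cauchy_seqs X" using crep_in s t by auto
  have "cclass X (\<lambda>n. vadd X (?s n) (?t n)) = cclass X (\<lambda>n. vadd X (s n) (t n))"
  proof (subst cclass_eq_iff[OF add_cauchy[OF st] add_cauchy[OF s t]],
      rule Lim_null_comparison[OF _ tendsto_add_zero[OF crep_dist[OF s] crep_dist[OF t]]],
      intro always_eventually allI)
    fix n
    have mem: "s n \<in> vecs X" "t n \<in> vecs X" "?s n \<in> vecs X" "?t n \<in> vecs X"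
      using s t st cauchy_seqs_vecs by auto
    then show "norm (vdist X (vadd X (?s n) (?t n)) (vadd X (s n) (t n))) \<le> vdist X (?s n) (s n) + vdist X (?t n) (t n)"
      by (simp add: vdist_add_le)
  qed
  then show ?thesis unfolding completion_def hilbert_completion_def by simp
qed

lemma scale_completion:
  assumes s: "s \<in> cauchy_seqs X"
  shows "vscale completion a (cclass X s) = cclass X (\<lambda>n. vscale X a (s n))"
proof -
  let ?s = "crep (cclass X s)"
  have st: "?s \<in> cauchy_seqs X" using crep_in s by auto
  have "cclass X (\<lambda>n. vscale X a (?s n)) = cclass X (\<lambda>n. vscale X a (s n))"
  proof (subst cclass_eq_iff[OF scale_cauchy[OF st] scale_cauchy[OF s]])
    have "(\<lambda>n. cmod a * vdist X (?s n) (s n)) \<longlonglongrightarrow> cmod a * 0"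
      by (intro tendsto_intros crep_dist s)
    then show "(\<lambda>n. vdist X (vscale X a (?s n)) (vscale X a (s n))) \<longlonglongrightarrow> 0"
      using st s by (simp add: vdist_scale cauchy_seqs_vecs)
  qed
  then show ?thesis unfolding completion_def hilbert_completion_def by simp
qed

lemma semi_inner_completion: "semi_inner completion"
proof
  show "vecs completion \<noteq> {}"
  proof -
    obtain x where "x \<in> vecs X" using vecs_nonempty by blast
    then show ?thesis using cclass_in[OF const_cauchy_seq] by blast
  qed
  show "vadd completion c d \<in> vecs completion" if "c \<in> vecs completion" "d \<in> vecs completion" for c d
    using that by (elim vecs_completion_cases) (simp add: add_completion add_cauchy)
  show "vscale completion a c \<in> vecs completion" if "c \<in> vecs completion" for a c
    using that by (elim vecs_completion_cases) (simp add: scale_completion scale_cauchy)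
  show "inprod completion (vadd completion c d) e = inprod completion c e + inprod completion d e"
    if cde: "c \<in> vecs completion" "d \<in> vecs completion" "e \<in> vecs completion" for c d e
  proof -
    obtain s where s: "s \<in> cauchy_seqs X" "c = cclass X s" using cde(1) by (rule vecs_completion_cases)
    obtain t where t: "t \<in> cauchy_seqs X" "d = cclass X t" using cde(2) by (rule vecs_completion_cases)
    obtain u where u: "u \<in> cauchy_seqs X" "e = cclass X u" using cde(3) by (rule vecs_completion_cases)
    have "(\<lambda>n. inprod X (vadd X (s n) (t n)) (u n)) \<longlonglongrightarrow> inprod completion (vadd completion c d) e"
      unfolding s(2) t(2) u(2) add_completion[OF s(1) t(1)] by (rule inner_completion_lim[OF add_cauchy[OF s(1) t(1)] u(1)])
    moreover have "(\<lambda>n. inprod X (vadd X (s n) (t n)) (u n)) \<longlonglongrightarrow> inprod completion c e + inprod completion d e"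
      using tendsto_add[OF inner_completion_lim[OF s(1) u(1)] inner_completion_lim[OF t(1) u(1)]] s t u
      by (simp add: cauchy_seqs_vecs)
    ultimately show ?thesis by (rule LIMSEQ_unique)
  qed
  show "inprod completion (vscale completion a c) e = a * inprod completion c e" if ce: "c \<in> vecs completion" "e \<in> vecs completion" for a c e
  proof -
    obtain s where s: "s \<in> cauchy_seqs X" "c = cclass X s" using ce(1) by (rule vecs_completion_cases)
    obtain u where u: "u \<in> cauchy_seqs X" "e = cclass X u" using ce(2) by (rule vecs_completion_cases)
    have "(\<lambda>n. inprod X (vscale X a (s n)) (u n)) \<longlonglongrightarrow> inprod completion (vscale completion a c) e"
      unfolding s(2) u(2) scale_completion[OF s(1)] by (rule inner_completion_lim[OF scale_cauchy[OF s(1)] u(1)])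
    moreover have "(\<lambda>n. inprod X (vscale X a (s n)) (u n)) \<longlonglongrightarrow> a * inprod completion c e"
      using tendsto_mult_left[OF inner_completion_lim[OF s(1) u(1)], of a] s u
      by (simp add: cauchy_seqs_vecs)
    ultimately show ?thesis by (rule LIMSEQ_unique)
  qed
  show "inprod completion e c = cnj (inprod completion c e)" if ce: "c \<in> vecs completion" "e \<in> vecs completion" for c e
  proof -
    obtain s where s: "s \<in> cauchy_seqs X" "c = cclass X s" using ce(1) by (rule vecs_completion_cases)
    obtain u where u: "u \<in> cauchy_seqs X" "e = cclass X u" using ce(2) by (rule vecs_completion_cases)
    have "(\<lambda>n. inprod X (u n) (s n)) = (\<lambda>n. cnj (inprod X (s n) (u n)))"
      using inner_sym[OF cauchy_seqs_vecs[OF s(1)] cauchy_seqs_vecs[OF u(1)]] by (simp add: fun_eq_iff)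
    then have "(\<lambda>n. inprod X (u n) (s n)) \<longlonglongrightarrow> cnj (inprod completion c e)"
      using tendsto_cnj[OF inner_completion_lim[OF s(1) u(1)]] s u by simp
    moreover have "(\<lambda>n. inprod X (u n) (s n)) \<longlonglongrightarrow> inprod completion e c"
      using inner_completion_lim[OF u(1) s(1)] s u by simp
    ultimately show ?thesis by (rule LIMSEQ_unique[symmetric])
  qed
  show "0 \<le> Re (inprod completion c c)" if c: "c \<in> vecs completion" for c
  proof -
    obtain s where s: "s \<in> cauchy_seqs X" "c = cclass X s" using c by (rule vecs_completion_cases)
    have "(\<lambda>n. Re (inprod X (s n) (s n))) \<longlonglongrightarrow> Re (inprod completion c c)"
      unfolding s(2) by (intro tendsto_Re inner_completion_lim s)
    then show ?thesis
      by (rule LIMSEQ_le_const) (use s in \<open>auto simp: inner_nonneg cauchy_seqs_vecs\<close>)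
  qed
qed

lemma vdist_completion_lim:
  assumes s: "s \<in> cauchy_seqs X" and t: "t \<in> cauchy_seqs X"
  shows "(\<lambda>n. vdist X (s n) (t n)) \<longlonglongrightarrow> vdist completion (cclass X s) (cclass X t)"
proof -
  interpret completion: semi_inner completion by (rule semi_inner_completion)
  have "(\<lambda>n. sqrt (Re (inprod X (s n) (s n)) - 2 * Re (inprod X (s n) (t n)) + Re (inprod X (t n) (t n)))) \<longlonglongrightarrow>
     sqrt (Re (inprod completion (cclass X s) (cclass X s)) - 2 * Re (inprod completion (cclass X s) (cclass X t)) + Re (inprod completion (cclass X t) (cclass X t)))"
    by (intro tendsto_intros inner_completion_lim s t)
  then show ?thesis
    using s t by (simp add: vdist_square[symmetric] completion.vdist_square[symmetric] cauchy_seqs_vecs)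
qed

text \<open>Completeness is a diagonal argument. From a representative of the \<open>j\<close>-th class take a term \<open>t j\<close> that
differs by less than \<open>1 / (j + 1)\<close> from all later ones. Then \<open>t\<close> is a Cauchy sequence in the original
space, and its class is the limit.\<close>

lemma hilbert_completion: "hilbert completion"
proof -
  interpret completion: semi_inner completion by (rule semi_inner_completion)
  show ?thesis
  proof
    show "c = d" if cd: "c \<in> vecs completion" "d \<in> vecs completion" "vdist completion c d = 0" for c d
    proof -
      obtain s where s: "s \<in> cauchy_seqs X" "c = cclass X s" using cd(1) by (rule vecs_completion_cases)
      obtain t where t: "t \<in> cauchy_seqs X" "d = cclass X t" using cd(2) by (rule vecs_completion_cases)
      show ?thesis
        using vdist_completion_lim[OF s(1) t(1)] cd(3) cclass_eq_iff[OF s(1) t(1)] s t by simp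
    qed
    fix S assume S: "S \<in> cauchy_seqs completion"
    define s where "s = (\<lambda>j. crep (S j))"
    have s: "s j \<in> cauchy_seqs X" "S j = cclass X (s j)" for j
      using crep_in[OF completion.cauchy_seqs_vecs[OF S]] by (simp_all add: s_def)
    \<comment> \<open>every class is close to the class of a constant sequence\<close>
    have "\<exists>N. \<forall>m\<ge>N. \<forall>n\<ge>N. vdist X (s j m) (s j n) < 1 / real (Suc j)" for j
      using s(1)[of j] unfolding cauchy_seqs_def by simp
    then obtain N where N: "\<And>j m n. N j \<le> m \<Longrightarrow> N j \<le> n \<Longrightarrow> vdist X (s j m) (s j n) < 1 / real (Suc j)"
      by metis
    define t where "t = (\<lambda>j. s j (N j))"
    have t: "t j \<in> vecs X" for j unfolding t_def using s(1) by (rule cauchy_seqs_vecs)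
    note tc = const_cauchy_seq[OF t]
    have close: "vdist completion (S j) (cclass X (\<lambda>_. t j)) \<le> 1 / real (Suc j)" for j
    proof (rule LIMSEQ_le_const2)
      show "(\<lambda>n. vdist X (s j n) (t j)) \<longlonglongrightarrow> vdist completion (S j) (cclass X (\<lambda>_. t j))"
        unfolding s(2) by (rule vdist_completion_lim[OF s(1) tc])
      show "\<exists>N. \<forall>n\<ge>N. vdist X (s j n) (t j) \<le> 1 / real (Suc j)"
        unfolding t_def using N[of j] by (meson less_imp_le order_refl)
    qed
    have inv0: "(\<lambda>j. 1 / real (Suc j)) \<longlonglongrightarrow> 0" by (rule LIMSEQ_Suc[OF lim_1_over_n])
    have const: "vdist X (t i) (t j) = vdist completion (cclass X (\<lambda>_. t i)) (cclass X (\<lambda>_. t j))" for i j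
      using LIMSEQ_unique[OF tendsto_const vdist_completion_lim[OF tc tc]] .
    have tt: "vdist X (t i) (t j) \<le> 1 / real (Suc i) + vdist completion (S i) (S j) + 1 / real (Suc j)" for i j
    proof -
      have mem: "S i \<in> vecs completion" "S j \<in> vecs completion" "cclass X (\<lambda>_. t i) \<in> vecs completion" "cclass X (\<lambda>_. t j) \<in> vecs completion"
        using completion.cauchy_seqs_vecs[OF S] tc by auto
      have "vdist completion (cclass X (\<lambda>_. t i)) (cclass X (\<lambda>_. t j)) \<le> vdist completion (S i) (cclass X (\<lambda>_. t i)) + vdist completion (S i) (cclass X (\<lambda>_. t j))"
        using completion.vdist_triangle[OF mem(3,1,4)] completion.vdist_sym[OF mem(3,1)] by simp
      also have "vdist completion (S i) (cclass X (\<lambda>_. t j)) \<le> vdist completion (S i) (S j) + vdist completion (S j) (cclass X (\<lambda>_. t j))"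
        using completion.vdist_triangle[OF mem(1,2,4)] .
      finally show ?thesis unfolding const using close[of i] close[of j] by linarith
    qed
    have t_cauchy: "t \<in> cauchy_seqs X"
      unfolding cauchy_seqs_def
    proof (intro CollectI conjI allI impI t)
      fix e :: real assume "0 < e"
      then have e3: "0 < e / 3" by simp
      obtain M1 where M1: "\<forall>m\<ge>M1. \<forall>n\<ge>M1. vdist completion (S m) (S n) < e / 3"
        using S e3 unfolding cauchy_seqs_def by blast
      obtain M2 where M2: "\<And>j. M2 \<le> j \<Longrightarrow> 1 / real (Suc j) < e / 3"
        using order_tendstoD(2)[OF inv0 e3] unfolding eventually_sequentially by blast
      show "\<exists>M. \<forall>m\<ge>M. \<forall>n\<ge>M. vdist X (t m) (t n) < e"
      proof (intro exI[of _ "max M1 M2"] allI impI)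
        fix m n assume mn: "max M1 M2 \<le> m" "max M1 M2 \<le> n"
        have "vdist completion (S m) (S n) < e / 3" "1 / real (Suc m) < e / 3" "1 / real (Suc n) < e / 3"
          using M1 M2 mn by auto
        then show "vdist X (t m) (t n) < e" using tt[of m n] by linarith
      qed
    qed
    show "\<exists>c\<in>vecs completion. (\<lambda>j. vdist completion (S j) c) \<longlonglongrightarrow> 0"
    proof (intro bexI[of _ "cclass X t"] cclass_in t_cauchy)
      show "(\<lambda>j. vdist completion (S j) (cclass X t)) \<longlonglongrightarrow> 0"
      proof (rule LIMSEQ_I)
        fix e :: real assume e: "0 < e"
        then have e2: "0 < e / 3" by simp
        obtain M1 where M1: "\<forall>m\<ge>M1. \<forall>n\<ge>M1. vdist X (t m) (t n) < e / 3"
          using t_cauchy e2 unfolding cauchy_seqs_def by blast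
        obtain M2 where M2: "\<And>j. M2 \<le> j \<Longrightarrow> 1 / real (Suc j) < e / 3"
          using order_tendstoD(2)[OF inv0 e2] unfolding eventually_sequentially by blast
        show "\<exists>M. \<forall>j\<ge>M. norm (vdist completion (S j) (cclass X t) - 0) < e"
        proof (intro exI[of _ "max M1 M2"] allI impI)
          fix j assume j: "max M1 M2 \<le> j"
          have mem: "S j \<in> vecs completion" "cclass X (\<lambda>_. t j) \<in> vecs completion" "cclass X t \<in> vecs completion"
            using completion.cauchy_seqs_vecs[OF S] tc t_cauchy by auto
          have "vdist completion (cclass X (\<lambda>_. t j)) (cclass X t) \<le> e / 3"
          proof (rule LIMSEQ_le_const2[OF vdist_completion_lim[OF tc t_cauchy]])
            show "\<exists>N. \<forall>n\<ge>N. vdist X (t j) (t n) \<le> e / 3"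
              using M1 j by (intro exI[of _ M1]) (auto intro: less_imp_le)
          qed
          moreover have "1 / real (Suc j) < e / 3" using M2 j by auto
          ultimately have "vdist completion (S j) (cclass X t) < e"
            using completion.vdist_triangle[OF mem] close[of j] e by linarith
          then show "norm (vdist completion (S j) (cclass X t) - 0) < e" using mem by simp
        qed
      qed
    qed
  qed
qed

end

text \<open>Linearity of \<open>T\<close> is contained in \<open>T_adj\<close>, as far as inner products can test it: a combination of
vectors may be moved to the other side of the inner product before \<open>T\<close> is applied.\<close>

locale bounded_selfadjoint = semi_inner +
  fixes T :: "'a \<Rightarrow> 'a" and K :: real
  assumes T_closed [simp]: "x \<in> vecs X \<Longrightarrow> T x \<in> vecs X"
    and T_adj: "x \<in> vecs X \<Longrightarrow> y \<in> vecs X \<Longrightarrow> inprod X (T x) y = inprod X x (T y)"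
    and T_bound: "x \<in> vecs X \<Longrightarrow> vnorm X (T x) \<le> K * vnorm X x"
    and K_pos: "0 < K"
begin

text \<open>Moving \<open>T\<close> to the other side of the inner product shows that \<open>T x - T y\<close> and \<open>T (x - y)\<close> have the
same norm.\<close>

lemma T_dist:
  assumes x: "x \<in> vecs X" and y: "y \<in> vecs X"
  shows "vdist X (T x) (T y) \<le> K * vdist X x y"
proof -
  let ?d = "vadd X x (vscale X (-1) y)"
  have "vdist X (T x) (T y) = vnorm X (T ?d)"
  proof (rule power2_eq_imp_eq)
    have "inprod X (T ?d) (T ?d) = inprod X x (T (T ?d)) - inprod X y (T (T ?d))"
      using x y by (subst T_adj) simp_all
    also have "\<dots> = inprod X (T (T x)) ?d - inprod X (T (T y)) ?d"
      using x y by (simp only: T_adj T_closed add_closed scale_closed)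
    also have "\<dots> = inprod X (T x) (T x) - inprod X (T x) (T y) - inprod X (T y) (T x) + inprod X (T y) (T y)"
      using x y by (simp add: T_adj)
    finally show "(vdist X (T x) (T y))\<^sup>2 = (vnorm X (T ?d))\<^sup>2"
      using x y by (simp add: vdist_square vnorm_square Re_inner_sym)
  qed (use x y in simp_all)
  also have "\<dots> \<le> K * vdist X x y" unfolding vdist_def using x y by (intro T_bound) simp
  finally show ?thesis .
qed

lemma T_cauchy:
  assumes s: "s \<in> cauchy_seqs X"
  shows "(\<lambda>n. T (s n)) \<in> cauchy_seqs X"
  unfolding cauchy_seqs_def
proof (intro CollectI conjI allI impI)
  note mem [simp] = cauchy_seqs_vecs[OF s]
  show "T (s n) \<in> vecs X" for n by simp
  fix e :: real assume "0 < e"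
  then have "0 < e / K" using K_pos by simp
  then obtain N where N: "\<forall>m\<ge>N. \<forall>n\<ge>N. vdist X (s m) (s n) < e / K"
    using s unfolding cauchy_seqs_def by blast
  show "\<exists>N. \<forall>m\<ge>N. \<forall>n\<ge>N. vdist X (T (s m)) (T (s n)) < e"
  proof (intro exI[of _ N] allI impI)
    fix m n assume mn: "N \<le> m" "N \<le> n"
    have "vdist X (T (s m)) (T (s n)) \<le> K * vdist X (s m) (s n)" by (rule T_dist) simp_all
    also have "\<dots> < K * (e / K)" using N mn K_pos by (intro mult_strict_left_mono) auto
    also have "\<dots> = e" using K_pos by simp
    finally show "vdist X (T (s m)) (T (s n)) < e" .
  qed
qed

text \<open>The extension of \<open>T\<close> to the completion.\<close>

definition lift :: "(nat \<Rightarrow> 'a) set \<Rightarrow> (nat \<Rightarrow> 'a) set" where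
  "lift = (\<lambda>c\<in>vecs completion. cclass X (\<lambda>n. T (crep c n)))"

lemma lift_cclass:
  assumes s: "s \<in> cauchy_seqs X"
  shows "lift (cclass X s) = cclass X (\<lambda>n. T (s n))"
proof -
  let ?s = "crep (cclass X s)"
  have st: "?s \<in> cauchy_seqs X" using crep_in s by auto
  have "(\<lambda>n. vdist X (T (?s n)) (T (s n))) \<longlonglongrightarrow> 0"
  proof (rule Lim_null_comparison)
    show "\<forall>\<^sub>F n in sequentially. norm (vdist X (T (?s n)) (T (s n))) \<le> K * vdist X (?s n) (s n)"
      using s st by (intro always_eventually) (simp add: T_dist cauchy_seqs_vecs)
    show "(\<lambda>n. K * vdist X (?s n) (s n)) \<longlonglongrightarrow> 0"
      using tendsto_mult_left[OF crep_dist[OF s], of K] by simp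
  qed
  then show ?thesis
    unfolding lift_def using s cclass_eq_iff[OF T_cauchy[OF st] T_cauchy[OF s]] by simp
qed

lemma lift_selfadjoint: "bounded_selfadjoint completion lift K"
proof -
  interpret completion: semi_inner completion by (rule semi_inner_completion)
  show ?thesis
  proof
    show "lift c \<in> vecs completion" if "c \<in> vecs completion" for c
      using that by (elim vecs_completion_cases) (simp add: lift_cclass T_cauchy)
    show "inprod completion (lift c) d = inprod completion c (lift d)" if cd: "c \<in> vecs completion" "d \<in> vecs completion" for c d
    proof -
      obtain s where s: "s \<in> cauchy_seqs X" "c = cclass X s" using cd(1) by (rule vecs_completion_cases)
      obtain t where t: "t \<in> cauchy_seqs X" "d = cclass X t" using cd(2) by (rule vecs_completion_cases)
      have "(\<lambda>n. inprod X (T (s n)) (t n)) \<longlonglongrightarrow> inprod completion (lift c) d"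
        unfolding s(2) t(2) lift_cclass[OF s(1)] by (intro inner_completion_lim T_cauchy s t)
      moreover have "(\<lambda>n. inprod X (s n) (T (t n))) \<longlonglongrightarrow> inprod completion c (lift d)"
        unfolding s(2) t(2) lift_cclass[OF t(1)] by (intro inner_completion_lim T_cauchy s t)
      ultimately show ?thesis
        using LIMSEQ_unique s(1) t(1) by (simp add: T_adj cauchy_seqs_vecs)
    qed
    show "vnorm completion (lift c) \<le> K * vnorm completion c" if c: "c \<in> vecs completion" for c
    proof -
      obtain s where s: "s \<in> cauchy_seqs X" "c = cclass X s" using c by (rule vecs_completion_cases)
      have lim: "(\<lambda>n. vnorm X (u n)) \<longlonglongrightarrow> vnorm completion (cclass X u)" if "u \<in> cauchy_seqs X" for u
        unfolding vnorm_def by (intro tendsto_intros inner_completion_lim that)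
      show ?thesis
      proof (rule LIMSEQ_le)
        show "(\<lambda>n. vnorm X (T (s n))) \<longlonglongrightarrow> vnorm completion (lift c)"
          unfolding s(2) lift_cclass[OF s(1)] by (intro lim T_cauchy s)
        show "(\<lambda>n. K * vnorm X (s n)) \<longlonglongrightarrow> K * vnorm completion c"
          unfolding s(2) by (intro tendsto_intros lim s)
        show "\<exists>N. \<forall>n\<ge>N. vnorm X (T (s n)) \<le> K * vnorm X (s n)"
          using s by (auto simp: T_bound cauchy_seqs_vecs)
      qed
    qed
  qed (rule K_pos)
qed

lemma lift_power:
  assumes x: "x \<in> vecs X"
  shows "(lift ^^ k) (cclass X (\<lambda>_. x)) = cclass X (\<lambda>_. (T ^^ k) x)"
proof (induction k)
  case (Suc k)
  have "(T ^^ k) x \<in> vecs X" using x by (induction k) auto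
  then show ?case using Suc by (simp add: lift_cclass const_cauchy_seq)
qed simp

end

section \<open>Spectral measures and functional calculus\<close>

locale hilbert_operator = hilbert X + bounded_selfadjoint X T K
  for X :: "'a inner_space" and T K
begin

lemma T_power_closed [simp]: "x \<in> vecs X \<Longrightarrow> (T ^^ k) x \<in> vecs X"
  by (induction k) auto

lemma T_power_adj: "x \<in> vecs X \<Longrightarrow> z \<in> vecs X \<Longrightarrow> inprod X ((T ^^ k) x) z = inprod X x ((T ^^ k) z)"
proof (induction k arbitrary: z)
  case (Suc k)
  have "inprod X ((T ^^ Suc k) x) z = inprod X ((T ^^ k) x) (T z)" using Suc.prems by (simp add: T_adj)
  also have "\<dots> = inprod X x ((T ^^ k) (T z))" using Suc by simp
  finally show ?case by (simp add: funpow_swap1)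
qed simp

text \<open>The sesquilinear form \<open>\<langle>p(T) x, z\<rangle>\<close>.\<close>

definition poly_form :: "'a \<Rightarrow> 'a \<Rightarrow> real poly \<Rightarrow> complex" where
  "poly_form x z p = (\<Sum>i\<le>degree p. complex_of_real (coeff p i) * inprod X ((T ^^ i) x) z)"

lemma poly_form_eq: "degree p \<le> n \<Longrightarrow> poly_form x z p = (\<Sum>i\<le>n. complex_of_real (coeff p i) * inprod X ((T ^^ i) x) z)"
  unfolding poly_form_def by (rule sum.mono_neutral_left) (auto simp: not_le coeff_eq_0)

lemma poly_form_add: "poly_form x z (p + q) = poly_form x z p + poly_form x z q"
proof -
  define n where "n = max (degree p) (degree q)"
  have "degree (p + q) \<le> n" "degree p \<le> n" "degree q \<le> n"
    unfolding n_def by (auto intro: degree_add_le_max)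
  then show ?thesis by (simp add: poly_form_eq sum.distrib distrib_right)
qed

lemma poly_form_smult: "poly_form x z (Polynomial.smult c p) = complex_of_real c * poly_form x z p"
  using poly_form_eq[OF degree_smult_le[of c p]] by (simp add: poly_form_def sum_distrib_left mult.assoc)

lemma poly_form_diff: "poly_form x z (p - q) = poly_form x z p - poly_form x z q"
  using poly_form_add[of x z p "Polynomial.smult (-1) q"] poly_form_smult[of x z "-1" q] by simp

lemma poly_form_0 [simp]: "poly_form x z 0 = 0" by (simp add: poly_form_def)

lemma poly_form_pCons: "poly_form x z (pCons a p) = complex_of_real a * inprod X x z + poly_form (T x) z p"
proof -
  have "poly_form x z (pCons a p) = (\<Sum>i\<le>Suc (degree p). complex_of_real (coeff (pCons a p) i) * inprod X ((T ^^ i) x) z)"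
    by (rule poly_form_eq[OF degree_pCons_le])
  also have "\<dots> = complex_of_real a * inprod X x z + poly_form (T x) z p"
    by (simp only: sum.atMost_Suc_shift poly_form_def coeff_pCons_0 coeff_pCons_Suc funpow_0 funpow_Suc_right o_apply)
  finally show ?thesis .
qed

lemma poly_form_sym: "x \<in> vecs X \<Longrightarrow> z \<in> vecs X \<Longrightarrow> poly_form z x p = cnj (poly_form x z p)"
  unfolding poly_form_def cnj_sum
proof (intro sum.cong refl)
  fix i assume x: "x \<in> vecs X" and z: "z \<in> vecs X"
  have "inprod X ((T ^^ i) z) x = cnj (inprod X ((T ^^ i) x) z)"
    using inner_sym[of "(T ^^ i) x" z] T_power_adj[OF z x] inner_sym[of x "(T ^^ i) z"] T_power_adj[OF x z] x z by simp
  then show "complex_of_real (coeff p i) * inprod X ((T ^^ i) z) x = cnj (complex_of_real (coeff p i) * inprod X ((T ^^ i) x) z)"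
    by simp
qed

text \<open>The vector \<open>p(T) x\<close>.\<close>

definition poly_op :: "real poly \<Rightarrow> 'a \<Rightarrow> 'a" where
  "poly_op p x = foldr (\<lambda>i y. vadd X (vscale X (complex_of_real (coeff p i)) ((T ^^ i) x)) y) [0..<Suc (degree p)] (vscale X 0 x)"

lemma poly_op_closed [simp]: "x \<in> vecs X \<Longrightarrow> poly_op p x \<in> vecs X"
proof -
  assume x: "x \<in> vecs X"
  have "foldr (\<lambda>i y. vadd X (vscale X (complex_of_real (coeff p i)) ((T ^^ i) x)) y) is (vscale X 0 x) \<in> vecs X" for "is"
    using x by (induction "is") simp_all
  then show ?thesis unfolding poly_op_def .
qed

lemma inner_poly_op: "x \<in> vecs X \<Longrightarrow> z \<in> vecs X \<Longrightarrow> inprod X (poly_op p x) z = poly_form x z p"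
proof -
  assume x: "x \<in> vecs X" and z: "z \<in> vecs X"
  define F where "F = (\<lambda>is. foldr (\<lambda>i y. vadd X (vscale X (complex_of_real (coeff p i)) ((T ^^ i) x)) y) is (vscale X 0 x))"
  have "F is \<in> vecs X \<and> inprod X (F is) z = (\<Sum>i\<leftarrow>is. complex_of_real (coeff p i) * inprod X ((T ^^ i) x) z)" for "is"
    using x z by (induction "is") (simp_all add: F_def)
  then have "inprod X (poly_op p x) z = (\<Sum>i\<leftarrow>[0..<Suc (degree p)]. complex_of_real (coeff p i) * inprod X ((T ^^ i) x) z)"
    unfolding poly_op_def F_def by blast
  also have "\<dots> = poly_form x z p"
    unfolding poly_form_def by (simp only: interv_sum_list_conv_sum_set_nat set_upt atLeastLessThanSuc_atLeastAtMost atMost_atLeast0)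
  finally show ?thesis .
qed

lemma poly_form_poly_op_right: "x \<in> vecs X \<Longrightarrow> z \<in> vecs X \<Longrightarrow> poly_form x (poly_op q z) p = poly_form x z (p * q)"
proof (induction p arbitrary: x)
  case (pCons a p)
  have "inprod X x (poly_op q z) = poly_form x z q"
    using inner_sym[of "poly_op q z" x] inner_poly_op[of z x q] poly_form_sym[of z x q] pCons.prems by simp
  then show ?case using pCons by (simp add: poly_form_pCons poly_form_add poly_form_smult)
qed simp

lemma poly_form_poly_op_left: "x \<in> vecs X \<Longrightarrow> z \<in> vecs X \<Longrightarrow> poly_form (poly_op q x) z p = poly_form x z (p * q)"
  using poly_form_sym[of z "poly_op q x" p] poly_form_poly_op_right[of z x q p] poly_form_sym[of z x "p * q"] by simp

lemma inner_poly_op_poly_op: "x \<in> vecs X \<Longrightarrow> z \<in> vecs X \<Longrightarrow> inprod X (poly_op p x) (poly_op q z) = poly_form x z (p * q)"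
  by (simp add: inner_poly_op poly_form_poly_op_right)

lemma vdist_poly_op: "x \<in> vecs X \<Longrightarrow> (vdist X (poly_op p x) (poly_op q x))\<^sup>2 = Re (poly_form x x ((p - q) ^ 2))"
proof -
  assume x: "x \<in> vecs X"
  have "(p - q) ^ 2 = p * p - (p * q + p * q) + q * q"
    by (simp add: power2_eq_square algebra_simps)
  then have "poly_form x x ((p - q) ^ 2) = poly_form x x (p * p) - (poly_form x x (p * q) + poly_form x x (p * q)) + poly_form x x (q * q)"
    by (simp only: poly_form_add poly_form_diff)
  then show ?thesis using x by (simp add: vdist_square inner_poly_op_poly_op)
qed

lemma Re_poly_form_square_nonneg: "x \<in> vecs X \<Longrightarrow> 0 \<le> Re (poly_form x x (q ^ 2))"
  unfolding power2_eq_square inner_poly_op_poly_op[symmetric] by (simp add: inner_nonneg)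

lemma T_inner_bound: "y \<in> vecs X \<Longrightarrow> \<bar>Re (inprod X (T y) y)\<bar> \<le> K * Re (inprod X y y)"
proof -
  assume y: "y \<in> vecs X"
  have "\<bar>Re (inprod X (T y) y)\<bar> \<le> vnorm X (T y) * vnorm X y" using y by (intro Re_inner_le) auto
  also have "\<dots> \<le> (K * vnorm X y) * vnorm X y" using y by (intro mult_right_mono T_bound) auto
  finally show ?thesis using y by (simp add: vnorm_square[symmetric] power2_eq_square mult.assoc)
qed

lemma Re_poly_form_linear_factors_nonneg:
  assumes y: "y \<in> vecs X"
  shows "0 \<le> Re (poly_form y y [:K, 1:])" "0 \<le> Re (poly_form y y [:K, - 1:])" "0 \<le> Re (poly_form y y ([:K, 1:] * [:K, - 1:]))"
proof -
  show "0 \<le> Re (poly_form y y [:K, 1:])" "0 \<le> Re (poly_form y y [:K, - 1:])"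
    using T_inner_bound[OF y] by (simp_all add: poly_form_pCons)
  have "(vnorm X (T y))\<^sup>2 \<le> (K * vnorm X y)\<^sup>2" using y by (intro power_mono T_bound) auto
  then have "Re (inprod X (T (T y)) y) \<le> K * K * Re (inprod X y y)"
    using y by (simp add: vnorm_square power_mult_distrib T_adj power2_eq_square[of K])
  then show "0 \<le> Re (poly_form y y ([:K, 1:] * [:K, - 1:]))" by (simp add: poly_form_pCons)
qed

text \<open>Splitting off squares leaves one of the factors \<open>1\<close>, \<open>K + T\<close>, \<open>K - T\<close> and \<open>K\<^sup>2 - T\<^sup>2\<close>. These are
positive because \<open>\<parallel>T\<parallel> \<le> K\<close>, and passing from \<open>x\<close> to \<open>q(T) x\<close> absorbs the square \<open>q\<^sup>2\<close>.\<close>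

lemma Re_poly_form_bernstein_nonneg:
  assumes x: "x \<in> vecs X"
  shows "0 \<le> Re (poly_form x x ([:K, 1:] ^ k * [:K, - 1:] ^ l))"
proof -
  define q where "q = [:K, 1:] ^ (k div 2) * [:K, - 1:] ^ (l div 2)"
  define r where "r = [:K, 1:] ^ (k mod 2) * [:K, - 1:] ^ (l mod 2)"
  have "[:K, 1:] ^ k = ([:K, 1:] ^ (k div 2))\<^sup>2 * [:K, 1:] ^ (k mod 2)"
    "[:K, - 1:] ^ l = ([:K, - 1:] ^ (l div 2))\<^sup>2 * [:K, - 1:] ^ (l mod 2)"
    by (simp_all add: power_mult[symmetric] power_add[symmetric])
  then have "[:K, 1:] ^ k * [:K, - 1:] ^ l = (r * q) * q"
    by (simp add: q_def r_def power2_eq_square mult_ac)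
  then have eq: "poly_form x x ([:K, 1:] ^ k * [:K, - 1:] ^ l) = poly_form (poly_op q x) (poly_op q x) r"
    using x by (simp add: poly_form_poly_op_left poly_form_poly_op_right mult_ac)
  note y = poly_op_closed[OF x, of q]
  consider "k mod 2 = 0" "l mod 2 = 0" | "k mod 2 = 0" "l mod 2 = 1" | "k mod 2 = 1" "l mod 2 = 0" | "k mod 2 = 1" "l mod 2 = 1"
    by linarith
  then show ?thesis
  proof cases
    case 1
    then have "r = 1 ^ 2" by (simp add: r_def)
    then show ?thesis unfolding eq using Re_poly_form_square_nonneg[OF y, of 1] by simp
  next
    case 2 then show ?thesis unfolding eq r_def using Re_poly_form_linear_factors_nonneg(2)[OF y] by simp
  next
    case 3 then show ?thesis unfolding eq r_def using Re_poly_form_linear_factors_nonneg(1)[OF y] by simp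
  next
    case 4 then show ?thesis unfolding eq r_def using Re_poly_form_linear_factors_nonneg(3)[OF y] by simp
  qed
qed

lemma Im_poly_form: "x \<in> vecs X \<Longrightarrow> poly_form x x p = complex_of_real (Re (poly_form x x p))"
proof -
  assume x: "x \<in> vecs X"
  have "Im (poly_form x x p) = 0" using poly_form_sym[OF x x, of p] by (simp add: complex_eq_iff)
  then show ?thesis by (simp add: complex_eq_iff)
qed

text \<open>An affine substitution moves \<open>[-K, K]\<close> to \<open>[0, 1]\<close> and turns the preceding positivity into the
hypothesis of the Hausdorff moment problem.\<close>

lemma spectral_measure_exists:
  assumes x: "x \<in> vecs X"
  obtains \<mu> :: "real measure" where "sets \<mu> = sets borel" "finite_measure \<mu>" "AE t in \<mu>. \<bar>t\<bar> \<le> K"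
    "\<And>p. poly_form x x p = complex_of_real (LINT t|\<mu>. poly p t)"
proof -
  define s where "s = [:1 / 2, 1 / (2 * K):]"
  define L where "L = (\<lambda>q. Re (poly_form x x (pcompose q s)))"
  have K: "K \<noteq> 0" using K_pos by simp
  have half: "pcompose [:0, 1:] s = Polynomial.smult (1 / (2 * K)) [:K, 1:]" "pcompose [:1, - 1:] s = Polynomial.smult (1 / (2 * K)) [:K, - 1:]"
    using K by (simp_all add: s_def pcompose_pCons)
  obtain \<nu> :: "real measure" where nu: "sets \<nu> = sets borel" "finite_measure \<nu>" "AE t in \<nu>. 0 \<le> t \<and> t \<le> 1"
    "\<And>p. (LINT t|\<nu>. poly p t) = L p"
  proof (rule hausdorff_moment[of L])
    show "L (p + q) = L p + L q" for p q by (simp add: L_def pcompose_add poly_form_add)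
    show "L (Polynomial.smult c p) = c * L p" for c p by (simp add: L_def pcompose_smult poly_form_smult)
    fix n k :: nat assume "k \<le> n"
    have pcompose_power: "pcompose (r ^ i) s = pcompose r s ^ i" for r i
      by (induction i) (simp_all add: pcompose_mult pcompose_1)
    have "pcompose ([:0, 1:] ^ k * [:1, - 1:] ^ (n - k)) s
        = Polynomial.smult ((1 / (2 * K)) ^ (n - k) * (1 / (2 * K)) ^ k) ([:K, 1:] ^ k * [:K, - 1:] ^ (n - k))"
      by (simp only: pcompose_mult pcompose_power half smult_power mult_smult_left mult_smult_right smult_smult)
    then show "0 \<le> L ([:0, 1:] ^ k * [:1, - 1:] ^ (n - k))"
      unfolding L_def using K_pos Re_poly_form_bernstein_nonneg[OF x, of k "n - k"] by (simp add: poly_form_smult)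
  qed blast
  define u where "u = [:- K, 2 * K:]"
  define \<mu> where "\<mu> = distr \<nu> borel (poly u)"
  have meas: "poly u \<in> measurable \<nu> borel" using nu(1) by (simp cong: measurable_cong_sets)
  have us: "pcompose u s = [:0, 1:]" using K by (simp add: u_def s_def pcompose_pCons)
  show thesis
  proof (rule that)
    show "sets \<mu> = sets borel" by (simp add: \<mu>_def)
    show "finite_measure \<mu>" unfolding \<mu>_def by (rule finite_measure.finite_measure_distr[OF nu(2) meas])
    have "AE t in \<nu>. \<bar>poly u t\<bar> \<le> K"
      using nu(3)
    proof eventually_elim
      case (elim t)
      then have "0 \<le> K * t" "K * t \<le> K * 1" using K_pos by (auto intro: mult_left_mono)
      then show ?case by (simp add: u_def abs_le_iff algebra_simps)
    qed
    then show "AE t in \<mu>. \<bar>t\<bar> \<le> K" unfolding \<mu>_def by (subst AE_distr_iff[OF meas]) auto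
    fix p
    have "(\<lambda>t. poly p (poly u t)) = poly (pcompose p u)" by (simp add: fun_eq_iff poly_pcompose)
    then have "(LINT t|\<mu>. poly p t) = (LINT t|\<nu>. poly (pcompose p u) t)"
      unfolding \<mu>_def by (subst integral_distr[OF meas]) simp_all
    also have "\<dots> = Re (poly_form x x (pcompose p (pcompose u s)))"
      unfolding nu(4) L_def by (simp add: pcompose_assoc)
    also have "pcompose p (pcompose u s) = p" unfolding us by (simp add: pcompose_idR)
    finally show "poly_form x x p = complex_of_real (LINT t|\<mu>. poly p t)" using Im_poly_form[OF x, of p] by simp
  qed
qed

lemma spectral_measure:
  assumes x: "x \<in> vecs X"
  shows "sets (spectral_measure X T x) = sets borel" "finite_measure (spectral_measure X T x)"
    "AE t in spectral_measure X T x. \<bar>t\<bar> \<le> K"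
    "\<And>p. poly_form x x p = complex_of_real (LINT t|spectral_measure X T x. poly p t)"
proof -
  obtain \<mu> :: "real measure" where mu: "sets \<mu> = sets borel" "finite_measure \<mu>" "AE t in \<mu>. \<bar>t\<bar> \<le> K"
    "\<And>p. poly_form x x p = complex_of_real (LINT t|\<mu>. poly p t)"
    using spectral_measure_exists[OF x] by blast
  have mom: "inprod X ((T ^^ k) x) x = complex_of_real (LINT t|\<mu>. t ^ k)" for k
  proof -
    have "poly_form x x (monom 1 k) = (\<Sum>i\<le>k. if i = k then inprod X ((T ^^ k) x) x else 0)"
      unfolding poly_form_def by (rule sum.cong) (auto simp: degree_monom_eq coeff_monom)
    then show ?thesis using mu(4)[of "monom 1 k"] by (simp add: poly_monom)
  qed
  have eq: "spectral_measure X T x = \<mu>"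
    unfolding spectral_measure_def
  proof (rule the_equality)
    show "sets \<mu> = sets borel \<and> finite_measure \<mu> \<and> (\<exists>K. AE t in \<mu>. \<bar>t\<bar> \<le> K) \<and>
        (\<forall>k. inprod X ((T ^^ k) x) x = complex_of_real (LINT t|\<mu>. t ^ k))"
      using mu(1-3) mom by blast
    fix \<nu> :: "real measure"
    assume nu: "sets \<nu> = sets borel \<and> finite_measure \<nu> \<and> (\<exists>K. AE t in \<nu>. \<bar>t\<bar> \<le> K) \<and>
        (\<forall>k. inprod X ((T ^^ k) x) x = complex_of_real (LINT t|\<nu>. t ^ k))"
    then obtain K' where K': "AE t in \<nu>. \<bar>t\<bar> \<le> K'" by blast
    show "\<nu> = \<mu>"
    proof (rule compact_measure_unique[of _ "max K K'"])
      show "AE t in \<nu>. \<bar>t\<bar> \<le> max K K'" using K' by eventually_elim auto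
      show "AE t in \<mu>. \<bar>t\<bar> \<le> max K K'" using mu(3) by eventually_elim auto
      show "(LINT t|\<nu>. t ^ k) = (LINT t|\<mu>. t ^ k)" for k
        using nu mom[of k] by (metis of_real_eq_iff)
    qed (use nu mu in auto)
  qed
  show "sets (spectral_measure X T x) = sets borel" "finite_measure (spectral_measure X T x)"
    "AE t in spectral_measure X T x. \<bar>t\<bar> \<le> K"
    "\<And>p. poly_form x x p = complex_of_real (LINT t|spectral_measure X T x. poly p t)"
    unfolding eq by (fact mu(1), fact mu(2), fact mu(3), fact mu(4))
qed

text \<open>Polarization: a bounded operator is determined by its quadratic form.\<close>

lemma inner_polarization:
  assumes R: "\<And>x. x \<in> vecs X \<Longrightarrow> R x \<in> vecs X"
    "\<And>x y. x \<in> vecs X \<Longrightarrow> y \<in> vecs X \<Longrightarrow> R (vadd X x y) = vadd X (R x) (R y)"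
    "\<And>a x. x \<in> vecs X \<Longrightarrow> R (vscale X a x) = vscale X a (R x)"
    and x: "x \<in> vecs X" and y: "y \<in> vecs X"
  defines "f \<equiv> \<lambda>a. inprod X (R (vadd X x (vscale X a y))) (vadd X x (vscale X a y))"
  shows "4 * inprod X (R x) y = f 1 - f (-1) + \<i> * f \<i> - \<i> * f (-\<i>)"
  using x y by (simp add: f_def R algebra_simps)

text \<open>Since \<open>\<parallel>q(T) x\<parallel>\<^sup>2\<close> is the integral of \<open>q\<^sup>2\<close> with respect to the spectral measure at \<open>x\<close>, and since
the polynomials \<open>p j\<close> converge to \<open>g\<close> in the mean square of every such measure, the vectors
\<open>p\<^sub>j(T) x\<close> converge. The limit defines a bounded operator with the required quadratic form, and
polarization shows that it is the only one.\<close>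

lemma borel_calculus_form:
  fixes g :: "real \<Rightarrow> real"
  assumes g: "g \<in> borel_measurable borel" and p_lim: "\<And>t. \<bar>t\<bar> \<le> K \<Longrightarrow> (\<lambda>j. poly (p j) t) \<longlonglongrightarrow> g t"
    and p_bound: "\<And>j t. \<bar>t\<bar> \<le> K \<Longrightarrow> \<bar>poly (p j) t\<bar> \<le> C"
    and x0: "x0 \<in> vecs X"
  shows "inprod X (borel_calculus X T (\<lambda>t. complex_of_real (g t)) x0) x0
    = complex_of_real (LINT t|spectral_measure X T x0. g t)"
proof -
  have "\<bar>poly (p 0) 0\<bar> \<le> C" using K_pos by (intro p_bound) simp
  then have C0: "0 \<le> C" by linarith
  have sq_bound: "(u - v)\<^sup>2 \<le> (2 * C)\<^sup>2" if "\<bar>u\<bar> \<le> C" "\<bar>v\<bar> \<le> C" for u v :: real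
    using that by (intro abs_le_square_iff[THEN iffD1]) linarith
  have poly_sq: "poly (q\<^sup>2) = (\<lambda>t. (poly q t)\<^sup>2)" for q :: "real poly" by (simp add: fun_eq_iff)
  have g_bound: "\<bar>g t\<bar> \<le> C" if "\<bar>t\<bar> \<le> K" for t
    by (rule LIMSEQ_le_const2[OF tendsto_rabs[OF p_lim[OF that]]]) (use p_bound that in blast)
  let ?\<mu> = "spectral_measure X T"
  have int_g: "integrable (?\<mu> x) g" if "x \<in> vecs X" for x
    by (rule integrable_bounded_on_support[OF spectral_measure(2,1,3)[OF that] g g_bound])
  have int_p: "integrable (?\<mu> x) (poly q)" if "x \<in> vecs X" for x q
    by (rule integrable_poly[OF spectral_measure(2,1,3)[OF that]])
  have meas: "poly q \<in> borel_measurable (?\<mu> x)" "g \<in> borel_measurable (?\<mu> x)" if "x \<in> vecs X" for x q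
    using spectral_measure(1)[OF that] g by (simp_all cong: measurable_cong_sets)
  have dist_int: "(vdist X (poly_op q x) (poly_op r x))\<^sup>2 = (LINT t|?\<mu> x. (poly q t - poly r t)\<^sup>2)" if x: "x \<in> vecs X" for q r x
    using vdist_poly_op[OF x] spectral_measure(4)[OF x, of "(q - r)\<^sup>2"] by simp
  \<comment> \<open>squared distance from \<open>g\<close> in the mean square of the spectral measure at \<open>x\<close>\<close>
  define D where "D = (\<lambda>x j. LINT t|?\<mu> x. (poly (p j) t - g t)\<^sup>2)"
  have int_D: "integrable (?\<mu> x) (\<lambda>t. (poly (p j) t - g t)\<^sup>2)" if x: "x \<in> vecs X" for x j
  proof (rule integrable_bounded_on_support[OF spectral_measure(2,1,3)[OF x], of _ "(2 * C)\<^sup>2"])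
    show "(\<lambda>t. (poly (p j) t - g t)\<^sup>2) \<in> borel_measurable borel" using g by measurable
    show "\<bar>(poly (p j) t - g t)\<^sup>2\<bar> \<le> (2 * C)\<^sup>2" if t: "\<bar>t\<bar> \<le> K" for t
      using sq_bound[OF p_bound[OF t, of j] g_bound[OF t]] by simp
  qed
  have D_lim: "D x \<longlonglongrightarrow> 0" if x: "x \<in> vecs X" for x
  proof -
    interpret fm: finite_measure "?\<mu> x" by (rule spectral_measure(2)[OF x])
    have "D x \<longlonglongrightarrow> (LINT t|?\<mu> x. 0)"
      unfolding D_def
    proof (rule integral_dominated_convergence[where w = "\<lambda>_. (2 * C)\<^sup>2"])
      show "AE t in ?\<mu> x. (\<lambda>j. (poly (p j) t - g t)\<^sup>2) \<longlonglongrightarrow> 0"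
        using spectral_measure(3)[OF x]
      proof eventually_elim
        case (elim t)
        show ?case using tendsto_power[OF tendsto_diff[OF p_lim[OF elim] tendsto_const[of "g t"]], of 2] by simp
      qed
      show "AE t in ?\<mu> x. norm ((poly (p j) t - g t)\<^sup>2) \<le> (2 * C)\<^sup>2" for j
        using spectral_measure(3)[OF x]
      proof eventually_elim
        case (elim t)
        then show ?case
          using sq_bound[OF p_bound[OF elim, of j] g_bound[OF elim]] by simp
      qed
      show "(\<lambda>t. (poly (p j) t - g t)\<^sup>2) \<in> borel_measurable (?\<mu> x)" for j
        using meas[OF x] by simp
    qed simp_all
    then show ?thesis by simp
  qed
  have dist_le: "(vdist X (poly_op (p i) x) (poly_op (p j) x))\<^sup>2 \<le> 2 * D x i + 2 * D x j" if x: "x \<in> vecs X" for x i j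
  proof -
    have "(LINT t|?\<mu> x. (poly (p i) t - poly (p j) t)\<^sup>2)
        \<le> (LINT t|?\<mu> x. 2 * (poly (p i) t - g t)\<^sup>2 + 2 * (poly (p j) t - g t)\<^sup>2)"
    proof (rule integral_mono)
      show "integrable (?\<mu> x) (\<lambda>t. (poly (p i) t - poly (p j) t)\<^sup>2)"
        using int_p[OF x, of "(p i - p j)\<^sup>2"] by (simp add: poly_sq)
      show "integrable (?\<mu> x) (\<lambda>t. 2 * (poly (p i) t - g t)\<^sup>2 + 2 * (poly (p j) t - g t)\<^sup>2)"
        using int_D[OF x] by simp
      show "(poly (p i) t - poly (p j) t)\<^sup>2 \<le> 2 * (poly (p i) t - g t)\<^sup>2 + 2 * (poly (p j) t - g t)\<^sup>2" for t
      proof -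
        have "0 \<le> ((poly (p i) t - g t) + (poly (p j) t - g t))\<^sup>2" by simp
        then show ?thesis by (simp add: power2_eq_square algebra_simps)
      qed
    qed
    also have "\<dots> = 2 * D x i + 2 * D x j" unfolding D_def using int_D[OF x] by simp
    finally show ?thesis unfolding dist_int[OF x] .
  qed
  have "\<exists>y\<in>vecs X. (\<lambda>j. vdist X (poly_op (p j) x) y) \<longlonglongrightarrow> 0" if x: "x \<in> vecs X" for x
  proof (rule complete)
    show "(\<lambda>j. poly_op (p j) x) \<in> cauchy_seqs X"
      unfolding cauchy_seqs_def
    proof (intro CollectI conjI allI impI)
      show "poly_op (p j) x \<in> vecs X" for j using x by simp
      fix e :: real assume e: "0 < e"
      then have "0 < e\<^sup>2 / 4" by simp
      then obtain N where N: "\<And>j. N \<le> j \<Longrightarrow> D x j < e\<^sup>2 / 4"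
        using order_tendstoD(2)[OF D_lim[OF x]] unfolding eventually_sequentially by blast
      show "\<exists>N. \<forall>i\<ge>N. \<forall>j\<ge>N. vdist X (poly_op (p i) x) (poly_op (p j) x) < e"
      proof (intro exI[of _ N] allI impI)
        fix i j assume "N \<le> i" "N \<le> j"
        then have "(vdist X (poly_op (p i) x) (poly_op (p j) x))\<^sup>2 < e\<^sup>2"
          using dist_le[OF x, of i j] N[of i] N[of j] by linarith
        then show "vdist X (poly_op (p i) x) (poly_op (p j) x) < e" using e by (simp add: power2_less_imp_less)
      qed
    qed
  qed
  \<comment> \<open>the strong limit of the operators given by the polynomials \<open>p j\<close>\<close>
  then obtain S0 where S0: "\<And>x. x \<in> vecs X \<Longrightarrow> S0 x \<in> vecs X"
    "\<And>x. x \<in> vecs X \<Longrightarrow> (\<lambda>j. vdist X (poly_op (p j) x) (S0 x)) \<longlonglongrightarrow> 0" by metis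
  have S0_inner: "(\<lambda>j. poly_form x z (p j)) \<longlonglongrightarrow> inprod X (S0 x) z" if x: "x \<in> vecs X" and z: "z \<in> vecs X" for x z
    using inner_tendsto[of "\<lambda>j. poly_op (p j) x" "S0 x" "\<lambda>_. z" z] S0[OF x] x z by (simp add: inner_poly_op)
  have poly_form_left_add: "poly_form (vadd X x y) z q = poly_form x z q + poly_form y z q"
    if "x \<in> vecs X" "y \<in> vecs X" "z \<in> vecs X" for x y z q
  proof -
    have "poly_form (vadd X x y) z q = cnj (inprod X (poly_op q z) (vadd X x y))"
      using that poly_form_sym[of "vadd X x y" z q] by (simp only: inner_poly_op add_closed) simp
    also have "\<dots> = poly_form x z q + poly_form y z q"
      using that poly_form_sym[of x z q] poly_form_sym[of y z q] by (simp add: inner_poly_op)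
    finally show ?thesis .
  qed
  have poly_form_left_scale: "poly_form (vscale X a x) z q = a * poly_form x z q" if "x \<in> vecs X" "z \<in> vecs X" for a x z q
  proof -
    have "poly_form (vscale X a x) z q = cnj (inprod X (poly_op q z) (vscale X a x))"
      using that poly_form_sym[of "vscale X a x" z q] by (simp only: inner_poly_op scale_closed) simp
    also have "\<dots> = a * poly_form x z q"
      using that poly_form_sym[of x z q] by (simp add: inner_poly_op)
    finally show ?thesis .
  qed
  define S where "S = restrict S0 (vecs X)"
  have S: "bounded_operator X S"
    unfolding bounded_operator_def
  proof (intro conjI ballI allI)
    show "S \<in> vecs X \<rightarrow>\<^sub>E vecs X" unfolding S_def using S0(1) by auto
    show "S (vadd X x y) = vadd X (S x) (S y)" if x: "x \<in> vecs X" and y: "y \<in> vecs X" for x y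
    proof -
      have "S0 (vadd X x y) = vadd X (S0 x) (S0 y)"
      proof (rule inner_ext)
        fix z assume z: "z \<in> vecs X"
        have "(\<lambda>j. poly_form (vadd X x y) z (p j)) \<longlonglongrightarrow> inprod X (S0 x) z + inprod X (S0 y) z"
          using tendsto_add[OF S0_inner[OF x z] S0_inner[OF y z]] x y z by (simp add: poly_form_left_add)
        moreover have "(\<lambda>j. poly_form (vadd X x y) z (p j)) \<longlonglongrightarrow> inprod X (S0 (vadd X x y)) z"
          using x y z by (intro S0_inner) auto
        ultimately show "inprod X (S0 (vadd X x y)) z = inprod X (vadd X (S0 x) (S0 y)) z"
          using LIMSEQ_unique S0(1) x y z by fastforce
      qed (use S0(1) x y in auto)
      then show ?thesis using x y by (simp add: S_def)
    qed
    show "S (vscale X a x) = vscale X a (S x)" if x: "x \<in> vecs X" for a x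
    proof -
      have "S0 (vscale X a x) = vscale X a (S0 x)"
      proof (rule inner_ext)
        fix z assume z: "z \<in> vecs X"
        have "(\<lambda>j. poly_form (vscale X a x) z (p j)) \<longlonglongrightarrow> a * inprod X (S0 x) z"
          using tendsto_mult_left[OF S0_inner[OF x z], of a] x z by (simp add: poly_form_left_scale)
        moreover have "(\<lambda>j. poly_form (vscale X a x) z (p j)) \<longlonglongrightarrow> inprod X (S0 (vscale X a x)) z"
          using x z by (intro S0_inner) auto
        ultimately show "inprod X (S0 (vscale X a x)) z = inprod X (vscale X a (S0 x)) z"
          using LIMSEQ_unique S0(1) x z by fastforce
      qed (use S0(1) x in auto)
      then show ?thesis using x by (simp add: S_def)
    qed
    have "vnorm X (S x) \<le> C * vnorm X x" if x: "x \<in> vecs X" for x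
    proof -
      have "(vnorm X (poly_op (p j) x))\<^sup>2 \<le> (C * vnorm X x)\<^sup>2" for j
      proof -
        interpret fm: finite_measure "?\<mu> x" by (rule spectral_measure(2)[OF x])
        have "(vnorm X (poly_op (p j) x))\<^sup>2 = Re (poly_form x x (p j * p j))"
          using x by (simp add: vnorm_square inner_poly_op_poly_op)
        also have "\<dots> = (LINT t|?\<mu> x. (poly (p j) t)\<^sup>2)"
          using spectral_measure(4)[OF x, of "p j * p j"] by (simp add: power2_eq_square)
        also have "\<dots> \<le> (LINT t|?\<mu> x. C\<^sup>2)"
        proof (rule integral_mono_AE)
          show "AE t in ?\<mu> x. (poly (p j) t)\<^sup>2 \<le> C\<^sup>2"
            using spectral_measure(3)[OF x]
          proof eventually_elim
            case (elim t)
            show ?case using p_bound[OF elim, of j] C0 by (intro abs_le_square_iff[THEN iffD1]) simp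
          qed
          show "integrable (?\<mu> x) (\<lambda>t. (poly (p j) t)\<^sup>2)" using int_p[OF x, of "(p j)\<^sup>2"] by (simp add: poly_sq)
        qed simp
        also have "\<dots> = C\<^sup>2 * (LINT t|?\<mu> x. poly 1 t)" by simp
        also have "(LINT t|?\<mu> x. poly 1 t) = (vnorm X x)\<^sup>2"
          using spectral_measure(4)[OF x, of 1] x by (simp add: poly_form_def vnorm_square complex_eq_iff)
        finally show ?thesis by (simp add: power_mult_distrib)
      qed
      then have le: "vnorm X (poly_op (p j) x) \<le> C * vnorm X x" for j
        by (rule power2_le_imp_le) (use C0 x in simp)
      have "(\<lambda>j. vnorm X (poly_op (p j) x)) \<longlonglongrightarrow> vnorm X (S0 x)"
        unfolding vnorm_def using S0[OF x] x by (intro tendsto_intros inner_tendsto) auto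
      then have "vnorm X (S0 x) \<le> C * vnorm X x" by (rule LIMSEQ_le_const2) (use le in blast)
      then show ?thesis using x by (simp add: S_def)
    qed
    then show "\<exists>C. \<forall>x\<in>vecs X. vnorm X (S x) \<le> C * vnorm X x" by blast
  qed
  have S_form: "inprod X (S x) x = complex_of_real (LINT t|?\<mu> x. g t)" if x: "x \<in> vecs X" for x
  proof -
    interpret fm: finite_measure "?\<mu> x" by (rule spectral_measure(2)[OF x])
    have "(\<lambda>j. LINT t|?\<mu> x. poly (p j) t) \<longlonglongrightarrow> (LINT t|?\<mu> x. g t)"
    proof (rule integral_dominated_convergence[where w = "\<lambda>_. C"])
      show "AE t in ?\<mu> x. (\<lambda>j. poly (p j) t) \<longlonglongrightarrow> g t"
        using spectral_measure(3)[OF x] by eventually_elim (rule p_lim)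
      show "AE t in ?\<mu> x. norm (poly (p j) t) \<le> C" for j
        using spectral_measure(3)[OF x] by eventually_elim (simp add: p_bound)
    qed (use meas[OF x] in simp_all)
    then have "(\<lambda>j. poly_form x x (p j)) \<longlonglongrightarrow> complex_of_real (LINT t|?\<mu> x. g t)"
      unfolding spectral_measure(4)[OF x] by (rule tendsto_of_real)
    then show ?thesis using LIMSEQ_unique[OF S0_inner[OF x x]] x by (simp add: S_def)
  qed
  have "borel_calculus X T (\<lambda>t. complex_of_real (g t)) = S"
    unfolding borel_calculus_def
  proof (rule the_equality)
    show "bounded_operator X S \<and> (\<forall>x\<in>vecs X. inprod X (S x) x = (LINT t|?\<mu> x. complex_of_real (g t)))"
      using S S_form by simp
    fix R assume R: "bounded_operator X R \<and> (\<forall>x\<in>vecs X. inprod X (R x) x = (LINT t|?\<mu> x. complex_of_real (g t)))"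
    have lin: "\<And>x. x \<in> vecs X \<Longrightarrow> Q x \<in> vecs X"
      "\<And>x y. x \<in> vecs X \<Longrightarrow> y \<in> vecs X \<Longrightarrow> Q (vadd X x y) = vadd X (Q x) (Q y)"
      "\<And>a x. x \<in> vecs X \<Longrightarrow> Q (vscale X a x) = vscale X a (Q x)" if "bounded_operator X Q" for Q
      using that unfolding bounded_operator_def by auto
    show "R = S"
    proof (rule extensionalityI[of _ "vecs X"])
      show "R \<in> extensional (vecs X)" "S \<in> extensional (vecs X)"
        using R S unfolding bounded_operator_def by (auto simp: PiE_def)
      fix x assume x: "x \<in> vecs X"
      show "R x = S x"
      proof (rule inner_ext)
        fix z assume z: "z \<in> vecs X"
        have "inprod X (R y) y = inprod X (S y) y" if "y \<in> vecs X" for y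
          using R S_form that by simp
        then have "inprod X (R (vadd X x (vscale X a z))) (vadd X x (vscale X a z))
            = inprod X (S (vadd X x (vscale X a z))) (vadd X x (vscale X a z))" for a
          using x z by simp
        then have "4 * inprod X (R x) z = 4 * inprod X (S x) z"
          by (simp only: inner_polarization[OF lin[OF conjunct1[OF R]] x z] inner_polarization[OF lin[OF S] x z])
        then show "inprod X (R x) z = inprod X (S x) z" by simp
      qed (use lin(1)[OF conjunct1[OF R]] lin(1)[OF S] x in auto)
    qed
  qed
  then show ?thesis using S_form[OF x0] by simp
qed

end

section \<open>Balls and patterns in graphs of bounded degree\<close>

lemma ball_iso_inverse:
  assumes "ball_iso G R x x' \<phi>" and x: "x \<in> graph_ball G R x"
  shows "ball_iso G R x' x (inv_into (graph_ball G R x) \<phi>)"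
proof -
  let ?\<psi> = "inv_into (graph_ball G R x) \<phi>"
  have bij: "bij_betw \<phi> (graph_ball G R x) (graph_ball G R x')" and xx: "\<phi> x = x'"
    and edge: "\<And>u v. u \<in> graph_ball G R x \<Longrightarrow> v \<in> graph_ball G R x \<Longrightarrow> (u, v) \<in> edges G \<longleftrightarrow> (\<phi> u, \<phi> v) \<in> edges G"
    using assms(1) unfolding ball_iso_def by blast+
  have "?\<psi> x' = x" using bij x xx by (metis bij_betw_inv_into_left)
  moreover have "(u, v) \<in> edges G \<longleftrightarrow> (?\<psi> u, ?\<psi> v) \<in> edges G"
    if "u \<in> graph_ball G R x'" "v \<in> graph_ball G R x'" for u v
  proof -
    have "?\<psi> u \<in> graph_ball G R x" "?\<psi> v \<in> graph_ball G R x"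
      using bij_betwE[OF bij_betw_inv_into[OF bij]] that by auto
    then show ?thesis
      using edge[of "?\<psi> u" "?\<psi> v"] bij_betw_inv_into_right[OF bij that(1)] bij_betw_inv_into_right[OF bij that(2)]
      by simp
  qed
  ultimately show ?thesis unfolding ball_iso_def using bij_betw_inv_into[OF bij] by blast
qed

locale bounded_graph =
  fixes G :: "'v graph"
  assumes simple: "simple_graph G" and connected: "connected_graph G" and bounded: "bounded_degree G"
begin

abbreviation "V \<equiv> verts G"
abbreviation "E \<equiv> edges G"
abbreviation "d \<equiv> graph_dist G"
abbreviation "gball \<equiv> graph_ball G"

lemma edge_verts: "(x, y) \<in> E \<Longrightarrow> x \<in> V \<and> y \<in> V"
  using simple unfolding simple_graph_def by blast

lemma edge_sym: "(x, y) \<in> E \<Longrightarrow> (y, x) \<in> E"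
  using simple unfolding simple_graph_def by (blast dest: symD)

lemma path_verts: "(x, y) \<in> E ^^ n \<Longrightarrow> x \<in> V \<Longrightarrow> y \<in> V"
  by (induction n arbitrary: y) (auto dest: edge_verts)

lemma path_sym: "(x, y) \<in> E ^^ n \<Longrightarrow> (y, x) \<in> E ^^ n"
proof (induction n arbitrary: y)
  case (Suc n)
  then obtain z where "(x, z) \<in> E ^^ n" "(z, y) \<in> E" by auto
  then show ?case using Suc.IH by (metis edge_sym relpow_Suc_I2)
qed simp

lemma dist_path:
  assumes "x \<in> V" "y \<in> V"
  shows "(x, y) \<in> E ^^ d x y"
proof -
  have "(x, y) \<in> E\<^sup>*" using connected assms unfolding connected_graph_def by blast
  then obtain n where "(x, y) \<in> E ^^ n" by (auto dest: rtrancl_imp_relpow)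
  then show ?thesis unfolding graph_dist_def by (rule LeastI)
qed

lemma dist_le: "(x, y) \<in> E ^^ n \<Longrightarrow> d x y \<le> n"
  unfolding graph_dist_def by (rule Least_le)

lemma dist_self [simp]: "d x x = 0"
  using dist_le[of x x 0] by simp

lemma dist_0: "x \<in> V \<Longrightarrow> y \<in> V \<Longrightarrow> d x y = 0 \<Longrightarrow> x = y"
  using dist_path[of x y] by simp

lemma dist_sym: "x \<in> V \<Longrightarrow> y \<in> V \<Longrightarrow> d x y = d y x"
  using dist_path dist_le path_sym by (metis antisym)

lemma dist_triangle: "x \<in> V \<Longrightarrow> y \<in> V \<Longrightarrow> z \<in> V \<Longrightarrow> d x z \<le> d x y + d y z"
  by (rule dist_le) (unfold relpow_add, rule relcompI[OF dist_path dist_path])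

lemma ball_verts: "y \<in> gball r x \<Longrightarrow> y \<in> V"
  unfolding graph_ball_def by blast

lemma ball_self [simp]: "x \<in> V \<Longrightarrow> x \<in> gball r x"
  unfolding graph_ball_def by simp

lemma ball_sym: "x \<in> V \<Longrightarrow> y \<in> V \<Longrightarrow> y \<in> gball r x \<longleftrightarrow> x \<in> gball r y"
  unfolding graph_ball_def by (simp add: dist_sym)

lemma ball_mono: "r \<le> s \<Longrightarrow> gball r x \<subseteq> gball s x"
  unfolding graph_ball_def by auto

lemma ball_trans: "x \<in> V \<Longrightarrow> y \<in> gball r x \<Longrightarrow> z \<in> gball s y \<Longrightarrow> z \<in> gball (r + s) x"
  using dist_triangle[of x y z] unfolding graph_ball_def by auto

lemma ball_0: "x \<in> V \<Longrightarrow> gball 0 x = {x}"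
  using dist_0[of x] unfolding graph_ball_def by auto

lemma ball_bounded: "\<exists>N. \<forall>x\<in>V. finite (gball r x) \<and> card (gball r x) \<le> N"
proof (induction r)
  case 0 then show ?case by (intro exI[of _ 1]) (simp add: ball_0)
next
  case (Suc r)
  then obtain N where N: "\<And>x. x \<in> V \<Longrightarrow> finite (gball r x) \<and> card (gball r x) \<le> N" by blast
  obtain D where D: "\<And>x. x \<in> V \<Longrightarrow> finite (E `` {x}) \<and> card (E `` {x}) \<le> D"
    using bounded unfolding bounded_degree_def by blast
  have "finite (gball (Suc r) x) \<and> card (gball (Suc r) x) \<le> N + N * D" if x: "x \<in> V" for x
  proof -
    have sub: "gball (Suc r) x \<subseteq> gball r x \<union> (\<Union>y\<in>gball r x. E `` {y})"
    proof
      fix y assume y: "y \<in> gball (Suc r) x"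
      then have yV: "y \<in> V" and le: "d x y \<le> Suc r" by (auto simp: graph_ball_def)
      show "y \<in> gball r x \<union> (\<Union>y\<in>gball r x. E `` {y})"
      proof (cases "d x y \<le> r")
        case True then show ?thesis using yV by (simp add: graph_ball_def)
      next
        case False
        then have "(x, y) \<in> E ^^ Suc r" using dist_path[OF x yV] le by (metis le_antisym not_less_eq_eq)
        then obtain z where z: "(x, z) \<in> E ^^ r" "(z, y) \<in> E" by auto
        then have "z \<in> gball r x" using dist_le path_verts x by (auto simp: graph_ball_def)
        then show ?thesis using z by blast
      qed
    qed
    have fin: "finite (gball r x \<union> (\<Union>y\<in>gball r x. E `` {y}))"
      using N[OF x] D ball_verts by auto
    have "card (gball (Suc r) x) \<le> card (gball r x \<union> (\<Union>y\<in>gball r x. E `` {y}))"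
      by (rule card_mono[OF fin sub])
    also have "\<dots> \<le> card (gball r x) + card (\<Union>y\<in>gball r x. E `` {y})" by (rule card_Un_le)
    also have "card (\<Union>y\<in>gball r x. E `` {y}) \<le> (\<Sum>y\<in>gball r x. card (E `` {y}))"
      using N[OF x] by (intro card_UN_le) simp
    also have "\<dots> \<le> (\<Sum>y\<in>gball r x. D)" using D ball_verts by (intro sum_mono) blast
    also have "\<dots> \<le> N * D" using N[OF x] by simp
    finally show ?thesis using finite_subset[OF sub fin] N[OF x] by linarith
  qed
  then show ?case by blast
qed

lemma finite_ball [simp]: "x \<in> V \<Longrightarrow> finite (gball r x)"
  using ball_bounded by blast

lemma ball_isoD:
  assumes "ball_iso G R x x' \<phi>"
  shows "bij_betw \<phi> (gball R x) (gball R x')" "\<phi> x = x'"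
    "\<And>u v. u \<in> gball R x \<Longrightarrow> v \<in> gball R x \<Longrightarrow> (u, v) \<in> E \<longleftrightarrow> (\<phi> u, \<phi> v) \<in> E"
  using assms unfolding ball_iso_def by blast+

text \<open>Only the part of the path inside the ball of radius \<open>R\<close> is seen by \<open>\<phi>\<close>; this is why the distance of
\<open>z\<close> from the root and the length of the path have to be added.\<close>

lemma ball_iso_path:
  assumes iso: "ball_iso G R x x' \<phi>" and x: "x \<in> V" and z: "z \<in> gball s x"
    and path: "(z, u) \<in> E ^^ n" and le: "s + n \<le> R"
  shows "u \<in> gball (s + n) x \<and> (\<phi> z, \<phi> u) \<in> E ^^ n"
  using path le
proof (induction n arbitrary: u)
  case 0 then show ?case using z by simp
next
  case (Suc n)
  then obtain v where v: "(z, v) \<in> E ^^ n" "(v, u) \<in> E" by auto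
  have IH: "v \<in> gball (s + n) x" "(\<phi> z, \<phi> v) \<in> E ^^ n" using Suc.IH[OF v(1)] Suc.prems by auto
  have "u \<in> gball 1 v" using v(2) dist_le[of v u 1] edge_verts by (auto simp: graph_ball_def)
  then have u: "u \<in> gball (s + Suc n) x" using ball_trans[OF x IH(1), of u 1] by simp
  then have "u \<in> gball R x" "v \<in> gball R x" using IH(1) Suc.prems ball_mono[of "s + Suc n" R x] ball_mono[of "s + n" R x] by auto
  then have "(\<phi> v, \<phi> u) \<in> E" using ball_isoD(3)[OF iso] v(2) by blast
  then show ?case using u IH(2) by auto
qed

lemma ball_iso_dist_le:
  assumes iso: "ball_iso G R x x' \<phi>" and x: "x \<in> V" and z: "z \<in> gball s x" and u: "u \<in> gball r z" and le: "s + r \<le> R"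
  shows "d (\<phi> z) (\<phi> u) \<le> r"
proof -
  have zV: "z \<in> V" "u \<in> V" using z u ball_verts by auto
  have "d z u \<le> r" using u by (simp add: graph_ball_def)
  then show ?thesis
    using ball_iso_path[OF iso x z dist_path[OF zV]] le dist_le[of "\<phi> z" "\<phi> u" "d z u"] by auto
qed

lemma ball_iso_verts: "ball_iso G R x x' \<phi> \<Longrightarrow> u \<in> gball R x \<Longrightarrow> \<phi> u \<in> V"
  using ball_isoD(1) ball_verts by (metis bij_betwE)

lemma ball_iso_target: "ball_iso G R x x' \<phi> \<Longrightarrow> x \<in> V \<Longrightarrow> x' \<in> V"
  using ball_iso_verts[of R x x' \<phi> x] ball_isoD(2)[of R x x' \<phi>] by simp

text \<open>A rooted isomorphism and its inverse both map short paths to paths, hence do not increase small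
distances. So smaller balls around points near the root are mapped onto balls.\<close>

lemma ball_iso_restrict:
  assumes iso: "ball_iso G R x x' \<phi>" and x: "x \<in> V" and z: "z \<in> gball s x" and le: "s + r \<le> R"
  shows "ball_iso G r z (\<phi> z) \<phi>"
proof -
  let ?\<psi> = "inv_into (gball R x) \<phi>"
  have inv: "ball_iso G R x' x ?\<psi>" by (rule ball_iso_inverse[OF iso]) (simp add: x)
  have x': "x' \<in> V" by (rule ball_iso_target[OF iso x])
  have sR: "gball s x \<subseteq> gball R x" using le by (intro ball_mono) simp
  have zR: "z \<in> gball R x" using z sR by blast
  have sub: "gball r z \<subseteq> gball R x" using ball_trans[OF x z] ball_mono[OF le] by blast
  have phi_z: "\<phi> z \<in> gball s x'"
    using ball_iso_dist_le[OF iso x ball_self[OF x, of 0], of z s] z le ball_iso_verts[OF iso zR] ball_isoD(2)[OF iso]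
    by (simp add: graph_ball_def)
  have sub': "gball r (\<phi> z) \<subseteq> gball R x'" using ball_trans[OF x' phi_z] ball_mono[OF le] by blast
  have inj: "inj_on \<phi> (gball R x)" using ball_isoD(1)[OF iso] by (rule bij_betw_imp_inj_on)
  have psi_z: "?\<psi> (\<phi> z) = z" using inj zR by simp
  have "\<phi> ` gball r z = gball r (\<phi> z)"
  proof
    show "\<phi> ` gball r z \<subseteq> gball r (\<phi> z)"
    proof
      fix w assume "w \<in> \<phi> ` gball r z"
      then obtain u where u: "u \<in> gball r z" "w = \<phi> u" by blast
      then show "w \<in> gball r (\<phi> z)"
        using ball_iso_dist_le[OF iso x z u(1) le] ball_iso_verts[OF iso] sub by (auto simp: graph_ball_def)
    qed
    show "gball r (\<phi> z) \<subseteq> \<phi> ` gball r z"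
    proof
      fix w assume w: "w \<in> gball r (\<phi> z)"
      then have wR: "w \<in> gball R x'" using sub' by blast
      have "d z (?\<psi> w) \<le> r" using ball_iso_dist_le[OF inv x' phi_z w le] psi_z by simp
      moreover have "?\<psi> w \<in> V" by (rule ball_iso_verts[OF inv wR])
      moreover have "\<phi> (?\<psi> w) = w" by (rule bij_betw_inv_into_right[OF ball_isoD(1)[OF iso] wR])
      ultimately show "w \<in> \<phi> ` gball r z" by (intro image_eqI[of _ _ "?\<psi> w"]) (auto simp: graph_ball_def)
    qed
  qed
  then have "bij_betw \<phi> (gball r z) (gball r (\<phi> z))"
    using inj_on_subset[OF inj sub] by (simp add: bij_betw_def)
  then show ?thesis unfolding ball_iso_def using ball_isoD(3)[OF iso] sub by blast
qed

lemma same_pattern_equiv: "equiv V (same_pattern G r)"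
proof (rule equivI)
  show "same_pattern G r \<subseteq> V \<times> V" unfolding same_pattern_def by auto
  show "refl_on V (same_pattern G r)"
  proof (rule refl_onI)
    fix x assume "x \<in> V"
    moreover have "ball_iso G r x x id" by (simp add: ball_iso_def)
    ultimately show "(x, x) \<in> same_pattern G r" unfolding same_pattern_def by blast
  qed
  show "sym (same_pattern G r)"
  proof (rule symI)
    fix x y assume "(x, y) \<in> same_pattern G r"
    then show "(y, x) \<in> same_pattern G r"
      unfolding same_pattern_def using ball_iso_inverse[of G r x y] ball_self[of x r] by blast
  qed
  show "trans (same_pattern G r)"
  proof (rule transI)
    fix x y z assume "(x, y) \<in> same_pattern G r" "(y, z) \<in> same_pattern G r"
    then obtain \<phi> \<psi> where iso: "x \<in> V" "z \<in> V" "ball_iso G r x y \<phi>" "ball_iso G r y z \<psi>"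
      unfolding same_pattern_def by blast
    have "ball_iso G r x z (\<psi> \<circ> \<phi>)"
      unfolding ball_iso_def
    proof (intro conjI ballI)
      show "bij_betw (\<psi> \<circ> \<phi>) (gball r x) (gball r z)"
        using ball_isoD(1)[OF iso(3)] ball_isoD(1)[OF iso(4)] by (rule bij_betw_trans)
      show "(\<psi> \<circ> \<phi>) x = z" using ball_isoD(2)[OF iso(3)] ball_isoD(2)[OF iso(4)] by simp
      fix u v assume uv: "u \<in> gball r x" "v \<in> gball r x"
      then have "\<phi> u \<in> gball r y" "\<phi> v \<in> gball r y" using ball_isoD(1)[OF iso(3)] by (auto simp: bij_betw_def)
      then show "(u, v) \<in> E \<longleftrightarrow> ((\<psi> \<circ> \<phi>) u, (\<psi> \<circ> \<phi>) v) \<in> E"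
        using ball_isoD(3)[OF iso(3) uv] ball_isoD(3)[OF iso(4)] by simp
    qed
    then show "(x, z) \<in> same_pattern G r" using iso unfolding same_pattern_def by blast
  qed
qed

text \<open>A numbering of its vertices turns a ball into a graph with a marked vertex on an initial segment of
the natural numbers of bounded length. There are finitely many of these, and equal ones come from
isomorphic balls.\<close>

lemma finite_patterns: "finite (patterns G r)"
proof -
  obtain N where N: "\<And>x. x \<in> V \<Longrightarrow> finite (gball r x) \<and> card (gball r x) \<le> N" using ball_bounded by blast
  have "\<exists>h i. bij_betw h {0..<card (gball r x)} (gball r x) \<and> i < card (gball r x) \<and> h i = x" if x: "x \<in> V" for x
  proof -
    have fin: "finite (gball r x)" and mem: "x \<in> gball r x" using x by auto
    obtain h where h: "bij_betw h {0..<card (gball r x)} (gball r x)"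
      using ex_bij_betw_nat_finite[OF fin] by blast
    then have "x \<in> h ` {0..<card (gball r x)}" using mem by (simp add: bij_betw_def)
    then obtain i where "i \<in> {0..<card (gball r x)}" "x = h i" by (rule imageE)
    then have "i < card (gball r x) \<and> h i = x" by simp
    then show ?thesis using h by blast
  qed
  then obtain h i0 where h: "\<And>x. x \<in> V \<Longrightarrow> bij_betw (h x) {0..<card (gball r x)} (gball r x)"
    "\<And>x. x \<in> V \<Longrightarrow> i0 x < card (gball r x)" "\<And>x. x \<in> V \<Longrightarrow> h x (i0 x) = x"
    by metis
  \<comment> \<open>size, root and edges of the ball after the numbering \<open>h x\<close>\<close>
  define c where "c = (\<lambda>x. (card (gball r x), i0 x, {(i, j). i < card (gball r x) \<and> j < card (gball r x) \<and> (h x i, h x j) \<in> E}))"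
  have same: "(x, y) \<in> same_pattern G r" if xy: "x \<in> V" "y \<in> V" "c x = c y" for x y
  proof -
    define n where "n = card (gball r x)"
    have n: "card (gball r x) = n" "card (gball r y) = n" using xy(3) by (auto simp: c_def n_def)
    have e: "(h x i, h x j) \<in> E \<longleftrightarrow> (h y i, h y j) \<in> E" if "i < n" "j < n" for i j
      using xy(3) that unfolding c_def n by (auto simp: set_eq_iff)
    define g where "g = inv_into {0..<n} (h x)"
    have hx: "bij_betw (h x) {0..<n} (gball r x)" and hy: "bij_betw (h y) {0..<n} (gball r y)"
      using h(1)[OF xy(1)] h(1)[OF xy(2)] n by auto
    have g: "bij_betw g (gball r x) {0..<n}" unfolding g_def by (rule bij_betw_inv_into[OF hx])
    have hg: "h x (g u) = u" if "u \<in> gball r x" for u unfolding g_def by (rule bij_betw_inv_into_right[OF hx that])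
    have gn: "g u < n" if "u \<in> gball r x" for u using bij_betwE[OF g] that by auto
    have "i0 x = i0 y" using xy(3) by (simp add: c_def)
    moreover have "g x = i0 x" unfolding g_def using bij_betw_inv_into_left[OF hx, of "i0 x"] h(2,3)[OF xy(1)] n by simp
    ultimately have root: "(h y \<circ> g) x = y" using h(3)[OF xy(2)] by simp
    have "(u, v) \<in> E \<longleftrightarrow> ((h y \<circ> g) u, (h y \<circ> g) v) \<in> E" if "u \<in> gball r x" "v \<in> gball r x" for u v
      using e[OF gn[OF that(1)] gn[OF that(2)]] hg[OF that(1)] hg[OF that(2)] by simp
    then have "ball_iso G r x y (h y \<circ> g)"
      unfolding ball_iso_def using bij_betw_trans[OF g hy] root by blast
    then show ?thesis using xy unfolding same_pattern_def by blast
  qed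
  have "finite (c ` V)"
  proof (rule finite_subset)
    show "c ` V \<subseteq> {..N} \<times> {..N} \<times> Pow ({..N} \<times> {..N})"
      using N h(2) by (force simp: c_def)
  qed simp
  moreover have "patterns G r = (\<lambda>k. same_pattern G r `` {SOME x. x \<in> V \<and> c x = k}) ` (c ` V)"
  proof -
    have "same_pattern G r `` {SOME y. y \<in> V \<and> c y = c x} = same_pattern G r `` {x}" if x: "x \<in> V" for x
    proof -
      have "(SOME y. y \<in> V \<and> c y = c x) \<in> V \<and> c (SOME y. y \<in> V \<and> c y = c x) = c x"
        by (rule someI[of _ x]) (simp add: x)
      then have "((SOME y. y \<in> V \<and> c y = c x), x) \<in> same_pattern G r" using same x by blast
      then show ?thesis by (rule equiv_class_eq[OF same_pattern_equiv])
    qed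
    then show ?thesis unfolding patterns_def quotient_def by (auto simp: image_image)
  qed
  ultimately show ?thesis by simp
qed

text \<open>Functions of the \<open>R\<close>-pattern of a vertex. In an AQ-graph they are the functions that have an average.\<close>

definition pattern_fun :: "nat \<Rightarrow> ('v \<Rightarrow> 'a) \<Rightarrow> bool" where
  "pattern_fun R f \<longleftrightarrow> (\<forall>x\<in>V. \<forall>x'\<in>V. \<forall>\<phi>. ball_iso G R x x' \<phi> \<longrightarrow> f x = f x')"

lemma pattern_fun_const:
  assumes "pattern_fun R f" "\<alpha> \<in> patterns G R" "x \<in> \<alpha>" "y \<in> \<alpha>"
  shows "f x = f y"
proof -
  have "(x, y) \<in> same_pattern G R"
    using assms(2-4) unfolding patterns_def by (meson quotient_eq_iff same_pattern_equiv)
  then show ?thesis using assms(1) unfolding same_pattern_def pattern_fun_def by blast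
qed

lemma pattern_fun_finite_range:
  assumes "pattern_fun R f"
  shows "finite (f ` V)"
proof (rule finite_subset)
  show "f ` V \<subseteq> (\<lambda>\<alpha>. f (SOME x. x \<in> \<alpha>)) ` patterns G R"
  proof
    fix t assume "t \<in> f ` V"
    then obtain x where x: "x \<in> V" "t = f x" by blast
    let ?\<alpha> = "same_pattern G R `` {x}"
    have \<alpha>: "?\<alpha> \<in> patterns G R" "x \<in> ?\<alpha>"
      using x(1) equiv_class_self[OF same_pattern_equiv x(1)] by (auto simp: patterns_def quotientI)
    then have "(SOME x. x \<in> ?\<alpha>) \<in> ?\<alpha>" by (metis someI)
    then have "f x = f (SOME x. x \<in> ?\<alpha>)" by (rule pattern_fun_const[OF assms \<alpha>])
    then show "t \<in> (\<lambda>\<alpha>. f (SOME x. x \<in> \<alpha>)) ` patterns G R" using x \<alpha> by blast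
  qed
qed (simp add: finite_patterns)

text \<open>A path that leaves \<open>Q\<close> passes through the boundary, so that the points from which one can leave \<open>Q\<close>
in \<open>R\<close> steps lie in the balls of radius \<open>R\<close> around the boundary.\<close>

lemma card_bad_points:
  assumes Q: "finite Q" "Q \<subseteq> V"
    and N: "\<And>x. x \<in> V \<Longrightarrow> card (gball R x) \<le> N"
  shows "card {x \<in> Q. \<not> gball R x \<subseteq> Q} \<le> N * card (boundary G Q)"
proof -
  have bfin: "finite (boundary G Q)" and bV: "boundary G Q \<subseteq> V" using Q by (auto simp: boundary_def)
  have exit: "\<exists>p\<in>boundary G Q. p \<in> gball n x" if "(x, y) \<in> E ^^ n" "x \<in> Q" "y \<notin> Q" for x y n
    using that
  proof (induction n arbitrary: y)
    case (Suc n)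
    then obtain z where z: "(x, z) \<in> E ^^ n" "(z, y) \<in> E" by auto
    show ?case
    proof (cases "z \<in> Q")
      case True
      then have "z \<in> boundary G Q" using z Suc.prems edge_verts by (auto simp: boundary_def)
      moreover have "z \<in> gball n x" using dist_le[OF z(1)] edge_verts z(2) by (auto simp: graph_ball_def)
      ultimately show ?thesis using ball_mono[of n "Suc n" x] by auto
    next
      case False
      then show ?thesis using Suc.IH[OF z(1)] Suc.prems ball_mono[of n "Suc n" x] by auto
    qed
  qed simp
  have "{x \<in> Q. \<not> gball R x \<subseteq> Q} \<subseteq> (\<Union>p\<in>boundary G Q. gball R p)"
  proof
    fix x assume "x \<in> {x \<in> Q. \<not> gball R x \<subseteq> Q}"
    then obtain y where xy: "x \<in> Q" "y \<in> gball R x" "y \<notin> Q" by blast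
    then have xV: "x \<in> V" "y \<in> V" using Q ball_verts by auto
    obtain p where p: "p \<in> boundary G Q" "p \<in> gball (d x y) x" using exit[OF dist_path[OF xV] xy(1,3)] by blast
    have "p \<in> gball R x" using p(2) xy(2) ball_mono[of "d x y" R x] by (auto simp: graph_ball_def)
    then have "x \<in> gball R p" using ball_sym[OF xV(1)] ball_verts by blast
    then show "x \<in> (\<Union>p\<in>boundary G Q. gball R p)" using p(1) by blast
  qed
  then have "card {x \<in> Q. \<not> gball R x \<subseteq> Q} \<le> card (\<Union>p\<in>boundary G Q. gball R p)"
    using bfin bV by (intro card_mono) auto
  also have "\<dots> \<le> (\<Sum>p\<in>boundary G Q. card (gball R p))" by (rule card_UN_le[OF bfin])
  also have "\<dots> \<le> (\<Sum>p\<in>boundary G Q. N)" using N bV by (intro sum_mono) auto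
  finally show ?thesis by (simp add: mult.commute)
qed

end

section \<open>Folner means and the trace inner product\<close>

lemma infsum_finite_support:
  fixes f :: "'a \<Rightarrow> complex"
  assumes "finite F" "F \<subseteq> A" "\<And>z. z \<in> A - F \<Longrightarrow> f z = 0"
  shows "infsum f A = sum f F"
proof -
  have "infsum f A = infsum f F" by (rule infsum_cong_neutral) (use assms in auto)
  then show ?thesis using assms(1) by simp
qed

text \<open>Cauchy-Schwarz, with the factor \<open>cmod (b z w)\<close> divided evenly between its two sides.\<close>

lemma schur_test:
  fixes b :: "'a \<Rightarrow> 'a \<Rightarrow> complex" and a :: "'a \<Rightarrow> complex"
  assumes F: "finite F" and K: "0 \<le> K"
    and row: "\<And>z. z \<in> F \<Longrightarrow> (\<Sum>w\<in>F. cmod (b z w)) \<le> K"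
    and col: "\<And>w. w \<in> F \<Longrightarrow> (\<Sum>z\<in>F. cmod (b z w)) \<le> K"
  shows "(\<Sum>z\<in>F. (cmod (\<Sum>w\<in>F. b z w * a w))\<^sup>2) \<le> K\<^sup>2 * (\<Sum>w\<in>F. (cmod (a w))\<^sup>2)"
proof -
  have "(cmod (\<Sum>w\<in>F. b z w * a w))\<^sup>2 \<le> K * (\<Sum>w\<in>F. cmod (b z w) * (cmod (a w))\<^sup>2)" if z: "z \<in> F" for z
  proof -
    have "cmod (\<Sum>w\<in>F. b z w * a w) \<le> (\<Sum>w\<in>F. sqrt (cmod (b z w)) * (sqrt (cmod (b z w)) * cmod (a w)))"
      by (rule sum_norm_le) (simp add: norm_mult mult.assoc[symmetric])
    then have "(cmod (\<Sum>w\<in>F. b z w * a w))\<^sup>2 \<le> (\<Sum>w\<in>F. sqrt (cmod (b z w)) * (sqrt (cmod (b z w)) * cmod (a w)))\<^sup>2"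
      by (rule power_mono) simp
    also have "\<dots> \<le> (\<Sum>w\<in>F. (sqrt (cmod (b z w)))\<^sup>2) * (\<Sum>w\<in>F. (sqrt (cmod (b z w)) * cmod (a w))\<^sup>2)"
      by (rule Cauchy_Schwarz_ineq_sum)
    also have "\<dots> = (\<Sum>w\<in>F. cmod (b z w)) * (\<Sum>w\<in>F. cmod (b z w) * (cmod (a w))\<^sup>2)"
      by (simp add: power_mult_distrib)
    also have "\<dots> \<le> K * (\<Sum>w\<in>F. cmod (b z w) * (cmod (a w))\<^sup>2)"
      by (intro mult_right_mono row z sum_nonneg) simp
    finally show ?thesis .
  qed
  then have "(\<Sum>z\<in>F. (cmod (\<Sum>w\<in>F. b z w * a w))\<^sup>2) \<le> (\<Sum>z\<in>F. K * (\<Sum>w\<in>F. cmod (b z w) * (cmod (a w))\<^sup>2))"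
    by (rule sum_mono)
  also have "\<dots> = K * (\<Sum>w\<in>F. \<Sum>z\<in>F. cmod (b z w) * (cmod (a w))\<^sup>2)"
    unfolding sum_distrib_left[symmetric] by (subst sum.swap) simp
  also have "(\<Sum>w\<in>F. \<Sum>z\<in>F. cmod (b z w) * (cmod (a w))\<^sup>2) = (\<Sum>w\<in>F. (\<Sum>z\<in>F. cmod (b z w)) * (cmod (a w))\<^sup>2)"
    by (simp add: sum_distrib_right)
  also have "K * \<dots> \<le> K * (\<Sum>w\<in>F. K * (cmod (a w))\<^sup>2)"
    by (intro mult_left_mono K sum_mono mult_right_mono col) auto
  also have "\<dots> = K\<^sup>2 * (\<Sum>w\<in>F. (cmod (a w))\<^sup>2)"
    by (simp add: sum_distrib_left power2_eq_square mult.assoc)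
  finally show ?thesis .
qed

context bounded_graph
begin

text \<open>Pattern invariance with explicit propagation. The number \<open>r\<close> serves both as propagation and as radius
of the patterns, and can be enlarged.\<close>

definition pat_inv :: "nat \<Rightarrow> 'v matrix \<Rightarrow> bool" where
  "pat_inv r A \<longleftrightarrow> (\<forall>x y. x \<notin> V \<or> y \<notin> V \<longrightarrow> A x y = 0) \<and>
     (\<forall>x\<in>V. \<forall>y\<in>V. d x y > r \<longrightarrow> A x y = 0) \<and>
     (\<forall>x\<in>V. \<forall>x'\<in>V. \<forall>\<phi>. ball_iso G r x x' \<phi> \<longrightarrow> (\<forall>y\<in>gball r x. A x y = A (\<phi> x) (\<phi> y)))"

lemma pattern_invariant_iff: "A \<in> pattern_invariant G \<longleftrightarrow> (\<exists>r. pat_inv r A)"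
  unfolding pattern_invariant_def pat_inv_def by blast

lemma pat_inv_support:
  assumes "pat_inv r A" "A x y \<noteq> 0"
  shows "x \<in> V" "y \<in> V" "y \<in> gball r x" "x \<in> gball r y"
proof -
  show x: "x \<in> V" and y: "y \<in> V" using assms unfolding pat_inv_def by blast+
  then have "\<not> r < d x y" using assms unfolding pat_inv_def by blast
  then show "y \<in> gball r x" using y by (simp add: graph_ball_def)
  then show "x \<in> gball r y" using ball_sym[OF x y] by simp
qed

text \<open>An isomorphism rooted at \<open>x\<close> preserves also the entries in the rows of other vertices \<open>u\<close>, provided
that the ball around \<open>u\<close> which determines its row lies within the ball of radius \<open>R\<close>.\<close>

lemma pat_inv_entry:
  assumes A: "pat_inv r A" and iso: "ball_iso G R x x' \<phi>" and x: "x \<in> V"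
    and u: "u \<in> gball s x" and le: "s + r \<le> R" and v: "v \<in> gball R x"
  shows "A (\<phi> u) (\<phi> v) = A u v"
proof -
  have iso_u: "ball_iso G r u (\<phi> u) \<phi>" by (rule ball_iso_restrict[OF iso x u le])
  have uR: "u \<in> gball R x" using u le ball_mono[of s R x] by auto
  have uV: "u \<in> V" "\<phi> u \<in> V" using ball_verts[OF u] ball_iso_verts[OF iso uR] by auto
  show ?thesis
  proof (cases "v \<in> gball r u")
    case True
    then show ?thesis using A iso_u uV unfolding pat_inv_def by metis
  next
    case False
    have "\<phi> v \<notin> gball r (\<phi> u)"
    proof
      assume "\<phi> v \<in> gball r (\<phi> u)"
      then obtain w where w: "w \<in> gball r u" "\<phi> w = \<phi> v"
        using ball_isoD(1)[OF iso_u] by (metis bij_betw_imp_surj_on imageE)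
      have "w \<in> gball R x" using ball_trans[OF x u w(1)] ball_mono[OF le] by blast
      then have "w = v" using w(2) v ball_isoD(1)[OF iso] by (metis bij_betw_imp_inj_on inj_onD)
      then show False using w(1) False by simp
    qed
    then show ?thesis using False pat_inv_support(3)[OF A] by metis
  qed
qed

lemma pat_invI:
  assumes "\<And>x y. A x y \<noteq> 0 \<Longrightarrow> x \<in> V \<and> y \<in> gball r x"
    and "\<And>x x' \<phi> y. x \<in> V \<Longrightarrow> x' \<in> V \<Longrightarrow> ball_iso G r x x' \<phi> \<Longrightarrow> y \<in> gball r x \<Longrightarrow> A (\<phi> x) (\<phi> y) = A x y"
  shows "pat_inv r A"
  unfolding pat_inv_def
proof (intro conjI allI ballI impI)
  show "A x y = 0" if "x \<notin> V \<or> y \<notin> V" for x y using assms(1)[of x y] ball_verts that by blast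
  show "A x y = 0" if "r < d x y" for x y using assms(1)[of x y] that by (auto simp: graph_ball_def)
  show "A x y = A (\<phi> x) (\<phi> y)" if "x \<in> V" "x' \<in> V" "ball_iso G r x x' \<phi>" "y \<in> gball r x" for x x' \<phi> y
    using assms(2)[OF that] by simp
qed

lemma pat_inv_mono:
  assumes A: "pat_inv r A" and le: "r \<le> s"
  shows "pat_inv s A"
proof (rule pat_invI)
  show "x \<in> V \<and> y \<in> gball s x" if "A x y \<noteq> 0" for x y
    using pat_inv_support[OF A that] ball_mono[OF le] by blast
  show "A (\<phi> x) (\<phi> y) = A x y" if "x \<in> V" "x' \<in> V" "ball_iso G s x x' \<phi>" "y \<in> gball s x" for x x' \<phi> y
    by (rule pat_inv_entry[OF A that(3,1) ball_self[OF that(1), of 0] _ that(4)]) (simp add: le)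
qed

lemma pat_inv_add:
  assumes "pat_inv r A" "pat_inv s B"
  shows "pat_inv (max r s) (\<lambda>x y. A x y + B x y)"
proof (rule pat_invI)
  have A: "pat_inv (max r s) A" and B: "pat_inv (max r s) B" using assms pat_inv_mono by auto
  show "x \<in> V \<and> y \<in> gball (max r s) x" if "A x y + B x y \<noteq> 0" for x y
    using that pat_inv_support[OF A, of x y] pat_inv_support[OF B, of x y] by fastforce
  show "A (\<phi> x) (\<phi> y) + B (\<phi> x) (\<phi> y) = A x y + B x y"
    if "x \<in> V" "x' \<in> V" "ball_iso G (max r s) x x' \<phi>" "y \<in> gball (max r s) x" for x x' \<phi> y
    using pat_inv_entry[OF A that(3,1) ball_self[OF that(1), of 0] _ that(4)]
      pat_inv_entry[OF B that(3,1) ball_self[OF that(1), of 0] _ that(4)] by simp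
qed

lemma pat_inv_scale:
  assumes A: "pat_inv r A"
  shows "pat_inv r (\<lambda>x y. a * A x y)"
proof (rule pat_invI)
  show "x \<in> V \<and> y \<in> gball r x" if "a * A x y \<noteq> 0" for x y
    using that pat_inv_support[OF A, of x y] by fastforce
  show "a * A (\<phi> x) (\<phi> y) = a * A x y"
    if "x \<in> V" "x' \<in> V" "ball_iso G r x x' \<phi>" "y \<in> gball r x" for x x' \<phi> y
    using pat_inv_entry[OF A that(3,1) ball_self[OF that(1), of 0] _ that(4)] by simp
qed

lemma pat_inv_one: "pat_inv 0 (mat_one G)"
proof (rule pat_invI)
  show "x \<in> V \<and> y \<in> gball 0 x" if "mat_one G x y \<noteq> 0" for x y
    using that by (auto simp: mat_one_def split: if_splits)
  show "mat_one G (\<phi> x) (\<phi> y) = mat_one G x y"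
    if "x \<in> V" "x' \<in> V" "ball_iso G 0 x x' \<phi>" "y \<in> gball 0 x" for x x' \<phi> y
    using that ball_isoD(2)[OF that(3)] by (simp add: ball_0 mat_one_def)
qed

lemma mat_mult_left_eq:
  assumes A: "pat_inv r A" and x: "x \<in> V" and F: "finite F" "gball r x \<subseteq> F" "F \<subseteq> V"
  shows "mat_mult G A B x y = (\<Sum>z\<in>F. A x z * B z y)"
  unfolding mat_mult_def
proof (rule infsum_finite_support[OF F(1,3)])
  fix z assume "z \<in> V - F"
  then have "A x z = 0" using pat_inv_support(3)[OF A, of x z] F(2) by blast
  then show "A x z * B z y = 0" by simp
qed

lemma mat_mult_right_eq:
  assumes B: "pat_inv r B" and F: "finite F" "gball r y \<subseteq> F" "F \<subseteq> V"
  shows "mat_mult G A B x y = (\<Sum>z\<in>F. A x z * B z y)"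
  unfolding mat_mult_def
proof (rule infsum_finite_support[OF F(1,3)])
  fix z assume "z \<in> V - F"
  then have "B z y = 0" using pat_inv_support(4)[OF B, of z y] F(2) by blast
  then show "A x z * B z y = 0" by simp
qed

lemma ball_subset_verts: "gball r x \<subseteq> V"
  using ball_verts by blast

lemma pat_inv_mult:
  assumes A: "pat_inv r A" and B: "pat_inv s B"
  shows "pat_inv (r + s) (mat_mult G A B)"
proof (rule pat_invI)
  show "x \<in> V \<and> y \<in> gball (r + s) x" if nz: "mat_mult G A B x y \<noteq> 0" for x y
  proof -
    have "\<exists>z\<in>V. A x z * B z y \<noteq> 0"
    proof (rule ccontr)
      assume "\<not> ?thesis"
      then have "mat_mult G A B x y = 0" unfolding mat_mult_def by (simp add: infsum_0)
      then show False using nz by simp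
    qed
    then obtain z where "A x z \<noteq> 0" "B z y \<noteq> 0" by auto
    then show ?thesis using pat_inv_support[OF A, of x z] pat_inv_support[OF B, of z y] ball_trans by blast
  qed
  fix x x' \<phi> y assume x: "x \<in> V" "x' \<in> V" and iso: "ball_iso G (r + s) x x' \<phi>" and y: "y \<in> gball (r + s) x"
  have iso_r: "ball_iso G r x (\<phi> x) \<phi>" by (rule ball_iso_restrict[OF iso x(1) ball_self[OF x(1), of 0]]) simp
  have xx: "\<phi> x = x'" by (rule ball_isoD(2)[OF iso])
  have "mat_mult G A B (\<phi> x) (\<phi> y) = (\<Sum>z\<in>gball r x'. A x' z * B z (\<phi> y))"
    unfolding xx by (rule mat_mult_left_eq[OF A]) (use x ball_subset_verts in auto)
  also have "\<dots> = (\<Sum>z\<in>gball r x. A x' (\<phi> z) * B (\<phi> z) (\<phi> y))"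
    using sum.reindex_bij_betw[OF ball_isoD(1)[OF iso_r], of "\<lambda>z. A x' z * B z (\<phi> y)"] xx by simp
  also have "\<dots> = (\<Sum>z\<in>gball r x. A x z * B z y)"
  proof (intro sum.cong refl)
    fix z assume z: "z \<in> gball r x"
    then have zR: "z \<in> gball (r + s) x" using ball_mono[of r "r + s" x] by auto
    have "A x' (\<phi> z) = A x z"
      using pat_inv_entry[OF A iso x(1) ball_self[OF x(1), of 0] _ zR] xx by simp
    moreover have "B (\<phi> z) (\<phi> y) = B z y" by (rule pat_inv_entry[OF B iso x(1) z _ y]) simp
    ultimately show "A x' (\<phi> z) * B (\<phi> z) (\<phi> y) = A x z * B z y" by simp
  qed
  also have "\<dots> = mat_mult G A B x y"
    by (rule mat_mult_left_eq[OF A, symmetric]) (use x ball_subset_verts in auto)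
  finally show "mat_mult G A B (\<phi> x) (\<phi> y) = mat_mult G A B x y" .
qed

text \<open>The inner product of the \<open>x\<close>-th columns of \<open>A\<close> and \<open>B\<close>. The trace inner product is the Folner mean of
these numbers, which reduces statements about the trace to finitely supported columns.\<close>

definition col_inner :: "'v matrix \<Rightarrow> 'v matrix \<Rightarrow> 'v \<Rightarrow> complex" where
  "col_inner A B x = mat_mult G (mat_star B) A x x"

lemma col_inner_eq:
  assumes "pat_inv r A" "finite F" "gball r x \<subseteq> F" "F \<subseteq> V"
  shows "col_inner A B x = (\<Sum>z\<in>F. cnj (B z x) * A z x)"
  unfolding col_inner_def mat_mult_right_eq[OF assms] by (simp add: mat_star_def)

lemma col_inner_pattern_fun:
  assumes A: "pat_inv r A" and B: "pat_inv r B"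
  shows "pattern_fun (2 * r) (col_inner A B)"
  unfolding pattern_fun_def
proof (intro ballI allI impI)
  fix x x' \<phi> assume x: "x \<in> V" "x' \<in> V" and iso: "ball_iso G (2 * r) x x' \<phi>"
  have iso_r: "ball_iso G r x (\<phi> x) \<phi>" by (rule ball_iso_restrict[OF iso x(1) ball_self[OF x(1), of 0]]) simp
  have xx: "\<phi> x = x'" by (rule ball_isoD(2)[OF iso])
  have "col_inner A B x' = (\<Sum>z\<in>gball r x'. cnj (B z x') * A z x')"
    by (rule col_inner_eq[OF A]) (use x ball_subset_verts in auto)
  also have "\<dots> = (\<Sum>z\<in>gball r x. cnj (B (\<phi> z) (\<phi> x)) * A (\<phi> z) (\<phi> x))"
    using sum.reindex_bij_betw[OF ball_isoD(1)[OF iso_r], of "\<lambda>z. cnj (B z x') * A z x'"] xx by simp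
  also have "\<dots> = (\<Sum>z\<in>gball r x. cnj (B z x) * A z x)"
  proof (intro sum.cong refl)
    fix z assume z: "z \<in> gball r x"
    have "A (\<phi> z) (\<phi> x) = A z x" "B (\<phi> z) (\<phi> x) = B z x"
      using pat_inv_entry[OF A iso x(1) z _ ball_self[OF x(1)]] pat_inv_entry[OF B iso x(1) z _ ball_self[OF x(1)]] by auto
    then show "cnj (B (\<phi> z) (\<phi> x)) * A (\<phi> z) (\<phi> x) = cnj (B z x) * A z x" by simp
  qed
  also have "\<dots> = col_inner A B x" by (rule col_inner_eq[OF A, symmetric]) (use x ball_subset_verts in auto)
  finally show "col_inner A B x = col_inner A B x'" by simp
qed

text \<open>A row sum depends only on a pattern, and there are finitely many patterns.\<close>

lemma pat_inv_row_bound: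
  assumes A: "pat_inv r A"
  obtains K :: real where "0 < K" "\<And>x F. finite F \<Longrightarrow> F \<subseteq> V \<Longrightarrow> (\<Sum>y\<in>F. cmod (A x y)) \<le> K"
proof -
  define f where "f = (\<lambda>x. \<Sum>y\<in>gball r x. cmod (A x y))"
  have "pattern_fun r f"
    unfolding pattern_fun_def
  proof (intro ballI allI impI)
    fix x x' \<phi> assume x: "x \<in> V" "x' \<in> V" and iso: "ball_iso G r x x' \<phi>"
    have "f x' = (\<Sum>y\<in>gball r x. cmod (A x' (\<phi> y)))"
      unfolding f_def using sum.reindex_bij_betw[OF ball_isoD(1)[OF iso], of "\<lambda>y. cmod (A x' y)"] by simp
    also have "\<dots> = f x"
      unfolding f_def using pat_inv_entry[OF A iso x(1) ball_self[OF x(1), of 0]] ball_isoD(2)[OF iso]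
      by (intro sum.cong refl) simp
    finally show "f x = f x'" by simp
  qed
  then have fin: "finite (f ` V)" by (rule pattern_fun_finite_range)
  define K where "K = (\<Sum>t\<in>f ` V. \<bar>t\<bar>) + 1"
  have K: "0 < K" unfolding K_def by (intro add_nonneg_pos sum_nonneg) auto
  have fK: "f x \<le> K" if "x \<in> V" for x
  proof -
    have "\<bar>f x\<bar> \<le> (\<Sum>t\<in>f ` V. \<bar>t\<bar>)" by (rule member_le_sum) (use fin that in auto)
    then show ?thesis by (simp add: K_def)
  qed
  have "(\<Sum>y\<in>F. cmod (A x y)) \<le> K" if F: "finite F" "F \<subseteq> V" for x F
  proof (cases "x \<in> V")
    case True
    have "(\<Sum>y\<in>F. cmod (A x y)) = (\<Sum>y\<in>F \<inter> gball r x. cmod (A x y))"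
      using F pat_inv_support(3)[OF A, of x] by (intro sum.mono_neutral_right) auto
    also have "\<dots> \<le> f x" unfolding f_def using True by (intro sum_mono2) auto
    finally show ?thesis using fK[OF True] by simp
  next
    case False
    then have "(\<Sum>y\<in>F. cmod (A x y)) = 0" using pat_inv_support(1)[OF A, of x] by (intro sum.neutral) auto
    then show ?thesis using K by simp
  qed
  then show thesis using that K by blast
qed

end

locale aq_graph =
  fixes G :: "'v graph"
  assumes AQ: "AQ_graph G"

sublocale aq_graph \<subseteq> bounded_graph
  using AQ by unfold_locales (simp_all add: AQ_graph_def)

context aq_graph
begin

definition folner_mean :: "('v \<Rightarrow> complex) \<Rightarrow> complex \<Rightarrow> bool" where
  "folner_mean f t \<longleftrightarrow> (\<forall>Q. folner_sequence G Q \<longrightarrow> (\<lambda>n. (\<Sum>x\<in>Q n. f x) / of_nat (card (Q n))) \<longlonglongrightarrow> t)"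

lemma folner_exists: obtains Q where "folner_sequence G Q"
  using AQ unfolding AQ_graph_def amenable_def by blast

lemma folnerD:
  assumes "folner_sequence G Q"
  shows "finite (Q n)" "Q n \<noteq> {}" "Q n \<subseteq> V" "0 < card (Q n)"
    "(\<lambda>n. real (card (boundary G (Q n))) / real (card (Q n))) \<longlonglongrightarrow> 0"
  using assms unfolding folner_sequence_def by (auto simp: card_gt_0_iff)

lemma folner_mean_unique: "folner_mean f s \<Longrightarrow> folner_mean f t \<Longrightarrow> s = t"
  using folner_exists LIMSEQ_unique unfolding folner_mean_def by metis

lemma folner_mean_cong:
  assumes "\<And>x. x \<in> V \<Longrightarrow> f x = g x"
  shows "folner_mean f t \<longleftrightarrow> folner_mean g t"
proof -
  have "(\<Sum>x\<in>Q n. f x) = (\<Sum>x\<in>Q n. g x)" if "folner_sequence G Q" for Q n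
    using folnerD(3)[OF that, of n] assms by (intro sum.cong) auto
  then show ?thesis unfolding folner_mean_def by simp
qed

lemma folner_mean_add: "folner_mean f s \<Longrightarrow> folner_mean g t \<Longrightarrow> folner_mean (\<lambda>x. f x + g x) (s + t)"
  unfolding folner_mean_def by (auto simp: sum.distrib add_divide_distrib intro!: tendsto_add)

lemma folner_mean_scale: "folner_mean f s \<Longrightarrow> folner_mean (\<lambda>x. a * f x) (a * s)"
  unfolding folner_mean_def by (auto simp: sum_distrib_left[symmetric] times_divide_eq_right[symmetric] simp del: times_divide_eq_right intro!: tendsto_mult_left)

lemma folner_mean_cnj: "folner_mean f s \<Longrightarrow> folner_mean (\<lambda>x. cnj (f x)) (cnj s)"
  unfolding folner_mean_def
proof (intro allI impI)
  fix Q assume "\<forall>Q. folner_sequence G Q \<longrightarrow> (\<lambda>n. (\<Sum>x\<in>Q n. f x) / of_nat (card (Q n))) \<longlonglongrightarrow> s" "folner_sequence G Q"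
  then have "(\<lambda>n. cnj ((\<Sum>x\<in>Q n. f x) / of_nat (card (Q n)))) \<longlonglongrightarrow> cnj s" by (intro tendsto_cnj) blast
  then show "(\<lambda>n. (\<Sum>x\<in>Q n. cnj (f x)) / of_nat (card (Q n))) \<longlonglongrightarrow> cnj s" by simp
qed

lemma folner_mean_mono:
  assumes "folner_mean f s" "folner_mean g t" "\<And>x. x \<in> V \<Longrightarrow> Re (f x) \<le> Re (g x)"
  shows "Re s \<le> Re t"
proof -
  obtain Q where Q: "folner_sequence G Q" by (rule folner_exists)
  show ?thesis
  proof (rule LIMSEQ_le)
    have lim: "(\<lambda>n. Re ((\<Sum>x\<in>Q n. h x) / of_nat (card (Q n)))) \<longlonglongrightarrow> Re u" if "folner_mean h u" for h u
      using that Q unfolding folner_mean_def by (intro tendsto_Re) blast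
    show "(\<lambda>n. Re ((\<Sum>x\<in>Q n. f x) / of_nat (card (Q n)))) \<longlonglongrightarrow> Re s"
      "(\<lambda>n. Re ((\<Sum>x\<in>Q n. g x) / of_nat (card (Q n)))) \<longlonglongrightarrow> Re t"
      by (rule lim[OF assms(1)], rule lim[OF assms(2)])
    have "Re ((\<Sum>x\<in>Q n. f x) / of_nat (card (Q n))) \<le> Re ((\<Sum>x\<in>Q n. g x) / of_nat (card (Q n)))" for n
    proof -
      have "(\<Sum>x\<in>Q n. Re (f x)) \<le> (\<Sum>x\<in>Q n. Re (g x))"
        using folnerD(3)[OF Q, of n] assms(3) by (intro sum_mono) auto
      then show ?thesis by (simp add: Re_divide_of_nat divide_right_mono)
    qed
    then show "\<exists>N. \<forall>n\<ge>N. Re ((\<Sum>x\<in>Q n. f x) / of_nat (card (Q n))) \<le> Re ((\<Sum>x\<in>Q n. g x) / of_nat (card (Q n)))" by blast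
  qed
qed

text \<open>A pattern function takes one value on each of finitely many patterns, so that its averages are a fixed
linear combination of the frequencies of patterns.\<close>

lemma folner_mean_exists:
  assumes f: "pattern_fun R f"
  shows "\<exists>t. folner_mean f t"
proof -
  obtain p where p: "\<And>\<alpha> Q. \<alpha> \<in> patterns G R \<Longrightarrow> folner_sequence G Q \<Longrightarrow>
      (\<lambda>n. real (card (Q n \<inter> \<alpha>)) / real (card (Q n))) \<longlonglongrightarrow> p \<alpha>"
    using AQ unfolding AQ_graph_def by metis
  define c where "c = (\<lambda>\<alpha>. f (SOME x. x \<in> \<alpha>))"
  have fc: "f x = c \<alpha>" if "\<alpha> \<in> patterns G R" "x \<in> \<alpha>" for x \<alpha>
    unfolding c_def using pattern_fun_const[OF f that] someI[of "\<lambda>x. x \<in> \<alpha>" x] that by blast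
  have "folner_mean f (\<Sum>\<alpha>\<in>patterns G R. c \<alpha> * complex_of_real (p \<alpha>))"
    unfolding folner_mean_def
  proof (intro allI impI)
    fix Q assume Q: "folner_sequence G Q"
    have "(\<Sum>x\<in>Q n. f x) = (\<Sum>\<alpha>\<in>patterns G R. c \<alpha> * of_nat (card (Q n \<inter> \<alpha>)))" for n
    proof -
      have "Q n = (\<Union>\<alpha>\<in>patterns G R. Q n \<inter> \<alpha>)"
        using folnerD(3)[OF Q, of n] Union_quotient[OF same_pattern_equiv, of R] unfolding patterns_def by blast
      then have "(\<Sum>x\<in>Q n. f x) = (\<Sum>x\<in>(\<Union>\<alpha>\<in>patterns G R. Q n \<inter> \<alpha>). f x)" by simp
      also have "\<dots> = (\<Sum>\<alpha>\<in>patterns G R. \<Sum>x\<in>Q n \<inter> \<alpha>. f x)"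
        using folnerD(1)[OF Q, of n] quotient_disj[OF same_pattern_equiv, of _ R]
        by (intro sum.UNION_disjoint) (auto simp: finite_patterns[unfolded patterns_def] patterns_def)
      also have "\<dots> = (\<Sum>\<alpha>\<in>patterns G R. c \<alpha> * of_nat (card (Q n \<inter> \<alpha>)))"
      proof (intro sum.cong refl)
        fix \<alpha> assume "\<alpha> \<in> patterns G R"
        then have "(\<Sum>x\<in>Q n \<inter> \<alpha>. f x) = (\<Sum>x\<in>Q n \<inter> \<alpha>. c \<alpha>)" using fc by (intro sum.cong) auto
        then show "(\<Sum>x\<in>Q n \<inter> \<alpha>. f x) = c \<alpha> * of_nat (card (Q n \<inter> \<alpha>))" by (simp add: mult.commute)
      qed
      finally show ?thesis .
    qed
    moreover have "(\<lambda>n. \<Sum>\<alpha>\<in>patterns G R. c \<alpha> * complex_of_real (real (card (Q n \<inter> \<alpha>)) / real (card (Q n))))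
        \<longlonglongrightarrow> (\<Sum>\<alpha>\<in>patterns G R. c \<alpha> * complex_of_real (p \<alpha>))"
      by (intro tendsto_sum tendsto_mult_left tendsto_of_real p Q)
    ultimately show "(\<lambda>n. (\<Sum>x\<in>Q n. f x) / of_nat (card (Q n))) \<longlonglongrightarrow> (\<Sum>\<alpha>\<in>patterns G R. c \<alpha> * complex_of_real (p \<alpha>))"
      by (simp add: sum_divide_distrib)
  qed
  then show ?thesis by blast
qed

lemma mat_trace_eq: "folner_mean (\<lambda>x. A x x) t \<Longrightarrow> mat_trace G A = t"
  unfolding mat_trace_def folner_mean_def[symmetric]
  by (rule the_equality) (use folner_mean_unique in blast)+

abbreviation "P \<equiv> pattern_space G"

lemma P_simps [simp]:
  "vecs P = pattern_invariant G" "vadd P A B = (\<lambda>x y. A x y + B x y)" "vscale P a A = (\<lambda>x y. a * A x y)"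
  unfolding pattern_space_def by simp_all

lemma inprod_mean:
  assumes "A \<in> pattern_invariant G" "B \<in> pattern_invariant G"
  shows "folner_mean (col_inner A B) (inprod P A B)"
proof -
  obtain r s where "pat_inv r A" "pat_inv s B" using assms unfolding pattern_invariant_iff by blast
  then have "pat_inv (max r s) A" "pat_inv (max r s) B" using pat_inv_mono by auto
  then obtain t where t: "folner_mean (col_inner A B) t" using folner_mean_exists[OF col_inner_pattern_fun] by blast
  then have "inprod P A B = t"
    unfolding pattern_space_def by (simp add: col_inner_def[abs_def] mat_trace_eq)
  then show ?thesis using t by simp
qed

lemma col_inner_add:
  assumes "pat_inv r A" "pat_inv s A'" "x \<in> V"
  shows "col_inner (\<lambda>x y. A x y + A' x y) B x = col_inner A B x + col_inner A' B x"
proof -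
  let ?F = "gball (max r s) x"
  have F: "finite ?F" "?F \<subseteq> V" "gball r x \<subseteq> ?F" "gball s x \<subseteq> ?F" using assms(3) ball_subset_verts ball_mono by auto
  show ?thesis
    unfolding col_inner_eq[OF pat_inv_add[OF assms(1,2)] F(1) order_refl F(2)] col_inner_eq[OF assms(1) F(1,3,2)] col_inner_eq[OF assms(2) F(1,4,2)]
    by (simp add: distrib_left sum.distrib)
qed

lemma col_inner_scale:
  assumes "pat_inv r A" "x \<in> V"
  shows "col_inner (\<lambda>x y. a * A x y) B x = a * col_inner A B x"
proof -
  have F: "finite (gball r x)" using assms(2) by simp
  show ?thesis
    unfolding col_inner_eq[OF pat_inv_scale[OF assms(1)] F order_refl ball_subset_verts] col_inner_eq[OF assms(1) F order_refl ball_subset_verts]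
    by (simp add: sum_distrib_left mult.left_commute)
qed

lemma col_inner_sym:
  assumes "pat_inv r A" "pat_inv s B" "x \<in> V"
  shows "col_inner B A x = cnj (col_inner A B x)"
proof -
  let ?F = "gball (max r s) x"
  have F: "finite ?F" "?F \<subseteq> V" "gball r x \<subseteq> ?F" "gball s x \<subseteq> ?F" using assms(3) ball_subset_verts ball_mono by auto
  show ?thesis
    unfolding col_inner_eq[OF assms(1) F(1,3,2)] col_inner_eq[OF assms(2) F(1,4,2)] by (simp add: mult.commute)
qed

lemma col_inner_self:
  assumes "pat_inv r A" "finite F" "gball r x \<subseteq> F" "F \<subseteq> V"
  shows "col_inner A A x = complex_of_real (\<Sum>z\<in>F. (cmod (A z x))\<^sup>2)"
  unfolding col_inner_eq[OF assms] of_real_sum by (intro sum.cong refl) (simp only: complex_norm_square mult.commute)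

lemma semi_inner_P: "semi_inner P"
proof
  show "vecs P \<noteq> {}" using pat_inv_one pattern_invariant_iff by auto
  show "vadd P A B \<in> vecs P" if "A \<in> vecs P" "B \<in> vecs P" for A B
    using that pat_inv_add unfolding P_simps pattern_invariant_iff by blast
  show "vscale P a A \<in> vecs P" if "A \<in> vecs P" for a A
    using that pat_inv_scale unfolding P_simps pattern_invariant_iff by blast
  show "inprod P (vadd P A B) C = inprod P A C + inprod P B C"
    if asm: "A \<in> vecs P" "B \<in> vecs P" "C \<in> vecs P" for A B C
  proof -
    obtain r s where rs: "pat_inv r A" "pat_inv s B" using asm(1,2) unfolding P_simps pattern_invariant_iff by blast
    have AB: "(\<lambda>x y. A x y + B x y) \<in> pattern_invariant G" using pat_inv_add[OF rs] pattern_invariant_iff by blast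
    have "folner_mean (\<lambda>x. col_inner A C x + col_inner B C x) (inprod P A C + inprod P B C)"
      using asm by (intro folner_mean_add inprod_mean) auto
    moreover have "folner_mean (\<lambda>x. col_inner A C x + col_inner B C x) (inprod P (vadd P A B) C)"
      using inprod_mean[OF AB, of C] asm folner_mean_cong[OF col_inner_add[OF rs, where B = C]] by simp
    ultimately show ?thesis using folner_mean_unique by blast
  qed
  show "inprod P (vscale P a A) C = a * inprod P A C" if asm: "A \<in> vecs P" "C \<in> vecs P" for a A C
  proof -
    obtain r where r: "pat_inv r A" using asm(1) unfolding P_simps pattern_invariant_iff by blast
    have aA: "(\<lambda>x y. a * A x y) \<in> pattern_invariant G" using pat_inv_scale[OF r] pattern_invariant_iff by blast
    have "folner_mean (\<lambda>x. a * col_inner A C x) (a * inprod P A C)"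
      using asm by (intro folner_mean_scale inprod_mean) auto
    moreover have "folner_mean (\<lambda>x. a * col_inner A C x) (inprod P (vscale P a A) C)"
      using inprod_mean[OF aA, of C] asm folner_mean_cong[OF col_inner_scale[OF r, where a = a and B = C]] by simp
    ultimately show ?thesis using folner_mean_unique by blast
  qed
  show "inprod P B A = cnj (inprod P A B)" if asm: "A \<in> vecs P" "B \<in> vecs P" for A B
  proof -
    obtain r s where rs: "pat_inv r A" "pat_inv s B" using asm unfolding P_simps pattern_invariant_iff by blast
    have "folner_mean (\<lambda>x. cnj (col_inner A B x)) (cnj (inprod P A B))" using asm by (intro folner_mean_cnj inprod_mean) auto
    moreover have "folner_mean (\<lambda>x. cnj (col_inner A B x)) (inprod P B A)"
      using inprod_mean[of B A] asm folner_mean_cong[OF col_inner_sym[OF rs]] by simp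
    ultimately show ?thesis using folner_mean_unique by blast
  qed
  show "0 \<le> Re (inprod P A A)" if asm: "A \<in> vecs P" for A
  proof -
    obtain r where r: "pat_inv r A" using asm unfolding P_simps pattern_invariant_iff by blast
    have "folner_mean (\<lambda>_. 0) 0" by (simp add: folner_mean_def)
    then have "Re 0 \<le> Re (inprod P A A)"
    proof (rule folner_mean_mono)
      show "folner_mean (col_inner A A) (inprod P A A)" using asm by (intro inprod_mean) auto
      show "Re 0 \<le> Re (col_inner A A x)" if "x \<in> V" for x
        using col_inner_self[OF r _ order_refl ball_subset_verts, of x] that by (simp add: sum_nonneg)
    qed
    then show ?thesis by simp
  qed
qed

end

text \<open>The bound \<open>K\<close> for the row sums of moduli also bounds the norm of left multiplication by \<open>B\<close>.\<close>

locale aq_operator = aq_graph G for G :: "'v graph" +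
  fixes B :: "'v matrix" and rB :: nat and K :: real
  assumes B: "pat_inv rB B" and herm: "\<And>x y. B y x = cnj (B x y)"
    and K_pos: "0 < K" and row: "\<And>x F. finite F \<Longrightarrow> F \<subseteq> V \<Longrightarrow> (\<Sum>y\<in>F. cmod (B x y)) \<le> K"
begin

lemma col: "finite F \<Longrightarrow> F \<subseteq> V \<Longrightarrow> (\<Sum>x\<in>F. cmod (B x y)) \<le> K"
  using row[of F y] by (simp add: herm[of _ y])

lemma mult_closed: "A \<in> pattern_invariant G \<Longrightarrow> mat_mult G B A \<in> pattern_invariant G"
  using pat_inv_mult[OF B] pattern_invariant_iff by blast

text \<open>Left multiplication by \<open>B\<close> acts on every column separately. There it is self-adjoint because \<open>B\<close> is
Hermitian, and bounded by the Schur test.\<close>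

lemma left_mult_operator: "bounded_selfadjoint P (mat_mult G B) K"
proof -
  interpret semi_inner P by (rule semi_inner_P)
  show ?thesis
  proof
    show "mat_mult G B A \<in> vecs P" if "A \<in> vecs P" for A using that mult_closed by simp
    show "inprod P (mat_mult G B A) C = inprod P A (mat_mult G B C)" if AC: "A \<in> vecs P" "C \<in> vecs P" for A C
    proof -
      obtain r s where r: "pat_inv r A" and s: "pat_inv s C" using AC unfolding P_simps pattern_invariant_iff by blast
      have "col_inner (mat_mult G B A) C x = col_inner A (mat_mult G B C) x" if x: "x \<in> V" for x
      proof -
        define F where "F = gball (rB + r + s) x"
        have F: "finite F" "gball r x \<subseteq> F" "gball s x \<subseteq> F" "gball (rB + r) x \<subseteq> F" "F \<subseteq> V"
          unfolding F_def by (simp_all add: x ball_mono ball_subset_verts)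
        have "col_inner (mat_mult G B A) C x = (\<Sum>z\<in>F. \<Sum>w\<in>F. cnj (C z x) * (B z w * A w x))"
          unfolding col_inner_eq[OF pat_inv_mult[OF B r] F(1,4,5)] mat_mult_right_eq[OF r F(1,2,5)] by (simp add: sum_distrib_left)
        also have "\<dots> = (\<Sum>w\<in>F. \<Sum>z\<in>F. cnj (C z x) * (B z w * A w x))" by (rule sum.swap)
        also have "\<dots> = (\<Sum>w\<in>F. cnj (\<Sum>z\<in>F. B w z * C z x) * A w x)"
        proof (intro sum.cong refl)
          fix w
          show "(\<Sum>z\<in>F. cnj (C z x) * (B z w * A w x)) = cnj (\<Sum>z\<in>F. B w z * C z x) * A w x"
            unfolding cnj_sum sum_distrib_right by (intro sum.cong refl) (simp add: herm[of w])
        qed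
        also have "\<dots> = col_inner A (mat_mult G B C) x"
          unfolding col_inner_eq[OF r F(1,2,5)] mat_mult_right_eq[OF s F(1,3,5)] ..
        finally show ?thesis .
      qed
      then have "folner_mean (col_inner A (mat_mult G B C)) (inprod P (mat_mult G B A) C)"
        using inprod_mean[of "mat_mult G B A" C] AC mult_closed folner_mean_cong[of "col_inner (mat_mult G B A) C"] by simp
      then show ?thesis using inprod_mean[of A "mat_mult G B C"] AC mult_closed folner_mean_unique by simp
    qed
    show "vnorm P (mat_mult G B A) \<le> K * vnorm P A" if A: "A \<in> vecs P" for A
    proof (rule power2_le_imp_le)
      obtain r where r: "pat_inv r A" using A unfolding P_simps pattern_invariant_iff by blast
      have BA: "mat_mult G B A \<in> vecs P" using A mult_closed by simp
      have "Re (inprod P (mat_mult G B A) (mat_mult G B A)) \<le> Re (complex_of_real (K\<^sup>2) * inprod P A A)"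
      proof (rule folner_mean_mono[OF inprod_mean folner_mean_scale[OF inprod_mean]])
        show "Re (col_inner (mat_mult G B A) (mat_mult G B A) x) \<le> Re (complex_of_real (K\<^sup>2) * col_inner A A x)" if x: "x \<in> V" for x
        proof -
          define F where "F = gball (rB + r) x"
          have F: "finite F" "gball r x \<subseteq> F" "F \<subseteq> V"
            unfolding F_def by (simp_all add: x ball_mono ball_subset_verts)
          have FF: "gball (rB + r) x \<subseteq> F" by (simp add: F_def)
          have "Re (col_inner (mat_mult G B A) (mat_mult G B A) x) = (\<Sum>z\<in>F. (cmod (\<Sum>w\<in>F. B z w * A w x))\<^sup>2)"
            unfolding col_inner_self[OF pat_inv_mult[OF B r] F(1) FF F(3)] mat_mult_right_eq[OF r F(1,2,3)] by simp
          also have "\<dots> \<le> K\<^sup>2 * (\<Sum>w\<in>F. (cmod (A w x))\<^sup>2)"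
            using F K_pos by (intro schur_test row col) auto
          also have "\<dots> = Re (complex_of_real (K\<^sup>2) * col_inner A A x)"
            unfolding col_inner_self[OF r F(1,2,3)] by simp
          finally show ?thesis .
        qed
      qed (use A BA in auto)
      then show "(vnorm P (mat_mult G B A))\<^sup>2 \<le> (K * vnorm P A)\<^sup>2"
        using A BA by (simp add: vnorm_square power_mult_distrib)
    qed (use A K_pos in simp)
  qed (rule K_pos)
qed

abbreviation "B_pow k \<equiv> (mat_mult G B ^^ k) (mat_one G)"

lemma B_pow_closed: "B_pow k \<in> pattern_invariant G"
  by (induction k) (use pat_inv_one mult_closed pattern_invariant_iff in auto)

lemma B_pow_mean: "folner_mean (\<lambda>x. B_pow k x x) (inprod P (B_pow k) (mat_one G))"
proof -
  have one: "mat_one G \<in> pattern_invariant G" using pat_inv_one pattern_invariant_iff by blast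
  obtain r where r: "pat_inv r (B_pow k)" using B_pow_closed[of k] unfolding pattern_invariant_iff by blast
  have "col_inner (B_pow k) (mat_one G) x = B_pow k x x" if x: "x \<in> V" for x
  proof -
    have "col_inner (B_pow k) (mat_one G) x = (\<Sum>z\<in>gball r x. cnj (mat_one G z x) * B_pow k z x)"
      by (rule col_inner_eq[OF r]) (use x ball_subset_verts in auto)
    also have "\<dots> = (\<Sum>z\<in>gball r x. if z = x then B_pow k x x else 0)"
      using x by (intro sum.cong refl) (auto simp: mat_one_def)
    finally show ?thesis using x by simp
  qed
  then show ?thesis
    using inprod_mean[OF B_pow_closed one, of k] folner_mean_cong[of "col_inner (B_pow k) (mat_one G)"] by simp
qed

end

text \<open>Evaluate the form at the indicator functions of two vertices.\<close>

lemma (in bounded_graph) self_adjoint_hermitian: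
  assumes B: "pat_inv r B" and sa: "self_adjoint_on_l2 G B"
  shows "B y x = cnj (B x y)"
proof (cases "x \<in> V \<and> y \<in> V")
  case False
  then have "B y x = 0" "B x y = 0" using pat_inv_support[OF B] by blast+
  then show ?thesis by simp
next
  case True
  define \<delta> :: "'v \<Rightarrow> 'v \<Rightarrow> complex" where "\<delta> = (\<lambda>a z. if z = a then 1 else 0)"
  have \<delta>_simps: "\<delta> a a = 1" "z \<noteq> a \<Longrightarrow> \<delta> a z = 0" for a z by (simp_all add: \<delta>_def)
  have l2: "\<delta> a \<in> l2 G" if "a \<in> V" for a
  proof -
    have "(\<lambda>z. (cmod (\<delta> a z))\<^sup>2) summable_on V \<longleftrightarrow> (\<lambda>z. (cmod (\<delta> a z))\<^sup>2) summable_on {a}"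
      by (rule summable_on_cong_neutral) (use that in \<open>auto simp: \<delta>_def\<close>)
    then show ?thesis using that by (auto simp: l2_def \<delta>_def)
  qed
  have app: "mat_apply G B (\<delta> a) z = B z a" if "a \<in> V" for a z
    unfolding mat_apply_def using that
    by (subst infsum_finite_support[of "{a}"]) (auto simp: \<delta>_def)
  have "l2_inner G (mat_apply G B (\<delta> x)) (\<delta> y) = B y x"
    unfolding l2_inner_def using True by (subst infsum_finite_support[of "{y}"]) (auto simp: app \<delta>_simps)
  moreover have "l2_inner G (\<delta> x) (mat_apply G B (\<delta> y)) = cnj (B x y)"
    unfolding l2_inner_def using True by (subst infsum_finite_support[of "{x}"]) (auto simp: app \<delta>_simps)
  ultimately show ?thesis using sa l2 True unfolding self_adjoint_on_l2_def by metis
qed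

section \<open>Finite compressions and atoms of the spectral measure\<close>

lemma finite_matrix_spectrum:
  fixes A :: "'v \<Rightarrow> 'v \<Rightarrow> int" and M :: real
  assumes Q: "finite Q"
    and sym: "\<And>x y. x \<in> Q \<Longrightarrow> y \<in> Q \<Longrightarrow> A x y = A y x"
    and bound: "\<And>x. x \<in> Q \<Longrightarrow> (\<Sum>y\<in>Q. real_of_int \<bar>A x y\<bar>) \<le> M"
  obtains es :: "real list" where "length es = card Q" "\<And>e. e \<in> set es \<Longrightarrow> \<bar>e\<bar> \<le> M"
    "\<And>k. real_of_int (\<Sum>x\<in>Q. fin_mat_power Q A k x x) = (\<Sum>e\<leftarrow>es. e ^ k)"
    "\<And>f :: int poly. 1 \<le> (\<Prod>e\<leftarrow>filter (\<lambda>e. poly (of_int_poly f) e \<noteq> 0) es. \<bar>poly (of_int_poly f) e\<bar>)"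
proof -
  define n where "n = card Q"
  obtain h where h: "bij_betw h {..<n} Q"
    using ex_bij_betw_nat_finite[OF Q] unfolding n_def lessThan_atLeast0 by blast
  have hQ: "h i \<in> Q" if "i < n" for i using bij_betwE[OF h] that by simp
  define A' where "A' = (\<lambda>i j. A (h i) (h j))"
  have inj: "h i = h j \<longleftrightarrow> i = j" if "i < n" "j < n" for i j
    using bij_betw_imp_inj_on[OF h] that by (auto dest: inj_onD)
  have pow: "fin_mat_power {..<n} A' k i j = fin_mat_power Q A k (h i) (h j)" if "i < n" "j < n" for k i j
    using that
  proof (induction k arbitrary: i)
    case (Suc k)
    have "fin_mat_power {..<n} A' (Suc k) i j = (\<Sum>z<n. A (h i) (h z) * fin_mat_power Q A k (h z) (h j))"
      using Suc by (simp add: A'_def)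
    also have "\<dots> = fin_mat_power Q A (Suc k) (h i) (h j)"
      using sum.reindex_bij_betw[OF h, of "\<lambda>z. A (h i) z * fin_mat_power Q A k z (h j)"] by simp
    finally show ?case .
  qed (simp add: inj)
  have sym': "A' i j = A' j i" if "i < n" "j < n" for i j unfolding A'_def using sym hQ that by simp
  have bound': "(\<Sum>j<n. real_of_int \<bar>A' i j\<bar>) \<le> M" if "i < n" for i
    using bound[OF hQ[OF that]] sum.reindex_bij_betw[OF h, of "\<lambda>y. real_of_int \<bar>A (h i) y\<bar>"] by (simp add: A'_def)
  obtain es where es: "length es = n" "\<And>e. e \<in> set es \<Longrightarrow> \<bar>e\<bar> \<le> M"
    "\<And>k. real_of_int (\<Sum>i<n. fin_mat_power {..<n} A' k i i) = (\<Sum>e\<leftarrow>es. e ^ k)"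
    "\<And>f :: int poly. 1 \<le> (\<Prod>e\<leftarrow>filter (\<lambda>e. poly (of_int_poly f) e \<noteq> 0) es. \<bar>poly (of_int_poly f) e\<bar>)"
    using integer_matrix_eigenvalues[where A = A' and n = n and M = M] sym' bound' by blast
  have "(\<Sum>i<n. fin_mat_power {..<n} A' k i i) = (\<Sum>x\<in>Q. fin_mat_power Q A k x x)" for k
    using sum.reindex_bij_betw[OF h, of "\<lambda>x. fin_mat_power Q A k x x"] pow by simp
  then show thesis using that[of es] es by (simp add: n_def)
qed

text \<open>A product of denominators. The lemma is meant for the entries of a pattern-invariant matrix, only
finitely many of which are different.\<close>

lemma common_denominator:
  fixes S :: "complex set"
  assumes "finite S" "S \<subseteq> \<rat>"
  shows "\<exists>D::nat. 0 < D \<and> (\<forall>s\<in>S. of_nat D * s \<in> \<int>)"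
  using assms
proof (induction S rule: finite_induct)
  case empty then show ?case by (intro exI[of _ 1]) simp
next
  case (insert s S)
  then obtain D :: nat where D: "0 < D" "\<forall>s\<in>S. of_nat D * s \<in> \<int>" by auto
  obtain a b where ab: "s = of_int a / of_int b" "0 < b" using insert.prems by (auto elim: Rats_cases')
  have "of_nat (D * nat b) * u \<in> \<int>" if "u \<in> insert s S" for u
  proof (cases "u = s")
    case True
    have "of_nat (D * nat b) * u = of_int (int D * a)" using ab True by (simp add: of_nat_nat)
    then show ?thesis by (metis Ints_of_int)
  next
    case False
    then have "of_nat D * u \<in> \<int>" using D that by auto
    then have "of_nat (nat b) * (of_nat D * u) \<in> \<int>" by (rule Ints_mult[OF Ints_of_nat])
    moreover have "of_nat (D * nat b) * u = of_nat (nat b) * (of_nat D * u)" by (simp only: of_nat_mult mult_ac)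
    ultimately show ?thesis by (simp only:)
  qed
  then show ?case using D(1) ab(2) by (intro exI[of _ "D * nat b"]) auto
qed

lemma algebraic_scale:
  fixes l :: real
  assumes "algebraic (real D * l)" "0 < D"
  shows "algebraic l"
proof -
  obtain p where p: "\<And>i. coeff p i \<in> \<int>" "p \<noteq> 0" "poly p (real D * l) = 0"
    using assms(1) unfolding algebraic_def by blast
  define q where "q = pcompose p [:0, real D:]"
  have "coeff q i \<in> \<int>" for i unfolding q_def coeff_pcompose_linear using p(1) by (intro Ints_mult Ints_power) auto
  moreover have "q \<noteq> 0" unfolding q_def using p(2) assms(2) by (simp add: pcompose_eq_0_iff)
  moreover have "poly q l = 0" unfolding q_def using p(3) by (simp add: poly_pcompose mult.commute)
  ultimately show ?thesis unfolding algebraic_def by blast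
qed

text \<open>Approximate the indicator function of the interval by continuous functions that equal 1 on it and
fall off with slope \<open>j\<close> outside, and these by polynomials up to an error \<open>1 / (j + 1)\<close>.\<close>

lemma interval_poly_approximation:
  fixes K a b :: real
  obtains p :: "nat \<Rightarrow> real poly" where "\<And>t. \<bar>t\<bar> \<le> K \<Longrightarrow> (\<lambda>j. poly (p j) t) \<longlonglongrightarrow> indicat_real {a..b} t"
    "\<And>j t. \<bar>t\<bar> \<le> K \<Longrightarrow> \<bar>poly (p j) t\<bar> \<le> 2"
proof -
  define f where "f = (\<lambda>j t. max 0 (1 - real j * (max 0 (a - t) + max 0 (t - b))))"
  have f_bound: "\<bar>f j t\<bar> \<le> 1" for j t
  proof -
    have "0 \<le> real j * (max 0 (a - t) + max 0 (t - b))" by (intro mult_nonneg_nonneg add_nonneg_nonneg) auto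
    then show ?thesis by (simp add: f_def)
  qed
  have f_lim: "(\<lambda>j. f j t) \<longlonglongrightarrow> indicat_real {a..b} t" for t
  proof (cases "t \<in> {a..b}")
    case True then show ?thesis by (simp add: f_def)
  next
    case False
    define r where "r = max 0 (a - t) + max 0 (t - b)"
    have r: "0 < r" using False by (auto simp: r_def max_def)
    obtain N where N: "1 / r < real N" using reals_Archimedean2 by blast
    have "f j t = 0" if "N \<le> j" for j
    proof -
      have "1 / r \<le> real j" using N that by linarith
      then have "1 \<le> real j * r" using r by (simp add: field_simps)
      then show ?thesis by (simp add: f_def r_def)
    qed
    then show ?thesis using False by (intro tendsto_eventually) (auto simp: eventually_sequentially)
  qed
  have "\<exists>p. \<forall>t\<in>{-K..K}. \<bar>f j t - poly p t\<bar> < 1 / real (Suc j)" for j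
  proof -
    have "continuous_on {-K..K} (f j)" unfolding f_def by (intro continuous_intros)
    then obtain p where "\<And>t. t \<in> {-K..K} \<Longrightarrow> \<bar>f j t - poly p t\<bar> < 1 / real (Suc j)"
      using continuous_poly_approximation[of "-K" K "f j" "1 / real (Suc j)"] by auto
    then show ?thesis by blast
  qed
  then obtain p where p: "\<And>j t. t \<in> {-K..K} \<Longrightarrow> \<bar>f j t - poly (p j) t\<bar> < 1 / real (Suc j)" by metis
  show thesis
  proof (rule that)
    fix t assume "\<bar>t\<bar> \<le> K"
    then have t: "t \<in> {-K..K}" by (simp add: abs_le_iff minus_le_iff)
    have "(\<lambda>j. f j t - poly (p j) t) \<longlonglongrightarrow> 0"
    proof (rule Lim_null_comparison)
      show "\<forall>\<^sub>F j in sequentially. norm (f j t - poly (p j) t) \<le> 1 / real (Suc j)"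
        using p[OF t] by (intro always_eventually) (simp add: less_imp_le)
      show "(\<lambda>j. 1 / real (Suc j)) \<longlonglongrightarrow> 0" by (rule LIMSEQ_Suc[OF lim_1_over_n])
    qed
    from tendsto_diff[OF f_lim[of t] this] show "(\<lambda>j. poly (p j) t) \<longlonglongrightarrow> indicat_real {a..b} t" by simp
    show "\<bar>poly (p j) t\<bar> \<le> 2" for j
    proof -
      have "1 / real (Suc j) \<le> 1" by simp
      then show ?thesis using p[OF t, of j] f_bound[of j t] by linarith
    qed
  qed
qed

context aq_operator
begin

definition T where "T = left_mult G B"
definition \<Omega> where "\<Omega> = one_vec G"
definition H where "H = trace_space G"

text \<open>The unit vector is the class of a constant sequence, and \<open>T\<close> maps the class of the constant sequence
of a matrix to that of its product with \<open>B\<close>. So the moments of the spectral measure are traces of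
powers of \<open>B\<close>.\<close>

lemma hilbert_operator: "hilbert_operator H T K"
  and one_in: "\<Omega> \<in> vecs H"
  and moments: "inprod H ((T ^^ k) \<Omega>) \<Omega> = inprod P (B_pow k) (mat_one G)"
proof -
  interpret bs: bounded_selfadjoint P "mat_mult G B" K by (rule left_mult_operator)
  have completion: "bs.completion = H" unfolding bs.completion_def H_def trace_space_def ..
  have T: "bs.lift = T" unfolding bs.lift_def T_def left_mult_def completion H_def ..
  show "hilbert_operator H T K"
    using bs.hilbert_completion bs.lift_selfadjoint unfolding completion T hilbert_operator_def by blast
  have one: "mat_one G \<in> vecs P" using pat_inv_one pattern_invariant_iff by auto
  show "\<Omega> \<in> vecs H"
    using bs.cclass_in[OF bs.const_cauchy_seq[OF one]] unfolding completion \<Omega>_def one_vec_def .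
  have Bk: "B_pow k \<in> vecs P" using B_pow_closed by simp
  have "(T ^^ k) \<Omega> = cclass P (\<lambda>_. B_pow k)"
    using bs.lift_power[OF one, of k] unfolding T \<Omega>_def one_vec_def .
  then have "(\<lambda>_. inprod P (B_pow k) (mat_one G)) \<longlonglongrightarrow> inprod H ((T ^^ k) \<Omega>) \<Omega>"
    using bs.inner_completion_lim[OF bs.const_cauchy_seq[OF Bk] bs.const_cauchy_seq[OF one]]
    unfolding completion \<Omega>_def one_vec_def by simp
  then show "inprod H ((T ^^ k) \<Omega>) \<Omega> = inprod P (B_pow k) (mat_one G)"
    by (simp add: LIMSEQ_const_iff)
qed

sublocale HO: hilbert_operator H T K by (rule hilbert_operator)

definition \<mu> where "\<mu> = spectral_measure H T \<Omega>"

lemma mu: "sets \<mu> = sets borel" "finite_measure \<mu>" "AE t in \<mu>. \<bar>t\<bar> \<le> K"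
  unfolding \<mu>_def using HO.spectral_measure[OF one_in] by auto

text \<open>The indicator function of an interval is a bounded limit of polynomials on the spectrum, so that the
functional calculus applies to it.\<close>

lemma ids_eq: "ids G B t = (if t < 0 then 0 else measure \<mu> {0..t})"
proof (cases "t < 0")
  case False
  obtain p :: "nat \<Rightarrow> real poly" where p: "\<And>s. \<bar>s\<bar> \<le> K \<Longrightarrow> (\<lambda>j. poly (p j) s) \<longlonglongrightarrow> indicat_real {0..t} s"
    "\<And>j s. \<bar>s\<bar> \<le> K \<Longrightarrow> \<bar>poly (p j) s\<bar> \<le> 2" using interval_poly_approximation by blast
  have ind: "(indicator {0..t} :: real \<Rightarrow> complex) = (\<lambda>s. complex_of_real (indicat_real {0..t} s))"
    by (auto simp: indicator_def)
  have "inprod H (borel_calculus H T (indicator {0..t}) \<Omega>) \<Omega> = complex_of_real (LINT s|\<mu>. indicat_real {0..t} s)"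
    unfolding ind \<mu>_def by (rule HO.borel_calculus_form[OF _ p one_in]) auto
  also have "(LINT s|\<mu>. indicat_real {0..t} s) = measure \<mu> {0..t}"
    using sets_eq_imp_space_eq[OF mu(1)] by simp
  finally show ?thesis
    using False unfolding ids_def vN_trace_def H_def T_def \<Omega>_def by simp
qed (simp add: ids_def)

text \<open>For positive arguments the integrated density of states differs by a constant from the distribution
function of \<open>\<mu>\<close>.\<close>

lemma isCont_ids:
  assumes "0 < l" "measure \<mu> {l} = 0"
  shows "isCont (ids G B) l"
proof -
  interpret fm: finite_borel_measure \<mu>
    using mu by (simp add: finite_borel_measure_def finite_borel_measure_axioms_def)
  have cont: "isCont (\<lambda>t. cdf \<mu> t - measure \<mu> {..<0}) l"
    using assms(2) fm.isCont_cdf by (intro continuous_intros) simp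
  have "ids G B t = cdf \<mu> t - measure \<mu> {..<0}" if "0 < t" for t
  proof -
    have "measure \<mu> {..t} = measure \<mu> ({..<0} \<union> {0..t})"
      using that by (intro arg_cong[where f = "measure \<mu>"]) auto
    also have "\<dots> = measure \<mu> {..<0} + measure \<mu> {0..t}"
      using mu(1) by (intro fm.finite_measure_Union) auto
    finally show ?thesis using that by (simp add: ids_eq cdf_def)
  qed
  then have "\<forall>\<^sub>F t in nhds l. ids G B t = cdf \<mu> t - measure \<mu> {..<0}"
    using eventually_nhds_in_open[of "{0<..}" l] assms(1) by (auto elim: eventually_mono)
  then show ?thesis
    using cont isCont_cong[of "ids G B" "\<lambda>t. cdf \<mu> t - measure \<mu> {..<0}" l] by simp
qed

lemma not_isCont_ids:
  assumes "\<not> isCont (ids G B) l"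
  shows "0 \<le> l"
proof (rule ccontr)
  assume "\<not> 0 \<le> l"
  then have "\<forall>\<^sub>F t in nhds l. ids G B t = 0"
    using eventually_nhds_in_open[of "{..<0}" l] by (auto elim: eventually_mono simp: ids_def)
  then have "isCont (ids G B) l" using isCont_cong[of "ids G B" "\<lambda>_. 0" l] by simp
  then show False using assms by simp
qed

lemma B_pow_bound: "cmod (B_pow k x y) \<le> K ^ k"
proof (induction k arbitrary: x)
  case 0 then show ?case by (simp add: mat_one_def)
next
  case (Suc k)
  show ?case
  proof (cases "x \<in> V")
    case True
    have "B_pow (Suc k) x y = (\<Sum>z\<in>gball rB x. B x z * B_pow k z y)"
      by (simp add: mat_mult_left_eq[OF B True _ order_refl ball_subset_verts] True)
    also have "cmod \<dots> \<le> (\<Sum>z\<in>gball rB x. cmod (B x z) * K ^ k)"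
      by (rule sum_norm_le) (simp add: norm_mult mult_left_mono Suc)
    also have "\<dots> = (\<Sum>z\<in>gball rB x. cmod (B x z)) * K ^ k" by (rule sum_distrib_right[symmetric])
    also have "\<dots> \<le> K * K ^ k" using row[of "gball rB x" x] True ball_subset_verts K_pos by (intro mult_right_mono) auto
    finally show ?thesis by simp
  next
    case False
    obtain r where "pat_inv r (B_pow (Suc k))" using B_pow_closed[of "Suc k"] unfolding pattern_invariant_iff by blast
    then have "B_pow (Suc k) x y = 0" using pat_inv_support(1) False by blast
    then show ?thesis using K_pos by simp
  qed
qed

lemma fin_mat_power_bound:
  assumes "finite Q" "Q \<subseteq> V"
  shows "cmod (fin_mat_power Q B k x y) \<le> K ^ k"
proof (induction k arbitrary: x)
  case (Suc k)
  have "cmod (fin_mat_power Q B (Suc k) x y) \<le> (\<Sum>z\<in>Q. cmod (B x z) * K ^ k)"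
    unfolding fin_mat_power.simps by (rule sum_norm_le) (simp add: norm_mult mult_left_mono Suc)
  also have "\<dots> = (\<Sum>z\<in>Q. cmod (B x z)) * K ^ k" by (rule sum_distrib_right[symmetric])
  also have "\<dots> \<le> K * K ^ k" using row[OF assms] K_pos by (intro mult_right_mono) auto
  finally show ?case by simp
qed simp

lemma fin_mat_power_eq:
  assumes Q: "finite Q" "Q \<subseteq> V"
  shows "x \<in> V \<Longrightarrow> gball (k * rB) x \<subseteq> Q \<Longrightarrow> fin_mat_power Q B k x y = B_pow k x y"
proof (induction k arbitrary: x)
  case 0 then show ?case by (simp add: mat_one_def)
next
  case (Suc k)
  have sub: "gball rB x \<subseteq> Q" using Suc.prems(2) ball_mono[of rB "Suc k * rB" x] by auto
  have "fin_mat_power Q B (Suc k) x y = (\<Sum>z\<in>Q. B x z * B_pow k z y)"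
    unfolding fin_mat_power.simps
  proof (intro sum.cong refl)
    fix z assume z: "z \<in> Q"
    show "B x z * fin_mat_power Q B k z y = B x z * B_pow k z y"
    proof (cases "B x z = 0")
      case False
      then have zb: "z \<in> gball rB x" by (rule pat_inv_support(3)[OF B])
      have "gball (k * rB) z \<subseteq> Q"
      proof
        fix w assume "w \<in> gball (k * rB) z"
        then have "w \<in> gball (rB + k * rB) x" by (rule ball_trans[OF Suc.prems(1) zb])
        then show "w \<in> Q" using Suc.prems(2) by auto
      qed
      then show ?thesis using Suc.IH[of z] z Q by auto
    qed simp
  qed
  also have "\<dots> = B_pow (Suc k) x y"
    using mat_mult_left_eq[OF B Suc.prems(1) Q(1) sub Q(2)] by simp
  finally show ?case .
qed

text \<open>The diagonal entry of the \<open>k\<close>-th power at \<open>x\<close> is a sum over walks of \<open>k\<close> steps, each of length at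
most \<open>rB\<close>. It changes under truncation to \<open>Q n\<close> only if \<open>x\<close> is within distance \<open>k * rB\<close> of the
complement of \<open>Q n\<close>, and the proportion of such points tends to 0 along a Folner sequence.\<close>

lemma folner_moments:
  assumes Q: "folner_sequence G Q"
  shows "(\<lambda>n. (\<Sum>x\<in>Q n. fin_mat_power (Q n) B k x x) / of_nat (card (Q n))) \<longlonglongrightarrow> inprod P (B_pow k) (mat_one G)"
proof -
  obtain N where N: "\<And>x. x \<in> V \<Longrightarrow> finite (gball (k * rB) x) \<and> card (gball (k * rB) x) \<le> N"
    using ball_bounded by blast
  note F = folnerD[OF Q]
  have "(\<lambda>n. (\<Sum>x\<in>Q n. B_pow k x x) / of_nat (card (Q n)) - (\<Sum>x\<in>Q n. fin_mat_power (Q n) B k x x) / of_nat (card (Q n))) \<longlonglongrightarrow> 0"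
  proof (rule Lim_null_comparison)
    show "(\<lambda>n. (2 * K ^ k * real N) * (real (card (boundary G (Q n))) / real (card (Q n)))) \<longlonglongrightarrow> 0"
      using tendsto_mult_left[OF F(5), of "2 * K ^ k * real N"] by simp
    show "\<forall>\<^sub>F n in sequentially. norm ((\<Sum>x\<in>Q n. B_pow k x x) / of_nat (card (Q n)) - (\<Sum>x\<in>Q n. fin_mat_power (Q n) B k x x) / of_nat (card (Q n)))
        \<le> (2 * K ^ k * real N) * (real (card (boundary G (Q n))) / real (card (Q n)))"
    proof (intro always_eventually allI)
      fix n
      define bad where "bad = {x \<in> Q n. \<not> gball (k * rB) x \<subseteq> Q n}"
      have "(\<Sum>x\<in>Q n. B_pow k x x) - (\<Sum>x\<in>Q n. fin_mat_power (Q n) B k x x) = (\<Sum>x\<in>Q n. B_pow k x x - fin_mat_power (Q n) B k x x)"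
        by (simp add: sum_subtractf)
      also have "\<dots> = (\<Sum>x\<in>bad. B_pow k x x - fin_mat_power (Q n) B k x x)"
        using F(1,3)[of n] fin_mat_power_eq[OF F(1,3)] by (intro sum.mono_neutral_right) (auto simp: bad_def)
      also have "cmod \<dots> \<le> (\<Sum>x\<in>bad. K ^ k + K ^ k)"
        by (rule sum_norm_le) (intro order_trans[OF norm_triangle_ineq4] add_mono B_pow_bound fin_mat_power_bound F(1,3))
      also have "\<dots> = 2 * K ^ k * real (card bad)" by simp
      also have "\<dots> \<le> 2 * K ^ k * real (N * card (boundary G (Q n)))"
        using card_bad_points[OF F(1,3), of "k * rB" N n] N K_pos unfolding bad_def
        by (intro mult_left_mono) (simp_all del: of_nat_mult)
      finally show "norm ((\<Sum>x\<in>Q n. B_pow k x x) / of_nat (card (Q n)) - (\<Sum>x\<in>Q n. fin_mat_power (Q n) B k x x) / of_nat (card (Q n)))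
        \<le> (2 * K ^ k * real N) * (real (card (boundary G (Q n))) / real (card (Q n)))"
        by (simp add: diff_divide_distrib[symmetric] norm_divide divide_right_mono mult.assoc)
    qed
  qed
  moreover have "(\<lambda>n. (\<Sum>x\<in>Q n. B_pow k x x) / of_nat (card (Q n))) \<longlonglongrightarrow> inprod P (B_pow k) (mat_one G)"
    using B_pow_mean[of k] Q unfolding folner_mean_def by blast
  from tendsto_diff[OF this calculation] show ?thesis by simp
qed

text \<open>For a common denominator \<open>D\<close> the compressions of \<open>D B\<close> are symmetric integer matrices, whose
eigenvalues \<open>e\<close> satisfy: the averages of \<open>g(e / D)\<close> converge to the integral of \<open>g\<close> against \<open>\<mu>\<close>
for polynomials \<open>g\<close>. For every \<open>m\<close> a polynomial that is small at \<open>D l\<close> shows that at most the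
proportion \<open>1 / m\<close> of the numbers \<open>e / D\<close> lies near \<open>l\<close>. Testing with a polynomial close to a bump
function at \<open>l\<close> carries this bound over to the atom.\<close>

lemma rational_atom_zero:
  assumes rat: "\<And>x y. x \<in> V \<Longrightarrow> y \<in> V \<Longrightarrow> B x y \<in> \<rat>" and tr: "\<not> algebraic l"
  shows "measure \<mu> {l} = 0"
proof -
  interpret fm: finite_measure \<mu> by (rule mu(2))
  \<comment> \<open>each row consists of finitely many values, determined by a pattern\<close>
  define S where "S = {B x y |x y. x \<in> V \<and> y \<in> V}"
  have "pattern_fun rB (\<lambda>x. B x ` gball rB x)"
    unfolding pattern_fun_def
  proof (intro ballI allI impI)
    fix x x' \<phi> assume x: "x \<in> V" "x' \<in> V" and iso: "ball_iso G rB x x' \<phi>"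
    have "B x' ` gball rB x' = (\<lambda>y. B (\<phi> x) (\<phi> y)) ` gball rB x"
      using ball_isoD(1,2)[OF iso] by (simp add: bij_betw_def image_image[symmetric] flip: image_image)
    also have "\<dots> = B x ` gball rB x"
      using pat_inv_entry[OF B iso x(1) ball_self[OF x(1), of 0]] by (intro image_cong refl) simp
    finally show "B x ` gball rB x = B x' ` gball rB x'" by simp
  qed
  then have "finite (\<Union>x\<in>V. B x ` gball rB x)"
    by (intro finite_Union[OF pattern_fun_finite_range]) auto
  moreover have "S \<subseteq> insert 0 (\<Union>x\<in>V. B x ` gball rB x)"
    unfolding S_def using pat_inv_support(3)[OF B] by blast
  ultimately have finS: "finite S" by (meson finite_insert finite_subset)
  have "S \<subseteq> \<rat>" using rat unfolding S_def by blast
  from common_denominator[OF finS this]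
  obtain D :: nat where D: "0 < D" "\<And>s. s \<in> S \<Longrightarrow> of_nat D * s \<in> \<int>" by blast
  define Bi where "Bi = (\<lambda>x y. \<lfloor>Re (of_nat D * B x y)\<rfloor>)"
  have Bi: "of_int (Bi x y) = of_nat D * B x y" for x y
  proof -
    have "of_nat D * B x y \<in> \<int>"
    proof (cases "B x y = 0")
      case False
      then have "B x y \<in> S" unfolding S_def using pat_inv_support(1,2)[OF B] by blast
      then show ?thesis by (rule D(2))
    qed simp
    then obtain z where "of_nat D * B x y = of_int z" by (elim Ints_cases)
    then show ?thesis unfolding Bi_def by simp
  qed
  have Bi_sym: "Bi x y = Bi y x" for x y
  proof -
    have "(of_int (Bi x y) :: complex) = cnj (of_int (Bi y x))" unfolding Bi by (simp add: herm[of x])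
    then have "(of_int (Bi x y) :: complex) = of_int (Bi y x)" by simp
    then show ?thesis by (simp only: of_int_eq_iff)
  qed
  have Bi_abs: "real_of_int \<bar>Bi x y\<bar> = real D * cmod (B x y)" for x y
  proof -
    have "real_of_int \<bar>Bi x y\<bar> = cmod (of_int (Bi x y))" by simp
    then show ?thesis unfolding Bi by (simp add: norm_mult)
  qed
  have Bi_pow: "of_int (fin_mat_power R Bi k x y) = of_nat D ^ k * fin_mat_power R B k x y" for R k x y
    by (induction k arbitrary: x) (simp_all add: Bi sum_distrib_left mult_ac)
  obtain Q where Q: "folner_sequence G Q" by (rule folner_exists)
  note F = folnerD[OF Q]
  \<comment> \<open>the eigenvalues of the compression of \<open>D B\<close> to \<open>Q n\<close>\<close>
  define spectrum where "spectrum = (\<lambda>n es. length es = card (Q n) \<and> (\<forall>e\<in>set es. \<bar>e\<bar> \<le> real D * K)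
      \<and> (\<forall>k. real_of_int (\<Sum>x\<in>Q n. fin_mat_power (Q n) Bi k x x) = (\<Sum>e\<leftarrow>es. e ^ k))
      \<and> (\<forall>f :: int poly. 1 \<le> (\<Prod>e\<leftarrow>filter (\<lambda>e. poly (of_int_poly f) e \<noteq> 0) es. \<bar>poly (of_int_poly f) e\<bar>)))"
  have "\<exists>es. spectrum n es" for n
  proof -
    have "(\<Sum>y\<in>Q n. real_of_int \<bar>Bi x y\<bar>) \<le> real D * K" for x
      unfolding Bi_abs sum_distrib_left[symmetric] by (intro mult_left_mono row F(1,3)) simp
    then show ?thesis
      unfolding spectrum_def
      by (rule finite_matrix_spectrum[where Q = "Q n" and A = Bi and M = "real D * K", OF F(1) Bi_sym]) blast
  qed
  then obtain es where "\<And>n. spectrum n (es n)" by metis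
  then have es: "\<And>n. length (es n) = card (Q n)" "\<And>n e. e \<in> set (es n) \<Longrightarrow> \<bar>e\<bar> \<le> real D * K"
    "\<And>n k. real_of_int (\<Sum>x\<in>Q n. fin_mat_power (Q n) Bi k x x) = (\<Sum>e\<leftarrow>es n. e ^ k)"
    "\<And>n f. 1 \<le> (\<Prod>e\<leftarrow>filter (\<lambda>e. poly (of_int_poly f) e \<noteq> 0) (es n). \<bar>poly (of_int_poly f) e\<bar>)"
    unfolding spectrum_def by blast+
  have lim_mom: "(\<lambda>n. complex_of_real ((\<Sum>e\<leftarrow>es n. (e / real D) ^ k) / real (card (Q n)))) \<longlonglongrightarrow> inprod P (B_pow k) (mat_one G)" for k
  proof -
    have "complex_of_real ((\<Sum>e\<leftarrow>es n. (e / real D) ^ k) / real (card (Q n)))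
        = (\<Sum>x\<in>Q n. fin_mat_power (Q n) B k x x) / of_nat (card (Q n))" for n
    proof -
      have "(\<Sum>e\<leftarrow>xs. (e / real D) ^ k) = (\<Sum>e\<leftarrow>xs. e ^ k) / real D ^ k" for xs
        by (induction xs) (simp_all add: power_divide add_divide_distrib)
      moreover have "complex_of_real (\<Sum>e\<leftarrow>es n. e ^ k) = of_nat D ^ k * (\<Sum>x\<in>Q n. fin_mat_power (Q n) B k x x)"
        unfolding es(3)[symmetric] by (simp add: Bi_pow sum_distrib_left)
      ultimately show ?thesis using D(1) by simp
    qed
    then show ?thesis by (simp only: folner_moments[OF Q])
  qed
  \<comment> \<open>weak convergence of the normalised eigenvalue counts, tested on polynomials\<close>
  have lim_poly: "(\<lambda>n. (\<Sum>e\<leftarrow>es n. poly g (e / real D)) / real (card (Q n))) \<longlonglongrightarrow> (LINT t|\<mu>. poly g t)" for g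
  proof -
    have "(\<lambda>n. \<Sum>i\<le>degree g. complex_of_real (coeff g i) * complex_of_real ((\<Sum>e\<leftarrow>es n. (e / real D) ^ i) / real (card (Q n))))
        \<longlonglongrightarrow> (\<Sum>i\<le>degree g. complex_of_real (coeff g i) * inprod P (B_pow i) (mat_one G))"
      by (intro tendsto_sum tendsto_mult_left lim_mom)
    moreover have "(\<Sum>i\<le>degree g. complex_of_real (coeff g i) * inprod P (B_pow i) (mat_one G)) = complex_of_real (LINT t|\<mu>. poly g t)"
      unfolding \<mu>_def HO.spectral_measure(4)[OF one_in, symmetric] HO.poly_form_def moments ..
    moreover have "(\<Sum>i\<le>degree g. complex_of_real (coeff g i) * complex_of_real ((\<Sum>e\<leftarrow>es n. (e / real D) ^ i) / real (card (Q n))))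
        = complex_of_real ((\<Sum>e\<leftarrow>es n. poly g (e / real D)) / real (card (Q n)))" for n
    proof -
      have "(\<Sum>e\<leftarrow>xs. poly g (e / real D)) = (\<Sum>i\<le>degree g. coeff g i * (\<Sum>e\<leftarrow>xs. (e / real D) ^ i))" for xs
        by (induction xs) (simp_all add: poly_altdef distrib_left sum.distrib)
      then show ?thesis by (simp add: sum_divide_distrib)
    qed
    ultimately have "(\<lambda>n. complex_of_real ((\<Sum>e\<leftarrow>es n. poly g (e / real D)) / real (card (Q n)))) \<longlonglongrightarrow> complex_of_real (LINT t|\<mu>. poly g t)"
      by simp
    then show ?thesis by (simp only: tendsto_of_real_iff)
  qed
  have bound: "measure \<mu> {l} \<le> 1 / real m + \<delta> * (1 + measure \<mu> (space \<mu>))" if m: "0 < m" and \<delta>: "0 < \<delta>" for m :: nat and \<delta> :: real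
  proof -
    define M where "M = real D * K + \<bar>real D * l\<bar> + 1"
    have trD: "\<not> algebraic (real D * l)" using tr algebraic_scale D(1) by blast
    have DK: "0 \<le> real D * K" using K_pos by simp
    have M1: "1 \<le> M" "\<bar>real D * l\<bar> \<le> M" using DK by (auto simp: M_def)
    obtain f :: "int poly" and F0 \<eta> :: real where f: "1 < F0" "0 < \<eta>" "F0 ^ m * \<eta> \<le> 1"
      "\<And>t. \<bar>t\<bar> \<le> M \<Longrightarrow> \<bar>poly (of_int_poly f) t\<bar> \<le> F0"
      "0 < \<bar>poly (of_int_poly f) (real D * l)\<bar>" "2 * \<bar>poly (of_int_poly f) (real D * l)\<bar> \<le> \<eta>"
      by (rule integer_poly_small_at_transcendental[OF M1 trD, of m]) (rule that)
    define v where "v = poly (of_int_poly f :: real poly)"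
    \<comment> \<open>near \<open>l\<close> the value of \<open>f\<close> stays nonzero and at most doubles; hence the factor 2 in the choice of \<open>\<eta>\<close>\<close>
    have "isCont (\<lambda>t. v (real D * t)) l" unfolding v_def by (intro continuous_intros)
    then have "\<forall>e>0. \<exists>\<delta>>0. \<forall>t. \<bar>t - l\<bar> < \<delta> \<longrightarrow> \<bar>v (real D * t) - v (real D * l)\<bar> < e"
      unfolding continuous_at_eps_delta dist_real_def .
    moreover have "0 < \<bar>v (real D * l)\<bar>" unfolding v_def by (rule f(5))
    ultimately obtain \<epsilon> where \<epsilon>: "0 < \<epsilon>" "\<And>t. \<bar>t - l\<bar> < \<epsilon> \<Longrightarrow> \<bar>v (real D * t) - v (real D * l)\<bar> < \<bar>v (real D * l)\<bar>"
      by blast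
    define near where "near = (\<lambda>e. \<bar>e / real D - l\<bar> < \<epsilon>)"
    have near: "v e \<noteq> 0 \<and> \<bar>v e\<bar> \<le> \<eta>" if "near e" for e
    proof -
      have "\<bar>v e - v (real D * l)\<bar> < \<bar>v (real D * l)\<bar>"
        using \<epsilon>(2)[of "e / real D"] that D(1) unfolding near_def by simp
      then show ?thesis using f(6) unfolding v_def[symmetric] by linarith
    qed
    \<comment> \<open>at most one eigenvalue in \<open>m\<close> is near \<open>l\<close>\<close>
    have count: "m * length (filter near (es n)) \<le> card (Q n)" for n
    proof -
      have "length (filter near xs) \<le> length (filter (\<lambda>e. v e \<noteq> 0 \<and> \<bar>v e\<bar> \<le> \<eta>) xs)" for xs
        using near by (induction xs) auto
      then have "m * length (filter near (es n)) \<le> m * length (filter (\<lambda>e. v e \<noteq> 0 \<and> \<bar>v e\<bar> \<le> \<eta>) (es n))"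
        by simp
      also have "\<dots> \<le> length (es n)"
      proof (rule few_small_values[OF f(1-3)])
        show "\<bar>v e\<bar> \<le> F0" if "e \<in> set (es n)" for e
          unfolding v_def using es(2)[OF that] by (intro f(4)) (simp add: M_def)
        show "1 \<le> (\<Prod>e\<leftarrow>filter (\<lambda>e. v e \<noteq> 0) (es n). \<bar>v e\<bar>)" unfolding v_def by (rule es(4))
      qed
      finally show ?thesis by (simp add: es(1))
    qed
    \<comment> \<open>a bump function of height 1 at \<open>l\<close>, supported where eigenvalues are rare\<close>
    define h where "h = (\<lambda>t. max 0 (1 - \<bar>t - l\<bar> / \<epsilon>))"
    have h: "0 \<le> h t" "h t \<le> 1" "h l = 1" "\<not> \<bar>t - l\<bar> < \<epsilon> \<Longrightarrow> h t = 0" for t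
      using \<epsilon>(1) by (auto simp: h_def field_simps)
    have "continuous_on {-K..K} h" unfolding h_def using \<epsilon>(1) by (intro continuous_intros) auto
    then obtain g where g0: "\<And>t. t \<in> {-K..K} \<Longrightarrow> \<bar>h t - poly g t\<bar> < \<delta>"
      using continuous_poly_approximation \<delta> by blast
    have g: "\<bar>h t - poly g t\<bar> < \<delta>" if "\<bar>t\<bar> \<le> K" for t
      using g0[of t] that by (simp add: abs_le_iff minus_le_iff)
    have sum_le: "(\<Sum>e\<leftarrow>xs. poly g (e / real D)) \<le> real (length (filter near xs)) + \<delta> * real (length xs)"
      if "\<And>e. e \<in> set xs \<Longrightarrow> \<bar>e\<bar> \<le> real D * K" for xs
      using that
    proof (induction xs)
      case (Cons e xs)
      have "\<bar>e / real D\<bar> \<le> K" using Cons.prems[of e] D(1) by (simp add: divide_le_eq mult.commute)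
      then have "\<bar>h (e / real D) - poly g (e / real D)\<bar> < \<delta>" by (rule g)
      then have "poly g (e / real D) \<le> (if near e then 1 else 0) + \<delta>"
        using h(2)[of "e / real D"] h(4)[of "e / real D"] unfolding near_def by (auto simp: abs_less_iff)
      moreover have "(\<Sum>e\<leftarrow>xs. poly g (e / real D)) \<le> real (length (filter near xs)) + \<delta> * real (length xs)"
        using Cons by simp
      ultimately show ?case by (auto simp: distrib_left)
    qed simp
    have avg: "(\<Sum>e\<leftarrow>es n. poly g (e / real D)) / real (card (Q n)) \<le> 1 / real m + \<delta>" for n
    proof -
      have "real m * real (length (filter near (es n))) \<le> real (card (Q n))"
        using count[of n] by (metis of_nat_le_iff of_nat_mult)
      then have "real (length (filter near (es n))) \<le> real (card (Q n)) / real m"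
        using m by (simp add: le_divide_eq mult.commute)
      then have "(\<Sum>e\<leftarrow>es n. poly g (e / real D)) \<le> real (card (Q n)) / real m + \<delta> * real (card (Q n))"
        using sum_le[of "es n"] es(1,2) by fastforce
      also have "\<dots> = (1 / real m + \<delta>) * real (card (Q n))" by (simp add: distrib_right)
      finally show ?thesis using F(4)[of n] by (simp add: divide_le_eq)
    qed
    have int_g: "(LINT t|\<mu>. poly g t) \<le> 1 / real m + \<delta>"
      by (rule LIMSEQ_le_const2[OF lim_poly]) (use avg in blast)
    have hb: "h \<in> borel_measurable borel" unfolding h_def by measurable
    have int_h: "integrable \<mu> h"
      by (rule integrable_bounded_on_support[OF mu(2,1,3) hb, of 1]) (use h in auto)
    have int_p: "integrable \<mu> (poly g)" by (rule integrable_poly[OF mu(2,1,3)])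
    have "measure \<mu> {l} = (LINT t|\<mu>. indicat_real {l} t)" using sets_eq_imp_space_eq[OF mu(1)] by simp
    also have "\<dots> \<le> (LINT t|\<mu>. h t)"
    proof (rule integral_mono[OF _ int_h])
      show "integrable \<mu> (indicat_real {l})" using mu(1) by (simp add: fm.integrable_const_bound[of _ 1])
      show "indicat_real {l} t \<le> h t" for t using h by (auto simp: indicator_def)
    qed
    also have "\<dots> \<le> (LINT t|\<mu>. poly g t + \<delta>)"
    proof (rule integral_mono_AE[OF int_h])
      show "integrable \<mu> (\<lambda>t. poly g t + \<delta>)" using int_p by simp
      show "AE t in \<mu>. h t \<le> poly g t + \<delta>"
        using mu(3)
      proof eventually_elim
        case (elim t)
        then show ?case using g[of t] by (simp add: abs_less_iff)
      qed
    qed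
    also have "\<dots> = (LINT t|\<mu>. poly g t) + \<delta> * measure \<mu> (space \<mu>)" using int_p by simp
    finally show ?thesis using int_g by (simp add: distrib_left)
  qed
  have "measure \<mu> {l} \<le> 0 + e" if e: "0 < e" for e
  proof -
    obtain m :: nat where m: "0 < m" "1 / real m < e / 2"
      using reals_Archimedean[of "e / 2"] e by (metis half_gt_zero inverse_eq_divide zero_less_Suc)
    define c where "c = 1 + measure \<mu> (space \<mu>)"
    have c: "0 < c" by (simp add: c_def add_pos_nonneg)
    have "measure \<mu> {l} \<le> 1 / real m + e / (2 * c) * c"
      using bound[OF m(1), of "e / (2 * c)"] e c by (simp add: c_def[symmetric])
    also have "e / (2 * c) * c = e / 2" using c by simp
    finally show ?thesis using m(2) by simp
  qed
  then have "measure \<mu> {l} \<le> 0" by (rule field_le_epsilon)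
  then show ?thesis using measure_nonneg[of \<mu> "{l}"] by linarith
qed

end

theorem corollary1p1:
  fixes G :: "'v graph" and B :: "'v \<Rightarrow> 'v \<Rightarrow> complex" and l :: real
  assumes "AQ_graph G"
    and "B \<in> pattern_invariant G"
    and "self_adjoint_on_l2 G B"
    and "positive_on_l2 G B"
    and "\<forall>x\<in>verts G. \<forall>y\<in>verts G. B x y \<in> \<rat>"
    and "\<not> isCont (ids G B) l"
  shows "algebraic l"
proof (rule ccontr)
  assume tr: "\<not> algebraic l"
  interpret aq_graph G by unfold_locales (rule assms(1))
  obtain r where r: "pat_inv r B" using assms(2) unfolding pattern_invariant_iff by blast
  obtain K where K: "0 < K" "\<And>x F. finite F \<Longrightarrow> F \<subseteq> V \<Longrightarrow> (\<Sum>y\<in>F. cmod (B x y)) \<le> K"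
    using pat_inv_row_bound[OF r] by blast
  interpret aq_operator G B r K
  proof unfold_locales
    show "B y x = cnj (B x y)" for x y by (rule self_adjoint_hermitian[OF r assms(3)])
  qed (fact r, fact K(1), fact K(2))
  have "0 \<le> l" by (rule not_isCont_ids[OF assms(6)])
  moreover have "algebraic (0 :: real)"
    unfolding algebraic_def by (rule exI[of _ "[:0, 1:]"]) (auto simp: coeff_pCons split: nat.splits)
  then have "l \<noteq> 0" using tr by blast
  moreover have "measure \<mu> {l} = 0" using rational_atom_zero[OF _ tr] assms(5) by blast
  ultimately show False using isCont_ids[of l] assms(6) by simp
qed

end
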